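(* Let $\mathcal{F}$ be a harmonic foliation on a Riemannian manifold $(M,g_0)$, let $\Phi:M\to\mathbb{R}$ be leaf-wise constant, and let a family of metrics $g_t$ $(0\le t<t_0)$ solve $$\partial_t g=-2\,(\mathrm{Sc}_{\rm mix}(g)-\Phi)\,g^\perp .$$ Then $$\partial_t H+\nabla^{\mathcal{F}}\|H\|_g^2=n\nabla^{\mathcal{F}}(\mathrm{div}_{\mathcal{F}}H)+n\nabla^{\mathcal{F}}\big(\|T\|_g^2-\|h_{\mathcal{F}}\|_g^2-n\,\beta_{\mathcal{D}}\big).$$ Suppose that $H_0=-n\nabla^{\mathcal{F}}\log u_0$ for a function $u_0>0$, and put $\Psi_1^{\mathcal{F}}=u_0^2\|h_{\mathcal{F}}\|_{g_0}^2$, $\Psi_2^{\mathcal{F}}=u_0^4\|T\|_{g_0}^2$. Then $H_t=-n\nabla^{\mathcal{F}}\log u$ for some positive function $u$ on $M\times[0,t_0)$; moreover: (i) if $\Psi_2^{\mathcal{F}}\ne0$ (at every point), then $u=(\Psi_2^{\mathcal{F}})^{1/4}\|T\|_{g_t}^{-1/2}$, and the non-linear PDE $$\tfrac1n\,\partial_t u=\Delta_{\mathcal{F}}u+\Big(\beta_{\mathcal{D}}+\frac{\Phi}{n}\Big)u+\frac{\Psi_1^{\mathcal{F}}}{n}\,u^{-1}-\frac{\Psi_2^{\mathcal{F}}}{n}\,u^{-3},\qquad u(\cdot,0)=u_0,$$ is satisfied; (ii) if $\Psi_1^{\mathcal{F}}\equiv0\equiv\Psi_2^{\mathcal{F}}$,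 then the potential function $u$ may be chosen as a solution of the linear PDE $$\tfrac1n\,\partial_t u=\Delta_{\mathcal{F}}u+\beta_{\mathcal{D}}\,u,\qquad u(\cdot,0)=u_0 .$$
   Context: Setting: $M$ is a connected closed manifold of dimension $n+p$ with a $p$-dimensional foliation $\mathcal{F}$; for a Riemannian metric $g$, $TM=\mathcal{D}_{\mathcal{F}}\oplus\mathcal{D}$ orthogonally, where $\mathcal{D}_{\mathcal{F}}$ is tangent to $\mathcal{F}$ and $\dim\mathcal{D}=n$. Everything (manifolds, foliations, etc.) is $C^\infty$ and oriented, and all leaves are compact minimal submanifolds. Solutions $g_t$ are smooth on the leaves. $(\cdot)^{\mathcal{F}}$ and $(\cdot)^\perp$ denote projections onto $\mathcal{D}_{\mathcal{F}}$ and $\mathcal{D}$; $\nabla$ is the Levi-Civita connection. For $X,Y\in\mathcal{D}_{\mathcal{F}}$: $h_{\mathcal{F}}(X,Y)=(\nabla_XY)^\perp$, $H_{\mathcal{F}}=\mathrm{Tr}_g h_{\mathcal{F}}$; $\mathcal{F}$ is harmonic if $H_{\mathcal{F}}=0$. For $X,Y\in\mathcal{D}$: $h(X,Y)=\frac12(\nabla_XY+\nabla_YX)^{\mathcal{F}}$, $T(X,Y)=\frac12[X,Y]^{\mathcal{F}}$, and $H=\mathrm{Tr}_g h$ is the mean curvature vector of $\mathcal{D}$ ($H_t$ when computed with $g_t$). Norms of $h,T,h_{\mathcal{F}}$ are tensor norms, i.e. the square is the sum of squared norms over pairs of vectors of an orthonormal frame. $\beta_{\mathcal{D}}=n^{-2}(n\|h\|^2-\|H\|^2)\ge0$.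 $\mathrm{Sc}_{\rm mix}(g)=\sum_{i=1}^n\sum_{\alpha=1}^p R(\mathcal{E}_\alpha,E_i,\mathcal{E}_\alpha,E_i)$ is the sum of the sectional curvatures of the planes spanned by $E_i,\mathcal{E}_\alpha$, for an adapted local orthonormal frame $E_i\in\mathcal{D}$, $\mathcal{E}_\alpha\in\mathcal{D}_{\mathcal{F}}$. The truncated metric is $g^\perp(X_1,X_2)=g(X_1^\perp,X_2^\perp)$. For functions, $\nabla^{\mathcal{F}}f=(\nabla f)^{\mathcal{F}}$; for vector fields, $\mathrm{div}_{\mathcal{F}}X=\sum_\alpha g(\nabla_{\mathcal{E}_\alpha}X,\mathcal{E}_\alpha)$; $\Delta_{\mathcal{F}}u=\mathrm{div}_{\mathcal{F}}(\nabla^{\mathcal{F}}u)$ is the leaf-wise Laplacian. These operators on the leaves do not depend on $t$. *)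

theory Defs
  imports "HOL-Analysis.Analysis"
begin

section \<open>Differentiability classes\<close>

text \<open>Derivatives are taken within \<open>S\<close>.  Below, \<open>S\<close> is an open set or a product of a
  half-open time interval with an open set; on both, derivatives within \<open>S\<close> are unique.\<close>

primrec Ck_on ::
    "nat \<Rightarrow> 'b::real_normed_vector set \<Rightarrow> ('b \<Rightarrow> 'c::real_normed_vector) \<Rightarrow> bool" where
  "Ck_on 0 S f = continuous_on S f"
| "Ck_on (Suc k) S f = (f differentiable_on S \<and>
     (\<forall>v. Ck_on k S (\<lambda>x. frechet_derivative f (at x within S) v)))"

definition smooth_on :: "'b::real_normed_vector set \<Rightarrow> ('b \<Rightarrow> 'c::real_normed_vector) \<Rightarrow> bool" where
  "smooth_on S f \<longleftrightarrow> (\<forall>k. Ck_on k S f)"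


section \<open>Foliated manifolds\<close>

text \<open>A foliated chart takes values in \<open>\<real>\<^sup>p \<times> \<real>\<^sup>n\<close>; the plaques are the slices on which the
  second component is constant.  A chart is a pair of a domain and a coordinate map on it.\<close>

type_synonym ('p, 'n) pt = "(real ^ 'p) \<times> (real ^ 'n)"
type_synonym ('a, 'p, 'n) chart = "'a set \<times> ('a \<Rightarrow> ('p, 'n) pt)"

abbreviation cdom :: "('a, 'p::finite, 'n::finite) chart \<Rightarrow> 'a set" where
  "cdom c \<equiv> fst c"

abbreviation coords :: "('a, 'p::finite, 'n::finite) chart \<Rightarrow> 'a \<Rightarrow> ('p, 'n) pt" where
  "coords c \<equiv> snd c"

definition cimg :: "('a, 'p::finite, 'n::finite) chart \<Rightarrow> ('p, 'n) pt set" where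
  "cimg c = coords c ` cdom c"

definition cinv :: "('a, 'p::finite, 'n::finite) chart \<Rightarrow> ('p, 'n) pt \<Rightarrow> 'a" where
  "cinv c = inv_into (cdom c) (coords c)"

definition transition ::
    "('a, 'p::finite, 'n::finite) chart \<Rightarrow> ('a, 'p, 'n) chart \<Rightarrow> ('p, 'n) pt \<Rightarrow> ('p, 'n) pt" where
  "transition c c' = coords c' \<circ> cinv c"

definition overlap ::
    "('a, 'p::finite, 'n::finite) chart \<Rightarrow> ('a, 'p, 'n) chart \<Rightarrow> ('p, 'n) pt set" where
  "overlap c c' = coords c ` (cdom c \<inter> cdom c')"

definition smooth_atlas :: "('a::topological_space, 'p::finite, 'n::finite) chart set \<Rightarrow> bool" where
  "smooth_atlas A \<longleftrightarrow>
     (\<Union>c\<in>A. cdom c) = UNIV \<and>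
     (\<forall>c\<in>A. open (cdom c) \<and> open (cimg c) \<and>
            homeomorphism (cdom c) (cimg c) (coords c) (cinv c)) \<and>
     (\<forall>c\<in>A. \<forall>c'\<in>A. smooth_on (overlap c c') (transition c c'))"

text \<open>Transition maps have, locally, the form \<open>(x, y) \<mapsto> (\<alpha> (x, y), \<gamma> y)\<close>.\<close>

definition foliated_atlas :: "('a::topological_space, 'p::finite, 'n::finite) chart set \<Rightarrow> bool" where
  "foliated_atlas A \<longleftrightarrow> smooth_atlas A \<and>
     (\<forall>c\<in>A. \<forall>c'\<in>A. \<forall>z\<in>overlap c c'.
        \<exists>W \<gamma>. open W \<and> z \<in> W \<and> W \<subseteq> overlap c c' \<and>
              (\<forall>w\<in>W. snd (transition c c' w) = \<gamma> (snd w)))"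

text \<open>The two determinants express that the atlas orients the leaves and the normal bundle;
  the Jacobian of a transition map is block triangular, so the manifold is oriented too.\<close>

definition oriented_atlas :: "('a::topological_space, 'p::finite, 'n::finite) chart set \<Rightarrow> bool" where
  "oriented_atlas A \<longleftrightarrow>
     (\<forall>c\<in>A. \<forall>c'\<in>A. \<forall>z\<in>overlap c c'.
        let D = frechet_derivative (transition c c') (at z) in
          det (matrix (\<lambda>v. fst (D (v, 0)))) > 0 \<and> det (matrix (\<lambda>w. snd (D (0, w)))) > 0)"

text \<open>The leaves are the classes of the equivalence relation generated by lying on a common
  plaque; the leaf topology is generated by the open subsets of plaques.\<close>

definition same_plaque :: "('a, 'p::finite, 'n::finite) chart set \<Rightarrow> 'a \<Rightarrow> 'a \<Rightarrow> bool" where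
  "same_plaque A x x' \<longleftrightarrow> (\<exists>c\<in>A. x \<in> cdom c \<and> x' \<in> cdom c \<and>
     connected_component (cimg c \<inter> {w. snd w = snd (coords c x)}) (coords c x) (coords c x'))"

definition leaf :: "('a, 'p::finite, 'n::finite) chart set \<Rightarrow> 'a \<Rightarrow> 'a set" where
  "leaf A x = {x'. (same_plaque A)\<^sup>*\<^sup>* x x'}"

definition leaf_topology :: "('a, 'p::finite, 'n::finite) chart set \<Rightarrow> 'a topology" where
  "leaf_topology A = topology_generated_by
     {{x \<in> cdom c. coords c x \<in> W \<and> snd (coords c x) = y} |c W y. c \<in> A \<and> open W}"

definition leafwise_constant :: "('a, 'p::finite, 'n::finite) chart set \<Rightarrow> ('a \<Rightarrow> 'b) \<Rightarrow> bool" where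
  "leafwise_constant A f \<longleftrightarrow> (\<forall>x. \<forall>x'\<in>leaf A x. f x' = f x)"

definition closed_foliated_manifold ::
    "('a::{t2_space, second_countable_topology}, 'p::finite, 'n::finite) chart set \<Rightarrow> bool" where
  "closed_foliated_manifold A \<longleftrightarrow>
     foliated_atlas A \<and> oriented_atlas A \<and>
     compact (UNIV :: 'a set) \<and> connected (UNIV :: 'a set) \<and>
     (\<forall>x. compactin (leaf_topology A) (leaf A x))"

text \<open>Leafwise smoothness of a function, respectively of a family of functions with parameter
  \<open>t \<in> J\<close> (smooth in \<open>t\<close> and the leaf variable jointly).  Nothing is required transversely.\<close>

definition leaf_smooth :: "('a, 'p::finite, 'n::finite) chart set \<Rightarrow> ('a \<Rightarrow> real) \<Rightarrow> bool" where
  "leaf_smooth A f \<longleftrightarrow>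
     (\<forall>c\<in>A. \<forall>y. smooth_on {x. (x, y) \<in> cimg c} (\<lambda>x. f (cinv c (x, y))))"

definition leaf_smooth_family ::
    "('a, 'p::finite, 'n::finite) chart set \<Rightarrow> real set \<Rightarrow> (real \<Rightarrow> 'a \<Rightarrow> real) \<Rightarrow> bool" where
  "leaf_smooth_family A J f \<longleftrightarrow>
     (\<forall>c\<in>A. \<forall>y. smooth_on (J \<times> {x. (x, y) \<in> cimg c}) (\<lambda>(t, x). f t (cinv c (x, y))))"


section \<open>Riemannian metrics\<close>

text \<open>A tensor field on the manifold is the family of its chart expressions.  In one chart, a
  metric is a field of bilinear forms on the coordinate space \<open>\<real>\<^sup>p \<times> \<real>\<^sup>n\<close>.\<close>

type_synonym ('p, 'n) form_field = "('p, 'n) pt \<Rightarrow> ('p, 'n) pt \<Rightarrow> ('p, 'n) pt \<Rightarrow> real"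
type_synonym ('p, 'n) vfield = "('p, 'n) pt \<Rightarrow> ('p, 'n) pt"
type_synonym ('a, 'p, 'n) metric = "('a, 'p, 'n) chart \<Rightarrow> ('p, 'n) form_field"

definition riemannian_metric ::
    "nat \<Rightarrow> ('a, 'p::finite, 'n::finite) chart set \<Rightarrow> ('a, 'p, 'n) metric \<Rightarrow> bool" where
  "riemannian_metric k A g \<longleftrightarrow>
     (\<forall>c\<in>A. \<forall>z\<in>cimg c. bilinear (g c z) \<and> (\<forall>v w. g c z v w = g c z w v) \<and>
                      (\<forall>v. v \<noteq> 0 \<longrightarrow> g c z v v > 0)) \<and>
     (\<forall>c\<in>A. \<forall>v w. Ck_on k (cimg c) (\<lambda>z. g c z v w)) \<and>
     (\<forall>c\<in>A. \<forall>c'\<in>A. \<forall>z\<in>overlap c c'. \<forall>v w.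
        let D = frechet_derivative (transition c c') (at z) in
          g c z v w = g c' (transition c c' z) (D v) (D w))"

definition leaf_smooth_metrics ::
    "('a, 'p::finite, 'n::finite) chart set \<Rightarrow> real set \<Rightarrow> (real \<Rightarrow> ('a, 'p, 'n) metric) \<Rightarrow> bool" where
  "leaf_smooth_metrics A J g \<longleftrightarrow>
     (\<forall>c\<in>A. \<forall>y v w. smooth_on (J \<times> {x. (x, y) \<in> cimg c}) (\<lambda>(t, x). g t c (x, y) v w))"


section \<open>Riemannian geometry in a chart\<close>

text \<open>Derivatives are taken along lines, so that they make sense in leaf directions for
  functions that are only leafwise differentiable.\<close>

definition dirder ::
    "('b::real_normed_vector \<Rightarrow> 'c::real_normed_vector) \<Rightarrow> 'b \<Rightarrow> 'b \<Rightarrow> 'c" where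
  "dirder f z v = vector_derivative (\<lambda>s. f (z + s *\<^sub>R v)) (at 0)"

definition lie_bracket ::
    "('p::finite, 'n::finite) vfield \<Rightarrow> ('p, 'n) vfield \<Rightarrow> ('p, 'n) vfield" where
  "lie_bracket X Y z = dirder Y z (X z) - dirder X z (Y z)"

text \<open>The Levi-Civita connection is the torsion-free connection (i.e. with symmetric Christoffel
  map) that is compatible with the metric.\<close>

definition christoffel ::
    "('p::finite, 'n::finite) form_field \<Rightarrow> ('p, 'n) pt \<Rightarrow> ('p, 'n) pt \<Rightarrow> ('p, 'n) pt \<Rightarrow> ('p, 'n) pt" where
  "christoffel G z = (THE \<Gamma>. bilinear \<Gamma> \<and> (\<forall>v w. \<Gamma> v w = \<Gamma> w v) \<and>
     (\<forall>u v w. dirder (\<lambda>z'. G z' v w) z u = G z (\<Gamma> u v) w + G z v (\<Gamma> u w)))"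

definition nabla ::
    "('p::finite, 'n::finite) form_field \<Rightarrow> ('p, 'n) vfield \<Rightarrow> ('p, 'n) vfield \<Rightarrow> ('p, 'n) vfield" where
  "nabla G X Y z = dirder Y z (X z) + christoffel G z (X z) (Y z)"

definition curvature ::
    "('p::finite, 'n::finite) form_field \<Rightarrow> ('p, 'n) vfield \<Rightarrow> ('p, 'n) vfield \<Rightarrow> ('p, 'n) vfield
      \<Rightarrow> ('p, 'n) vfield" where
  "curvature G X Y Z z =
     nabla G X (nabla G Y Z) z - nabla G Y (nabla G X Z) z - nabla G (lie_bracket X Y) Z z"

text \<open>The sign is such that \<open>riem G z v w v w\<close> is the sectional curvature of the plane spanned by
  orthonormal \<open>v\<close>, \<open>w\<close>.  By tensoriality the vectors may be extended to constant fields.\<close>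

definition riem ::
    "('p::finite, 'n::finite) form_field \<Rightarrow> ('p, 'n) pt
      \<Rightarrow> ('p, 'n) pt \<Rightarrow> ('p, 'n) pt \<Rightarrow> ('p, 'n) pt \<Rightarrow> ('p, 'n) pt \<Rightarrow> real" where
  "riem G z x y v w = G z (curvature G (\<lambda>_. x) (\<lambda>_. y) (\<lambda>_. w) z) v"


section \<open>The splitting defined by the foliation\<close>

definition leaf_dirs :: "('p::finite, 'n::finite) pt set" where
  "leaf_dirs = {v. snd v = 0}"

definition normal_dirs :: "('p::finite, 'n::finite) form_field \<Rightarrow> ('p, 'n) pt \<Rightarrow> ('p, 'n) pt set" where
  "normal_dirs G z = {w. \<forall>v\<in>leaf_dirs. G z v w = 0}"

definition proj_leaf ::
    "('p::finite, 'n::finite) form_field \<Rightarrow> ('p, 'n) pt \<Rightarrow> ('p, 'n) pt \<Rightarrow> ('p, 'n) pt" where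
  "proj_leaf G z v = (THE w. w \<in> leaf_dirs \<and> v - w \<in> normal_dirs G z)"

definition proj_normal ::
    "('p::finite, 'n::finite) form_field \<Rightarrow> ('p, 'n) pt \<Rightarrow> ('p, 'n) pt \<Rightarrow> ('p, 'n) pt" where
  "proj_normal G z v = v - proj_leaf G z v"

definition truncated :: "('p::finite, 'n::finite) form_field \<Rightarrow> ('p, 'n) form_field" where
  "truncated G z v w = G z (proj_normal G z v) (proj_normal G z w)"

definition sqnorm :: "('p::finite, 'n::finite) form_field \<Rightarrow> ('p, 'n) pt \<Rightarrow> ('p, 'n) pt \<Rightarrow> real" where
  "sqnorm G z v = G z v v"

definition leaf_frame ::
    "('p::finite, 'n::finite) form_field \<Rightarrow> ('p, 'n) pt \<Rightarrow> 'p \<Rightarrow> ('p, 'n) pt" where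
  "leaf_frame G z = (SOME \<epsilon>. (\<forall>a. \<epsilon> a \<in> leaf_dirs) \<and>
     (\<forall>a b. G z (\<epsilon> a) (\<epsilon> b) = (if a = b then 1 else 0)))"

definition normal_frame ::
    "('p::finite, 'n::finite) form_field \<Rightarrow> ('p, 'n) pt \<Rightarrow> 'n \<Rightarrow> ('p, 'n) pt" where
  "normal_frame G z = (SOME e. (\<forall>i. e i \<in> normal_dirs G z) \<and>
     (\<forall>i j. G z (e i) (e j) = (if i = j then 1 else 0)))"

text \<open>Extensions of the vectors of an adapted orthonormal frame at \<open>z\<close> to sections of the two
  distributions.  They are orthonormal only at \<open>z\<close>, which is all that matters for the
  tensors below.\<close>

definition leaf_section ::
    "('p::finite, 'n::finite) form_field \<Rightarrow> ('p, 'n) pt \<Rightarrow> 'p \<Rightarrow> ('p, 'n) vfield" where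
  "leaf_section G z a = (\<lambda>_. leaf_frame G z a)"

definition normal_section ::
    "('p::finite, 'n::finite) form_field \<Rightarrow> ('p, 'n) pt \<Rightarrow> 'n \<Rightarrow> ('p, 'n) vfield" where
  "normal_section G z i = (\<lambda>z'. proj_normal G z' (normal_frame G z i))"

text \<open>In the usual notation \<open>leaf_sff\<close> is \<open>h\<^sub>F\<close>, \<open>normal_sff\<close> is \<open>h\<close> and \<open>integrability\<close> is \<open>T\<close>;
  \<open>leaf_mean_curv\<close> and \<open>mean_curv\<close> are the traces \<open>H\<^sub>F\<close> and \<open>H\<close>.\<close>

definition leaf_sff ::
    "('p::finite, 'n::finite) form_field \<Rightarrow> ('p, 'n) vfield \<Rightarrow> ('p, 'n) vfield \<Rightarrow> ('p, 'n) vfield" where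
  "leaf_sff G X Y z = proj_normal G z (nabla G X Y z)"

definition normal_sff ::
    "('p::finite, 'n::finite) form_field \<Rightarrow> ('p, 'n) vfield \<Rightarrow> ('p, 'n) vfield \<Rightarrow> ('p, 'n) vfield" where
  "normal_sff G X Y z = (1/2) *\<^sub>R proj_leaf G z (nabla G X Y z + nabla G Y X z)"

definition integrability ::
    "('p::finite, 'n::finite) form_field \<Rightarrow> ('p, 'n) vfield \<Rightarrow> ('p, 'n) vfield \<Rightarrow> ('p, 'n) vfield" where
  "integrability G X Y z = (1/2) *\<^sub>R proj_leaf G z (lie_bracket X Y z)"

definition leaf_mean_curv :: "('p::finite, 'n::finite) form_field \<Rightarrow> ('p, 'n) vfield" where
  "leaf_mean_curv G z = (\<Sum>a\<in>UNIV. leaf_sff G (leaf_section G z a) (leaf_section G z a) z)"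

definition mean_curv :: "('p::finite, 'n::finite) form_field \<Rightarrow> ('p, 'n) vfield" where
  "mean_curv G z = (\<Sum>i\<in>UNIV. normal_sff G (normal_section G z i) (normal_section G z i) z)"

definition leaf_sff_norm2 :: "('p::finite, 'n::finite) form_field \<Rightarrow> ('p, 'n) pt \<Rightarrow> real" where
  "leaf_sff_norm2 G z =
     (\<Sum>a\<in>UNIV. \<Sum>b\<in>UNIV. sqnorm G z (leaf_sff G (leaf_section G z a) (leaf_section G z b) z))"

definition normal_sff_norm2 :: "('p::finite, 'n::finite) form_field \<Rightarrow> ('p, 'n) pt \<Rightarrow> real" where
  "normal_sff_norm2 G z =
     (\<Sum>i\<in>UNIV. \<Sum>j\<in>UNIV. sqnorm G z (normal_sff G (normal_section G z i) (normal_section G z j) z))"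

definition integrability_norm2 :: "('p::finite, 'n::finite) form_field \<Rightarrow> ('p, 'n) pt \<Rightarrow> real" where
  "integrability_norm2 G z =
     (\<Sum>i\<in>UNIV. \<Sum>j\<in>UNIV. sqnorm G z (integrability G (normal_section G z i) (normal_section G z j) z))"

definition beta_D :: "('p::finite, 'n::finite) form_field \<Rightarrow> ('p, 'n) pt \<Rightarrow> real" where
  "beta_D G z = (real CARD('n) * normal_sff_norm2 G z - sqnorm G z (mean_curv G z)) / (real CARD('n))\<^sup>2"

definition Sc_mix :: "('p::finite, 'n::finite) form_field \<Rightarrow> ('p, 'n) pt \<Rightarrow> real" where
  "Sc_mix G z = (\<Sum>i\<in>UNIV. \<Sum>a\<in>UNIV.
     riem G z (leaf_frame G z a) (normal_frame G z i) (leaf_frame G z a) (normal_frame G z i))"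


section \<open>Leafwise operators\<close>

text \<open>The leaf component of the gradient, written so that only derivatives of \<open>f\<close> along
  the leaf occur.\<close>

definition grad_leaf ::
    "('p::finite, 'n::finite) form_field \<Rightarrow> (('p, 'n) pt \<Rightarrow> real) \<Rightarrow> ('p, 'n) vfield" where
  "grad_leaf G f z = (THE w. w \<in> leaf_dirs \<and> (\<forall>v\<in>leaf_dirs. G z w v = dirder f z v))"

definition div_leaf ::
    "('p::finite, 'n::finite) form_field \<Rightarrow> ('p, 'n) vfield \<Rightarrow> ('p, 'n) pt \<Rightarrow> real" where
  "div_leaf G X z = (\<Sum>a\<in>UNIV. G z (nabla G (leaf_section G z a) X z) (leaf_frame G z a))"

definition laplace_leaf ::
    "('p::finite, 'n::finite) form_field \<Rightarrow> (('p, 'n) pt \<Rightarrow> real) \<Rightarrow> ('p, 'n) pt \<Rightarrow> real" where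
  "laplace_leaf G f = div_leaf G (grad_leaf G f)"


section \<open>The flow\<close>

definition harmonic :: "('a, 'p::finite, 'n::finite) chart set \<Rightarrow> ('a, 'p, 'n) metric \<Rightarrow> bool" where
  "harmonic A g \<longleftrightarrow> (\<forall>c\<in>A. \<forall>z\<in>cimg c. leaf_mean_curv (g c) z = 0)"

text \<open>The time interval is \<open>[0, t\<^sub>0)\<close>, with \<open>t\<^sub>0 = \<infinity>\<close> allowed.  Each metric of the family is of
  class \<open>C\<^sup>2\<close> on the manifold, so that its curvature is defined, and the family is smooth along
  the leaves.\<close>

definition time_interval :: "ereal \<Rightarrow> real set" where
  "time_interval t0 = {t. 0 \<le> t \<and> ereal t < t0}"

definition Sc_mix_flow ::
    "('a, 'p::finite, 'n::finite) chart set \<Rightarrow> real set \<Rightarrow> ('a \<Rightarrow> real)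
      \<Rightarrow> (real \<Rightarrow> ('a, 'p, 'n) metric) \<Rightarrow> bool" where
  "Sc_mix_flow A J \<Phi> g \<longleftrightarrow>
     (\<forall>t\<in>J. riemannian_metric 2 A (g t)) \<and> leaf_smooth_metrics A J g \<and>
     (\<forall>t\<in>J. \<forall>c\<in>A. \<forall>z\<in>cimg c. \<forall>v w.
        ((\<lambda>s. g s c z v w) has_real_derivative
          - 2 * (Sc_mix (g t c) z - \<Phi> (cinv c z)) * truncated (g t c) z v w) (at t within J))"

text \<open>The condition \<open>H = - n \<nabla>\<^sup>F log u\<close>.\<close>

definition log_potential ::
    "('a, 'p::finite, 'n::finite) chart set \<Rightarrow> ('a, 'p, 'n) metric \<Rightarrow> ('a \<Rightarrow> real) \<Rightarrow> bool" where
  "log_potential A g u \<longleftrightarrow> (\<forall>x. u x > 0) \<and>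
     (\<forall>c\<in>A. \<forall>z\<in>cimg c.
        mean_curv (g c) z = - real CARD('n) *\<^sub>R grad_leaf (g c) (\<lambda>w. ln (u (cinv c w))) z)"

definition Psi1 ::
    "('a, 'p::finite, 'n::finite) metric \<Rightarrow> ('a \<Rightarrow> real) \<Rightarrow> ('a, 'p, 'n) chart \<Rightarrow> ('p, 'n) pt \<Rightarrow> real" where
  "Psi1 g u c z = u (cinv c z) ^ 2 * leaf_sff_norm2 (g c) z"

definition Psi2 ::
    "('a, 'p::finite, 'n::finite) metric \<Rightarrow> ('a \<Rightarrow> real) \<Rightarrow> ('a, 'p, 'n) chart \<Rightarrow> ('p, 'n) pt \<Rightarrow> real" where
  "Psi2 g u c z = u (cinv c z) ^ 4 * integrability_norm2 (g c) z"

end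

theory Submission
  imports Defs
begin

text \<open>
  The flow only changes the normal part of the metric.  A product \<open>g(v, w)\<close> with \<open>v\<close> tangent to the
  leaves is constant in time, hence so is the orthogonal splitting, and at each point all
  coefficients of \<open>g\<^sup>\<bottom>\<close> satisfy the same scalar equation \<open>f' = -2 (Sc\<^sub>m\<^sub>i\<^sub>x - \<Phi>) f\<close>.  Therefore
  \<open>g\<^sub>t\<^sup>\<bottom> = \<rho>\<^sub>t g\<^sub>0\<^sup>\<bottom>\<close> for a positive function \<open>\<rho>\<^sub>t\<close> (\<open>truncated_factor\<close>), which does not depend on the
  chart (\<open>factor_chart_independent\<close>).

  Under such a change of the metric every invariant transforms explicitly.  The second fundamental
  form of the leaves depends only on the leaf metric and the splitting, and so do the brackets that
  define \<open>T\<close>; counting normal arguments gives \<open>\<parallel>h\<^sub>F\<parallel>\<^sup>2 \<rho> = const\<close> and \<open>\<parallel>T\<parallel>\<^sup>2 \<rho>\<^sup>2 = const\<close>, and harmonicity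
  persists.  The second fundamental form of the normal distribution is minus half the
  derivative of \<open>g\<^sup>\<bottom>\<close> along the leaves (\<open>second_fundamental_form\<close>), so that
  \<open>H\<^sub>t = H\<^sub>0 - n/2 \<nabla>\<^sup>F log \<rho>\<^sub>t\<close> (\<open>mean_curv_change\<close>).  Differentiating in time and interchanging the
  time and leaf derivatives yields \<open>\<partial>\<^sub>t H = n \<nabla>\<^sup>F Sc\<^sub>m\<^sub>i\<^sub>x\<close> (\<open>mean_curv_flow\<close>).  Moreover, if
  \<open>H\<^sub>0 = -n \<nabla>\<^sup>F log u\<^sub>0\<close>, then \<open>H\<^sub>t = -n \<nabla>\<^sup>F log u\<close> for \<open>u = u\<^sub>0 \<rho>\<^sup>1\<^sup>/\<^sup>2\<close>, which satisfies
  \<open>\<partial>\<^sub>t u = -(Sc\<^sub>m\<^sub>i\<^sub>x - \<Phi>) u\<close>.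

  It remains to express the mixed scalar curvature by extrinsic quantities.  For a harmonic foliation
  (\<open>Sc_mix_harmonic\<close>)

  \<open>Sc\<^sub>m\<^sub>i\<^sub>x = div\<^sub>F H - \<parallel>h\<parallel>\<^sup>2 + \<parallel>T\<parallel>\<^sup>2 - \<parallel>h\<^sub>F\<parallel>\<^sup>2\<close>.

  Since \<open>\<parallel>h\<parallel>\<^sup>2 = n \<beta> + \<parallel>H\<parallel>\<^sup>2 / n\<close>, its leafwise gradient is the right-hand side of the evolution equation
  of \<open>H\<close> (\<open>grad_leaf_Sc_mix\<close>).  With \<open>\<nabla>\<^sup>F u = -(u/n) H\<close> one finds
  \<open>\<Delta>\<^sub>F u = -(u/n) div\<^sub>F H + (u/n\<^sup>2) \<parallel>H\<parallel>\<^sup>2\<close>, and the same formula turns the equation for \<open>\<partial>\<^sub>t u\<close> into the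
  stated partial differential equation; its nonlinear terms come from
  \<open>\<parallel>h\<^sub>F\<parallel>\<^sup>2 = \<Psi>\<^sub>1 / u\<^sup>2\<close> and \<open>\<parallel>T\<parallel>\<^sup>2 = \<Psi>\<^sub>2 / u\<^sup>4\<close>.  Multiplying \<open>u\<close> by the leafwise constant \<open>exp(-\<Phi> t)\<close>
  removes \<open>\<Phi>\<close>.

  The connection and the curvature are handled in one chart.  Projections of constant vectors serve as
  sections of the normal distribution, and constant vectors as sections of the leaf distribution.
  Sums over orthonormal frames are rewritten as contractions with inverse Gram matrices.
\<close>

section \<open>Calculus of k times differentiable functions\<close>

text \<open>Points of \<open>S\<close> can be approached along every coordinate direction, which makes the derivative
  within \<open>S\<close> unique.  Both open sets and products of a half-open time interval with an open set
  qualify; the latter carry the functions of time and of the leaf variable.\<close>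

definition unique_derivs :: "'b::euclidean_space set \<Rightarrow> bool" where
  "unique_derivs S \<longleftrightarrow> (\<forall>x\<in>S. \<forall>i\<in>Basis. \<forall>e>0. \<exists>d. 0 < \<bar>d\<bar> \<and> \<bar>d\<bar> < e \<and> x + d *\<^sub>R i \<in> S)"

lemma frechet_derivative_within_eqI:
  assumes "unique_derivs S" "x \<in> S" "(f has_derivative f') (at x within S)"
  shows "frechet_derivative f (at x within S) = f'"
proof -
  have "f differentiable at x within S" using assms(3) by (auto simp: differentiable_def)
  then have "(f has_derivative frechet_derivative f (at x within S)) (at x within S)"
    by (simp add: frechet_derivative_works)
  then show ?thesis
    by (rule frechet_derivative_unique_within[OF _ assms(3)])
      (use assms(1,2) in \<open>auto simp: unique_derivs_def\<close>)
qed

lemma unique_derivs_open: "open S \<Longrightarrow> unique_derivs S"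
  unfolding unique_derivs_def
proof (intro ballI allI impI)
  fix x i :: 'a and e :: real
  assume "open S" "x \<in> S" "i \<in> Basis" "e > 0"
  then obtain r where r: "r > 0" "ball x r \<subseteq> S" by (meson openE)
  have "x + (min r e / 2) *\<^sub>R i \<in> ball x r"
    using r \<open>i \<in> Basis\<close> \<open>e > 0\<close> by (simp add: dist_norm)
  then show "\<exists>d. 0 < \<bar>d\<bar> \<and> \<bar>d\<bar> < e \<and> x + d *\<^sub>R i \<in> S"
    using r \<open>e > 0\<close> by (intro exI[of _ "min r e / 2"]) auto
qed

lemma unique_derivs_Times:
  assumes "unique_derivs S" "unique_derivs T"
  shows "unique_derivs (S \<times> T)"
  unfolding unique_derivs_def
proof (clarify)
  fix a i :: 'a and b j :: 'b and e :: real
  assume *: "a \<in> S" "b \<in> T" "(i, j) \<in> Basis" "e > 0"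
  then consider "i \<in> Basis" "j = 0" | "i = 0" "j \<in> Basis"
    by (auto simp: Basis_prod_def)
  then show "\<exists>d. 0 < \<bar>d\<bar> \<and> \<bar>d\<bar> < e \<and> (a, b) + d *\<^sub>R (i, j) \<in> S \<times> T"
    using * assms unfolding unique_derivs_def by cases force+
qed

lemma frechet_derivative_cong:
  assumes "\<And>x. x \<in> S \<Longrightarrow> f x = g x" "x \<in> S"
  shows "frechet_derivative f (at x within S) = frechet_derivative g (at x within S)"
proof -
  have "(f has_derivative f') (at x within S) \<longleftrightarrow> (g has_derivative f') (at x within S)" for f'
    using assms by (metis has_derivative_transform)
  then show ?thesis by (simp add: frechet_derivative_def)
qed

lemma Ck_on_cong:
  assumes "\<And>x. x \<in> S \<Longrightarrow> f x = g x"
  shows "Ck_on k S f \<longleftrightarrow> Ck_on k S g"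
  using assms
proof (induction k arbitrary: f g)
  case 0
  then show ?case by (auto intro: continuous_on_cong)
next
  case (Suc k)
  have 1: "f differentiable_on S \<longleftrightarrow> g differentiable_on S"
    using Suc.prems unfolding differentiable_on_def differentiable_def
    by (metis has_derivative_transform)
  have "Ck_on k S (\<lambda>x. frechet_derivative f (at x within S) v) =
        Ck_on k S (\<lambda>x. frechet_derivative g (at x within S) v)" for v
    by (rule Suc.IH) (metis Suc.prems frechet_derivative_cong)
  with 1 show ?case by simp
qed

lemma Ck_on_SucD:
  assumes "Ck_on (Suc k) S f"
  shows "x \<in> S \<Longrightarrow> (f has_derivative frechet_derivative f (at x within S)) (at x within S)"
    and "Ck_on k S (\<lambda>x. frechet_derivative f (at x within S) v)"
  using assms by (auto simp: differentiable_on_def frechet_derivative_works)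

text \<open>The definition of \<^const>\<open>Ck_on\<close> speaks of the derivative selected by \<^const>\<open>frechet_derivative\<close>.  By
  uniqueness, a derivative found with the calculus rules does as well, and the closure
  properties below follow from this rule by induction on the order.\<close>

lemma Ck_on_SucI:
  assumes "unique_derivs S"
    and "\<And>x. x \<in> S \<Longrightarrow> (f has_derivative f' x) (at x within S)"
    and "\<And>v. Ck_on k S (\<lambda>x. f' x v)"
  shows "Ck_on (Suc k) S f"
proof -
  have "frechet_derivative f (at x within S) v = f' x v" if "x \<in> S" for x v
    using frechet_derivative_within_eqI[OF assms(1) that assms(2)[OF that]] by simp
  then have "Ck_on k S (\<lambda>x. frechet_derivative f (at x within S) v)" for v
    using assms(3)[of v] by (subst Ck_on_cong) auto
  then show ?thesis
    using assms(2) by (auto simp: differentiable_on_def differentiable_def)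
qed

lemma Ck_on_Suc_imp: "Ck_on (Suc k) S f \<Longrightarrow> Ck_on k S f"
proof (induction k arbitrary: f)
  case 0
  then show ?case by (simp add: differentiable_imp_continuous_on)
next
  case (Suc k)
  then show ?case by (metis Ck_on.simps(2))
qed

lemma Ck_on_mono: "Ck_on k S f \<Longrightarrow> j \<le> k \<Longrightarrow> Ck_on j S f"
  by (induction k) (auto simp: le_Suc_eq simp del: Ck_on.simps dest: Ck_on_Suc_imp)

lemma Ck_on_const: "unique_derivs S \<Longrightarrow> Ck_on k S (\<lambda>x. c)"
proof (induction k arbitrary: c)
  case (Suc k)
  show ?case
    by (rule Ck_on_SucI[OF Suc.prems has_derivative_const]) (rule Suc.IH[OF Suc.prems])
qed auto

lemma Ck_on_linear_map:
  assumes "unique_derivs S" "bounded_linear L"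
  shows "Ck_on k S L"
proof -
  have "Ck_on (Suc k) S L"
    by (rule Ck_on_SucI[OF assms(1) bounded_linear_imp_has_derivative[OF assms(2)]]) (rule Ck_on_const[OF assms(1)])
  then show ?thesis by (rule Ck_on_Suc_imp)
qed

lemma Ck_on_add:
  assumes "unique_derivs S"
  shows "Ck_on k S f \<Longrightarrow> Ck_on k S g \<Longrightarrow> Ck_on k S (\<lambda>x. f x + g x)"
proof (induction k arbitrary: f g)
  case (Suc k)
  show ?case
    by (rule Ck_on_SucI[OF assms has_derivative_add[OF Ck_on_SucD(1)[OF Suc.prems(1)] Ck_on_SucD(1)[OF Suc.prems(2)]]])
      (use Suc in auto)
qed (auto intro: continuous_intros)

lemma Ck_on_bounded_linear:
  assumes "unique_derivs S" "bounded_linear L"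
  shows "Ck_on k S f \<Longrightarrow> Ck_on k S (\<lambda>x. L (f x))"
proof (induction k arbitrary: f)
  case 0
  then show ?case using assms(2) by (auto intro: linear_continuous_on bounded_linear.continuous_on)
next
  case (Suc k)
  show ?case
    by (rule Ck_on_SucI[OF assms(1) bounded_linear.has_derivative[OF assms(2) Ck_on_SucD(1)[OF Suc.prems(1)]]])
      (use Suc in auto)
qed

lemma Ck_on_bounded_bilinear:
  assumes "unique_derivs S" and b: "bounded_bilinear b"
  shows "Ck_on k S f \<Longrightarrow> Ck_on k S g \<Longrightarrow> Ck_on k S (\<lambda>x. b (f x) (g x))"
proof (induction k arbitrary: f g)
  case 0
  then show ?case using b by (auto intro: bounded_bilinear.continuous_on)
next
  case (Suc k)
  show ?case
  proof (rule Ck_on_SucI[OF assms(1) bounded_bilinear.FDERIV[OF b Ck_on_SucD(1)[OF Suc.prems(1)] Ck_on_SucD(1)[OF Suc.prems(2)]]])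
    fix v
    show "Ck_on k S (\<lambda>x. b (f x) (frechet_derivative g (at x within S) v) +
              b (frechet_derivative f (at x within S) v) (g x))"
      by (intro Ck_on_add[OF assms(1)] Suc.IH Ck_on_SucD(2)[OF Suc.prems(1)]
          Ck_on_SucD(2)[OF Suc.prems(2)] Ck_on_Suc_imp[OF Suc.prems(1)] Ck_on_Suc_imp[OF Suc.prems(2)])
  qed
qed

lemmas Ck_on_mult = Ck_on_bounded_bilinear[OF _ bounded_bilinear_mult]
lemmas Ck_on_scaleR = Ck_on_bounded_bilinear[OF _ bounded_bilinear_scaleR]
lemmas Ck_on_inner = Ck_on_bounded_linear[OF _ bounded_linear_inner_left]

lemma Ck_on_minus: "unique_derivs S \<Longrightarrow> Ck_on k S f \<Longrightarrow> Ck_on k S (\<lambda>x. - f x)"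
  by (rule Ck_on_bounded_linear[OF _ bounded_linear_minus[OF bounded_linear_ident]])

lemma Ck_on_diff:
  "unique_derivs S \<Longrightarrow> Ck_on k S f \<Longrightarrow> Ck_on k S g \<Longrightarrow> Ck_on k S (\<lambda>x. f x - g x)"
  using Ck_on_add[of S k f "\<lambda>x. - g x"] Ck_on_minus[of S k g] by simp

lemma Ck_on_sum:
  assumes "unique_derivs S" "\<And>i. i \<in> I \<Longrightarrow> Ck_on k S (f i)"
  shows "Ck_on k S (\<lambda>x. \<Sum>i\<in>I. f i x)"
  using assms(2)
  by (induction I rule: infinite_finite_induct) (auto intro: Ck_on_const Ck_on_add assms(1))

lemma Ck_on_prod:
  fixes f :: "'i \<Rightarrow> 'b::euclidean_space \<Rightarrow> real"
  assumes "unique_derivs S" "\<And>i. i \<in> I \<Longrightarrow> Ck_on k S (f i)"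
  shows "Ck_on k S (\<lambda>x. \<Prod>i\<in>I. f i x)"
  using assms(2)
  by (induction I rule: infinite_finite_induct) (auto intro: Ck_on_const Ck_on_mult assms(1))

lemma Ck_on_inverse:
  fixes f :: "'b::euclidean_space \<Rightarrow> real"
  assumes "unique_derivs S" and "\<And>x. x \<in> S \<Longrightarrow> f x \<noteq> 0"
  shows "Ck_on k S f \<Longrightarrow> Ck_on k S (\<lambda>x. inverse (f x))"
proof (induction k)
  case 0
  then show ?case using assms by (auto intro: continuous_intros)
next
  case (Suc k)
  have d: "((\<lambda>x. inverse (f x)) has_derivative
      (\<lambda>h. - (inverse (f x) * frechet_derivative f (at x within S) h * inverse (f x)))) (at x within S)"
    if "x \<in> S" for x
    using Deriv.has_derivative_inverse[OF assms(2)[OF that] Ck_on_SucD(1)[OF Suc.prems that]] .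
  show ?case
    by (rule Ck_on_SucI[OF assms(1) d], assumption)
      (intro Ck_on_mult assms(1) Ck_on_minus Ck_on_SucD(2)[OF Suc.prems] Suc.IH Ck_on_Suc_imp[OF Suc.prems])
qed

lemma Ck_on_sqrt:
  fixes f :: "'b::euclidean_space \<Rightarrow> real"
  assumes "unique_derivs S" and "\<And>x. x \<in> S \<Longrightarrow> f x > 0"
  shows "Ck_on k S f \<Longrightarrow> Ck_on k S (\<lambda>x. sqrt (f x))"
proof (induction k)
  case 0
  then show ?case using assms by (auto intro: continuous_intros)
next
  case (Suc k)
  have d: "((\<lambda>x. sqrt (f x)) has_derivative
      (\<lambda>h. frechet_derivative f (at x within S) h * ((1/2) * inverse (sqrt (f x))))) (at x within S)"
    if "x \<in> S" for x
    by (rule has_derivative_eq_rhs[OF has_derivative_real_sqrt[OF assms(2)[OF that] Ck_on_SucD(1)[OF Suc.prems that]]])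
      (auto simp: field_simps)
  show ?case
  proof (rule Ck_on_SucI[OF assms(1) d])
    show "Ck_on k S (\<lambda>x. frechet_derivative f (at x within S) v * ((1/2) * inverse (sqrt (f x))))" for v
      using assms(2) by (intro Ck_on_mult assms(1) Ck_on_const Ck_on_inverse Ck_on_SucD(2)[OF Suc.prems]
          Suc.IH Ck_on_Suc_imp[OF Suc.prems]) force+
  qed
qed

lemma Ck_on_exp:
  fixes f :: "'b::euclidean_space \<Rightarrow> real"
  assumes "unique_derivs S"
  shows "Ck_on k S f \<Longrightarrow> Ck_on k S (\<lambda>x. exp (f x))"
proof (induction k)
  case 0
  then show ?case by (auto intro: continuous_intros)
next
  case (Suc k)
  have d: "((\<lambda>x. exp (f x)) has_derivative
      (\<lambda>h. exp (f x) * frechet_derivative f (at x within S) h)) (at x within S)"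
    if "x \<in> S" for x
    using has_derivative_exp[OF Ck_on_SucD(1)[OF Suc.prems that]] by (simp add: mult.commute)
  show ?case
    by (rule Ck_on_SucI[OF assms d], assumption)
      (intro Ck_on_mult assms Ck_on_SucD(2)[OF Suc.prems] Suc.IH Ck_on_Suc_imp[OF Suc.prems])
qed

text \<open>Affine maps serve to restrict a function to a leaf slice, and to regard a function of the leaf
  variable as a function of time and the leaf variable.\<close>

lemma Ck_on_compose_affine:
  assumes "unique_derivs S" "bounded_linear L"
    and A: "\<And>q. q \<in> S \<Longrightarrow> c + L q \<in> U"
  shows "Ck_on k U f \<Longrightarrow> Ck_on k S (\<lambda>q. f (c + L q))"
proof (induction k arbitrary: f)
  case 0
  have "continuous_on S (\<lambda>q. c + L q)"
    using assms(2) by (intro continuous_intros bounded_linear.continuous_on[OF assms(2)])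
  with 0 A show ?case by (auto intro: continuous_on_compose2)
next
  case (Suc k)
  have d: "((\<lambda>q. f (c + L q)) has_derivative
      (\<lambda>h. frechet_derivative f (at (c + L q) within U) (L h))) (at q within S)"
    if "q \<in> S" for q
  proof (rule has_derivative_in_compose2[where g = f and t = U and f = "\<lambda>q. c + L q" and f' = L,
        OF Ck_on_SucD(1)[OF Suc.prems]])
    show "((\<lambda>q. c + L q) has_derivative L) (at q within S)"
      by (auto intro!: derivative_eq_intros bounded_linear_imp_has_derivative assms(2))
  qed (use A that in auto)
  show ?case
    by (rule Ck_on_SucI[OF assms(1) d], assumption) (rule Suc.IH[OF Ck_on_SucD(2)[OF Suc.prems]])
qed

lemma Ck_on_locally_constant:
  assumes "unique_derivs S"
    and "\<And>x. x \<in> S \<Longrightarrow> \<exists>e>0. \<forall>x'\<in>S. dist x' x < e \<longrightarrow> f x' = f x"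
  shows "Ck_on k S f"
proof -
  have d: "(f has_derivative (\<lambda>_. 0)) (at x within S)" if "x \<in> S" for x
  proof -
    obtain e where e: "e > 0" "\<forall>x'\<in>S. dist x' x < e \<longrightarrow> f x' = f x" using assms(2)[OF \<open>x \<in> S\<close>] by metis
    show ?thesis
      by (rule has_derivative_transform_within[OF has_derivative_const[of "f x"] e(1) that])
        (use e in auto)
  qed
  have "Ck_on (Suc k) S f" by (rule Ck_on_SucI[OF assms(1) d], assumption) (rule Ck_on_const[OF assms(1)])
  then show ?thesis by (rule Ck_on_Suc_imp)
qed


subsection \<open>Symmetry of second derivatives\<close>

lemma has_derivative_along_segment:
  assumes "Ck_on (Suc k) S f" "\<And>s. s \<in> {0..d} \<Longrightarrow> p + s *\<^sub>R a \<in> S" "s \<in> {0..d}"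
  shows "((\<lambda>s. f (p + s *\<^sub>R a)) has_derivative
           (\<lambda>h. h *\<^sub>R frechet_derivative f (at (p + s *\<^sub>R a) within S) a)) (at s within {0..d})"
proof -
  have "((\<lambda>s. f (p + s *\<^sub>R a)) has_derivative
           (\<lambda>h. frechet_derivative f (at (p + s *\<^sub>R a) within S) (h *\<^sub>R a))) (at s within {0..d})"
    by (rule has_derivative_in_compose2[where g = f and t = S and f = "\<lambda>s. p + s *\<^sub>R a", OF Ck_on_SucD(1)[OF assms(1)]])
      (use assms(2,3) in \<open>auto intro!: derivative_eq_intros\<close>)
  moreover have "linear (frechet_derivative f (at (p + s *\<^sub>R a) within S))"
    using Ck_on_SucD(1)[OF assms(1) assms(2)[OF assms(3)]] has_derivative_linear by blast
  ultimately show ?thesis by (simp add: linear_cmul)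
qed

text \<open>The mean value theorem is applied once along \<open>a\<close> and once along \<open>b\<close>.  All points lie on the
  positive side of \<open>z\<close>, so that \<open>z\<close> may be a boundary point of \<open>S\<close>, such as a point at the initial
  time.\<close>

lemma second_difference_mean_value:
  fixes F :: "'b::euclidean_space \<Rightarrow> real"
  assumes ud: "unique_derivs S" and F: "Ck_on 2 S F" and d: "0 < d"
    and S: "\<And>s r. s \<in> {0..d} \<Longrightarrow> r \<in> {0..d} \<Longrightarrow> z + s *\<^sub>R a + r *\<^sub>R b \<in> S"
  shows "\<exists>s\<in>{0<..<d}. \<exists>r\<in>{0<..<d}.
     F (z + d *\<^sub>R a + d *\<^sub>R b) - F (z + d *\<^sub>R a) - F (z + d *\<^sub>R b) + F z
       = d * d * frechet_derivative (\<lambda>x. frechet_derivative F (at x within S) a)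
           (at (z + s *\<^sub>R a + r *\<^sub>R b) within S) b"
proof -
  let ?D = "\<lambda>x. frechet_derivative F (at x within S) a"
  have F2: "Ck_on (Suc (Suc 0)) S F" using F by (simp add: numeral_2_eq_2)
  have D1: "Ck_on (Suc 0) S ?D" using Ck_on_SucD(2)[OF F2] .
  define p where "p r s = F ((z + r *\<^sub>R b) + s *\<^sub>R a)" for r s
  have p: "((\<lambda>s. p r s) has_derivative (\<lambda>h. h *\<^sub>R ?D ((z + r *\<^sub>R b) + s *\<^sub>R a))) (at s within {0..d})"
    if "r \<in> {0..d}" "s \<in> {0..d}" for r s
    unfolding p_def
    by (rule has_derivative_along_segment[OF F2 _ that(2)]) (use S that in \<open>auto simp: algebra_simps\<close>)
  have "\<exists>s\<in>{0<..<d}. (p d d - p 0 d) - (p d 0 - p 0 0) =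
     (\<lambda>h. h *\<^sub>R ?D ((z + d *\<^sub>R b) + s *\<^sub>R a) - h *\<^sub>R ?D ((z + 0 *\<^sub>R b) + s *\<^sub>R a)) (d - 0)"
    by (rule mvt_simple[OF d], rule has_derivative_diff[OF p[of d] p[of 0]]) (use d in auto)
  then obtain s where s: "s \<in> {0<..<d}" and
    1: "(p d d - p 0 d) - (p d 0 - p 0 0) = d * (?D ((z + s *\<^sub>R a) + d *\<^sub>R b) - ?D ((z + s *\<^sub>R a) + 0 *\<^sub>R b))"
    by (auto simp: algebra_simps)
  have "\<exists>r\<in>{0<..<d}. ?D ((z + s *\<^sub>R a) + d *\<^sub>R b) - ?D ((z + s *\<^sub>R a) + 0 *\<^sub>R b) =
     (\<lambda>h. h *\<^sub>R frechet_derivative ?D (at ((z + s *\<^sub>R a) + r *\<^sub>R b) within S) b) (d - 0)"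
    by (rule mvt_simple[OF d]) (rule has_derivative_along_segment[OF D1], use s S in auto)
  then obtain r where r: "r \<in> {0<..<d}" and
    2: "?D ((z + s *\<^sub>R a) + d *\<^sub>R b) - ?D ((z + s *\<^sub>R a) + 0 *\<^sub>R b) =
     d * frechet_derivative ?D (at ((z + s *\<^sub>R a) + r *\<^sub>R b) within S) b" by auto
  show ?thesis
    using s r 1 2 by (intro bexI[of _ s] bexI[of _ r]) (auto simp: p_def algebra_simps)
qed

text \<open>Both iterated derivatives are the limit of the same second difference quotient.\<close>

lemma second_derivative_symmetric_real:
  fixes F :: "'b::euclidean_space \<Rightarrow> real"
  assumes ud: "unique_derivs S" and F: "Ck_on 2 S F" and d: "0 < d"
    and S: "\<And>s r. s \<in> {0..d} \<Longrightarrow> r \<in> {0..d} \<Longrightarrow> z + s *\<^sub>R a + r *\<^sub>R b \<in> S"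
  shows "frechet_derivative (\<lambda>x. frechet_derivative F (at x within S) a) (at z within S) b =
         frechet_derivative (\<lambda>x. frechet_derivative F (at x within S) b) (at z within S) a"
proof -
  define P where "P a b x = frechet_derivative (\<lambda>x. frechet_derivative F (at x within S) a) (at x within S) b" for a b x
  have F2: "Ck_on (Suc (Suc 0)) S F" using F by (simp add: numeral_2_eq_2)
  have cont: "continuous_on S (P a b)" for a b
    using Ck_on_SucD(2)[OF Ck_on_SucD(2)[OF F2]] by (simp add: P_def[abs_def])
  have zS: "z \<in> S" using S[of 0 0] d by simp
  have "\<bar>P a b z - P b a z\<bar> \<le> e" if "e > 0" for e
  proof -
    obtain r1 where r1: "r1 > 0" "\<And>x. x \<in> S \<Longrightarrow> dist x z < r1 \<Longrightarrow> dist (P a b x) (P a b z) < e/2"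
      using cont[of a b] zS \<open>e > 0\<close> unfolding continuous_on_iff by (meson half_gt_zero)
    obtain r2 where r2: "r2 > 0" "\<And>x. x \<in> S \<Longrightarrow> dist x z < r2 \<Longrightarrow> dist (P b a x) (P b a z) < e/2"
      using cont[of b a] zS \<open>e > 0\<close> unfolding continuous_on_iff by (meson half_gt_zero)
    \<comment> \<open>Small parallelograms lie in the ball on which both second derivatives vary by less than \<open>e/2\<close>.\<close>
    define c where "c = min d (min r1 r2 / (norm a + norm b + 1))"
    have N: "norm a + norm b + 1 > 0" by (smt (verit) norm_ge_zero)
    have c: "c > 0" "c \<le> d" using d r1 r2 N by (auto simp: c_def)
    have cr: "c * (norm a + norm b) < min r1 r2"
    proof -
      have "c * (norm a + norm b) < c * (norm a + norm b + 1)" using c by simp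
      also have "\<dots> \<le> min r1 r2 / (norm a + norm b + 1) * (norm a + norm b + 1)"
        using N by (intro mult_right_mono) (auto simp: c_def)
      also have "\<dots> = min r1 r2" using N by simp
      finally show ?thesis .
    qed
    have near: "dist (z + s *\<^sub>R a + r *\<^sub>R b) z < min r1 r2" if "s \<in> {0<..<c}" "r \<in> {0<..<c}" for s r
    proof -
      have "dist (z + s *\<^sub>R a + r *\<^sub>R b) z \<le> s * norm a + r * norm b"
        using norm_triangle_ineq[of "s *\<^sub>R a" "r *\<^sub>R b"] that by (simp add: dist_norm)
      also have "\<dots> \<le> c * norm a + c * norm b"
        using that by (intro add_mono mult_right_mono) auto
      finally show ?thesis using cr by (simp add: distrib_left)
    qed
    have S': "z + s *\<^sub>R a + r *\<^sub>R b \<in> S" if "s \<in> {0..c}" "r \<in> {0..c}" for s r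
      using S that c by auto
    have S'': "z + s *\<^sub>R b + r *\<^sub>R a \<in> S" if "s \<in> {0..c}" "r \<in> {0..c}" for s r
      using S'[of r s] that by (simp add: algebra_simps)
    obtain s1 q1 where 1: "s1 \<in> {0<..<c}" "q1 \<in> {0<..<c}"
      "F (z + c *\<^sub>R a + c *\<^sub>R b) - F (z + c *\<^sub>R a) - F (z + c *\<^sub>R b) + F z = c * c * P a b (z + s1 *\<^sub>R a + q1 *\<^sub>R b)"
      using second_difference_mean_value[OF ud F c(1) S'] unfolding P_def by blast
    obtain s2 q2 where 2: "s2 \<in> {0<..<c}" "q2 \<in> {0<..<c}"
      "F (z + c *\<^sub>R b + c *\<^sub>R a) - F (z + c *\<^sub>R b) - F (z + c *\<^sub>R a) + F z = c * c * P b a (z + s2 *\<^sub>R b + q2 *\<^sub>R a)"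
      using second_difference_mean_value[OF ud F c(1) S''] unfolding P_def by blast
    have "c * c * P a b (z + s1 *\<^sub>R a + q1 *\<^sub>R b) = c * c * P b a (z + q2 *\<^sub>R a + s2 *\<^sub>R b)"
      using 1(3) 2(3) by (simp add: algebra_simps)
    then have "P a b (z + s1 *\<^sub>R a + q1 *\<^sub>R b) = P b a (z + q2 *\<^sub>R a + s2 *\<^sub>R b)" using c by simp
    moreover have "dist (P a b (z + s1 *\<^sub>R a + q1 *\<^sub>R b)) (P a b z) < e/2"
      using r1(2) near[OF 1(1,2)] S'[of s1 q1] 1 by auto
    moreover have "dist (P b a (z + q2 *\<^sub>R a + s2 *\<^sub>R b)) (P b a z) < e/2"
      using r2(2) near[OF 2(2,1)] S'[of q2 s2] 2 by auto
    ultimately show ?thesis unfolding dist_real_def by linarith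
  qed
  then have "\<bar>P a b z - P b a z\<bar> \<le> 0" by (rule field_le_epsilon) auto
  then show ?thesis by (simp add: P_def)
qed

section \<open>Traces with respect to a positive definite form\<close>

text \<open>The tensor norms, mean curvatures and divergences are sums over orthonormal frames that are
  chosen arbitrarily at each point.  Such a sum of \<open>Q (e i) (e i)\<close> equals the contraction of \<open>Q\<close>
  with the inverse Gram matrix of the metric.  The contraction does not depend on the frame, and it
  inherits the regularity of the metric and of \<open>Q\<close>.\<close>

definition posdef_form :: "('v::real_vector \<Rightarrow> 'v \<Rightarrow> real) \<Rightarrow> bool" where
  "posdef_form B \<longleftrightarrow> bilinear B \<and> (\<forall>v w. B v w = B w v) \<and> (\<forall>v. v \<noteq> 0 \<longrightarrow> B v v > 0)"

definition orthonormal_frame :: "('v \<Rightarrow> 'v \<Rightarrow> real) \<Rightarrow> ('k \<Rightarrow> 'v) \<Rightarrow> bool" where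
  "orthonormal_frame B e \<longleftrightarrow> (\<forall>i j. B (e i) (e j) = (if i = j then 1 else 0))"

definition gram :: "(real^'k::finite \<Rightarrow> real^'k \<Rightarrow> real) \<Rightarrow> real^'k^'k" where
  "gram B = (\<chi> i j. B (axis i 1) (axis j 1))"

definition ginv :: "(real^'k::finite \<Rightarrow> real^'k \<Rightarrow> real) \<Rightarrow> real^'k^'k" where
  "ginv B = matrix_inv (gram B)"

definition metric_trace ::
    "(real^'k::finite \<Rightarrow> real^'k \<Rightarrow> real) \<Rightarrow> (real^'k \<Rightarrow> real^'k \<Rightarrow> real) \<Rightarrow> real" where
  "metric_trace B Q = (\<Sum>j\<in>UNIV. \<Sum>k\<in>UNIV. ginv B $ j $ k * Q (axis j 1) (axis k 1))"

lemmas bilinear_rules = bilinear_ladd bilinear_radd bilinear_lmul bilinear_rmul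

lemma bilinear_sum_left: "bilinear B \<Longrightarrow> B (\<Sum>i\<in>I. f i) y = (\<Sum>i\<in>I. B (f i) y)"
  by (simp add: bilinear_def linear_sum[of "\<lambda>x. B x y"])

lemma bilinear_sum_right: "bilinear B \<Longrightarrow> B x (\<Sum>i\<in>I. f i) = (\<Sum>i\<in>I. B x (f i))"
  by (simp add: bilinear_def linear_sum[of "B x"])

lemma bilinear_expand_axis:
  fixes Q :: "real^'k::finite \<Rightarrow> real^'k \<Rightarrow> real"
  assumes "bilinear Q"
  shows "Q u v = (\<Sum>j\<in>UNIV. \<Sum>k\<in>UNIV. u$j * v$k * Q (axis j 1) (axis k 1))"
proof -
  have "Q u v = Q (\<Sum>j\<in>UNIV. u$j *\<^sub>R axis j 1) (\<Sum>k\<in>UNIV. v$k *\<^sub>R axis k 1)"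
    using basis_expansion[of u] basis_expansion[of v] by (simp add: scalar_mult_eq_scaleR)
  also have "\<dots> = (\<Sum>j\<in>UNIV. Q (u$j *\<^sub>R axis j 1) (\<Sum>k\<in>UNIV. v$k *\<^sub>R axis k 1))"
    by (rule bilinear_sum_left[OF assms])
  also have "\<dots> = (\<Sum>j\<in>UNIV. \<Sum>k\<in>UNIV. u$j * v$k * Q (axis j 1) (axis k 1))"
    by (subst bilinear_sum_right[OF assms])
      (simp add: bilinear_lmul[OF assms] bilinear_rmul[OF assms] ac_simps)
  finally show ?thesis .
qed

lemma posdef_form_bilinear: "posdef_form B \<Longrightarrow> bilinear B"
  by (simp add: posdef_form_def)

lemma gram_mult_vec:
  assumes "bilinear B"
  shows "(gram B *v x) $ i = B (axis i 1) x"
proof -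
  have "B (axis i 1) x = B (axis i 1) (\<Sum>k\<in>UNIV. x$k *\<^sub>R axis k 1)"
    using basis_expansion[of x] by (simp add: scalar_mult_eq_scaleR)
  also have "\<dots> = (gram B *v x) $ i"
    by (subst bilinear_sum_right[OF assms])
      (simp add: bilinear_rmul[OF assms] gram_def matrix_vector_mult_def ac_simps)
  finally show ?thesis by simp
qed

lemma bilinear_eq_gram:
  assumes "bilinear B"
  shows "B y x = (\<Sum>l\<in>UNIV. y$l * (gram B *v x) $ l)"
proof -
  have "B y x = B (\<Sum>k\<in>UNIV. y$k *\<^sub>R axis k 1) x"
    using basis_expansion[of y] by (simp add: scalar_mult_eq_scaleR)
  then show ?thesis
    by (simp add: bilinear_sum_left[OF assms] bilinear_lmul[OF assms] gram_mult_vec[OF assms])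
qed

lemma gram_invertible:
  assumes "posdef_form B"
  shows "invertible (gram B)"
proof -
  have b: "bilinear B" using assms by (simp add: posdef_form_def)
  have "x = 0" if "gram B *v x = 0" for x
  proof (rule ccontr)
    assume "x \<noteq> 0"
    have "B x x = 0" by (subst bilinear_eq_gram[OF b]) (simp add: that)
    then show False using assms \<open>x \<noteq> 0\<close> by (force simp: posdef_form_def)
  qed
  then have "\<exists>A'. A' ** gram B = mat 1"
    using matrix_left_invertible_ker[of "gram B"] by blast
  then show ?thesis by (simp add: invertible_left_inverse)
qed

lemma
  assumes "posdef_form B"
  shows gram_ginv: "gram B ** ginv B = mat 1" and ginv_gram: "ginv B ** gram B = mat 1"
proof -
  have "\<exists>A'. gram B ** A' = mat 1 \<and> A' ** gram B = mat 1"
    using gram_invertible[OF assms] by (simp add: invertible_def)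
  from someI_ex[OF this] show "gram B ** ginv B = mat 1" "ginv B ** gram B = mat 1"
    by (simp_all add: ginv_def matrix_inv_def)
qed

text \<open>If the rows of \<open>C\<close> are an orthonormal frame, then \<open>C B C\<^sup>T = 1\<close>, hence \<open>C\<^sup>T C = B\<^sup>-\<^sup>1\<close>.\<close>

lemma ginv_orthonormal_frame:
  fixes e :: "'k::finite \<Rightarrow> real^'k"
  assumes "posdef_form B" "orthonormal_frame B e"
  shows "ginv B $ j $ k = (\<Sum>i\<in>UNIV. e i $ j * e i $ k)"
proof -
  have b: "bilinear B" using assms by (simp add: posdef_form_def)
  define C :: "real^'k^'k" where "C = (\<chi> i. e i)"
  have "(C ** (gram B ** transpose C)) $ i $ j = mat 1 $ i $ j" for i j
  proof -
    have "(C ** (gram B ** transpose C)) $ i $ j = B (e i) (e j)"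
      by (subst bilinear_expand_axis[OF b])
        (simp add: matrix_matrix_mult_def C_def transpose_def gram_def sum_distrib_left ac_simps)
    then show ?thesis using assms(2) by (simp add: orthonormal_frame_def mat_def)
  qed
  then have "C ** (gram B ** transpose C) = mat 1" by (simp add: vec_eq_iff)
  then have "(gram B ** transpose C) ** C = mat 1" by (simp add: matrix_left_right_inverse)
  then have 1: "gram B ** (transpose C ** C) = mat 1" by (simp add: matrix_mul_assoc)
  have "ginv B = ginv B ** (gram B ** (transpose C ** C))" by (simp add: 1)
  also have "\<dots> = transpose C ** C" by (simp add: matrix_mul_assoc ginv_gram[OF assms(1)])
  finally show ?thesis by (simp add: matrix_matrix_mult_def transpose_def C_def)
qed

lemma metric_trace_orthonormal_frame:
  fixes e :: "'k::finite \<Rightarrow> real^'k"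
  assumes "posdef_form B" "orthonormal_frame B e" "bilinear Q"
  shows "(\<Sum>i\<in>UNIV. Q (e i) (e i)) = metric_trace B Q"
proof -
  have "(\<Sum>i\<in>UNIV. Q (e i) (e i)) =
      (\<Sum>i\<in>UNIV. \<Sum>j\<in>UNIV. \<Sum>k\<in>UNIV. e i $ j * e i $ k * Q (axis j 1) (axis k 1))"
    by (subst bilinear_expand_axis[OF assms(3)]) simp
  also have "\<dots> = (\<Sum>j\<in>UNIV. \<Sum>k\<in>UNIV. \<Sum>i\<in>UNIV. e i $ j * e i $ k * Q (axis j 1) (axis k 1))"
    by (subst sum.swap) (intro sum.cong refl sum.swap)
  also have "\<dots> = metric_trace B Q"
    by (simp add: metric_trace_def ginv_orthonormal_frame[OF assms(1,2)] sum_distrib_right)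
  finally show ?thesis .
qed

lemma orthonormal_frame_expansion:
  fixes e :: "'k::finite \<Rightarrow> real^'k"
  assumes "posdef_form B" "orthonormal_frame B e"
  shows "(\<Sum>i\<in>UNIV. B x (e i) *\<^sub>R e i) = x"
proof -
  have b: "bilinear B" and sym: "\<And>v w. B v w = B w v" using assms by (auto simp: posdef_form_def)
  have "(\<Sum>i\<in>UNIV. B x (e i) *\<^sub>R e i) $ k = x $ k" for k
  proof -
    have "(\<Sum>i\<in>UNIV. B x (e i) *\<^sub>R e i) $ k =
        (\<Sum>i\<in>UNIV. \<Sum>l\<in>UNIV. (gram B *v x) $ l * (e i $ l * e i $ k))"
      by (simp add: sym[of x] bilinear_eq_gram[OF b, of "e _" x] sum_distrib_left sum_distrib_right ac_simps)
    also have "\<dots> = (\<Sum>l\<in>UNIV. (gram B *v x) $ l * ginv B $ l $ k)"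
      by (subst sum.swap) (simp add: ginv_orthonormal_frame[OF assms] sum_distrib_left)
    also have "\<dots> = (ginv B *v (gram B *v x)) $ k"
      using ginv_orthonormal_frame[OF assms, of k] ginv_orthonormal_frame[OF assms, of _ k]
      by (simp add: matrix_vector_mult_def ac_simps)
    also have "\<dots> = x $ k"
      by (simp add: matrix_vector_mul_assoc ginv_gram[OF assms(1)])
    finally show ?thesis .
  qed
  then show ?thesis by (simp add: vec_eq_iff)
qed

text \<open>Gram-Schmidt, adding one index at a time: as long as an index is missing, the vectors found so
  far do not span the space, and a vector outside their span is made orthogonal to them and
  normalised.\<close>

lemma orthonormal_frame_exists:
  fixes B :: "real^'k::finite \<Rightarrow> real^'k \<Rightarrow> real"
  assumes "posdef_form B"
  shows "\<exists>e::'k \<Rightarrow> real^'k. orthonormal_frame B e"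
proof -
  have b: "bilinear B" and sym: "\<And>v w. B v w = B w v" and pos: "\<And>v. v \<noteq> 0 \<Longrightarrow> B v v > 0"
    using assms by (auto simp: posdef_form_def)
  have "\<exists>e. \<forall>i\<in>I. \<forall>j\<in>I. B (e i) (e j) = (if i = j then 1 else 0)" if "finite I" for I :: "'k set"
    using that
  proof (induction I rule: finite_induct)
    case (insert k I)
    then obtain e where e: "\<forall>i\<in>I. \<forall>j\<in>I. B (e i) (e j) = (if i = j then 1 else 0)" by blast
    have "dim (span (e ` I)) < DIM(real^'k)"
    proof -
      have "dim (span (e ` I)) \<le> card (e ` I)" using insert by (simp add: dim_le_card')
      also have "\<dots> \<le> card I" using insert by (simp add: card_image_le)
      also have "\<dots> < CARD('k)" using insert(2) by (intro psubset_card_mono) auto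
      finally show ?thesis by simp
    qed
    then have "span (e ` I) \<noteq> UNIV" by (metis dim_UNIV dim_span less_irrefl)
    then obtain x where x: "x \<notin> span (e ` I)" by blast
    define y where "y = x - (\<Sum>i\<in>I. B x (e i) *\<^sub>R e i)"
    have "(\<Sum>i\<in>I. B x (e i) *\<^sub>R e i) \<in> span (e ` I)"
      by (intro span_sum span_scale span_base) auto
    then have "y \<noteq> 0" using x by (auto simp: y_def)
    have orth: "B y (e j) = 0" if "j \<in> I" for j
    proof -
      have "B y (e j) = B x (e j) - (\<Sum>i\<in>I. B x (e i) * B (e i) (e j))"
        by (simp add: y_def bilinear_lsub[OF b] bilinear_sum_left[OF b] bilinear_lmul[OF b])
      also have "(\<Sum>i\<in>I. B x (e i) * B (e i) (e j)) = (\<Sum>i\<in>I. if i = j then B x (e j) else 0)"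
        using e that by (intro sum.cong) auto
      finally show ?thesis using insert that by simp
    qed
    define r where "r = sqrt (B y y)"
    have r: "r > 0" "r * r = B y y" using pos[OF \<open>y \<noteq> 0\<close>] by (auto simp: r_def)
    let ?e = "e(k := (1/r) *\<^sub>R y)"
    have "B (?e i) (?e j) = (if i = j then 1 else 0)" if "i \<in> insert k I" "j \<in> insert k I" for i j
      using that e orth sym[of "e _" y] insert(2) r
      by (auto simp: bilinear_lmul[OF b] bilinear_rmul[OF b] field_simps)
    then show ?case by blast
  qed simp
  from this[of UNIV] show ?thesis by (auto simp: orthonormal_frame_def)
qed

lemma Ck_on_det:
  fixes M :: "'b::euclidean_space \<Rightarrow> real^'k^'k"
  assumes "unique_derivs S" "\<And>i j. Ck_on k S (\<lambda>z. M z $ i $ j)"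
  shows "Ck_on k S (\<lambda>z. det (M z))"
  unfolding det_def by (intro Ck_on_sum Ck_on_mult Ck_on_prod Ck_on_const assms)

text \<open>By Cramer's rule the entries of the inverse are quotients of polynomials in the entries.\<close>

lemma Ck_on_ginv:
  assumes S: "unique_derivs S" and pd: "\<And>z. z \<in> S \<Longrightarrow> posdef_form (B z)"
    and B: "\<And>i j. Ck_on k S (\<lambda>z. B z (axis i 1) (axis j 1))"
  shows "Ck_on k S (\<lambda>z. ginv (B z) $ i $ l)"
proof -
  let ?M = "\<lambda>z. (\<chi> a j. if j = i then axis l 1 $ a else gram (B z) $ a $ j)"
  have nz: "det (gram (B z)) \<noteq> 0" if "z \<in> S" for z
    using gram_invertible[OF pd[OF that]] by (simp add: invertible_det_nz)
  have eq: "ginv (B z) $ i $ l = det (?M z) * inverse (det (gram (B z)))" if "z \<in> S" for z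
  proof -
    have "gram (B z) *v (ginv (B z) *v axis l 1) = axis l 1"
      by (simp add: matrix_vector_mul_assoc gram_ginv[OF pd[OF that]])
    then have "ginv (B z) *v axis l 1 =
        (\<chi> k. det (\<chi> a j. if j = k then axis l 1 $ a else gram (B z) $ a $ j) / det (gram (B z)))"
      by (simp add: cramer[OF nz[OF that]])
    then have "(ginv (B z) *v axis l 1) $ i = det (?M z) / det (gram (B z))"
      by simp
    then show ?thesis
      by (simp add: matrix_vector_mult_basis column_def divide_inverse)
  qed
  have g: "Ck_on k S (\<lambda>z. gram (B z) $ a $ j)" for a j using B by (simp add: gram_def)
  have "Ck_on k S (\<lambda>z. ?M z $ a $ j)" for a j
    using g[of a j] Ck_on_const[OF S] by (cases "j = i") simp_all
  then have "Ck_on k S (\<lambda>z. det (?M z) * inverse (det (gram (B z))))"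
    by (intro Ck_on_mult S Ck_on_inverse Ck_on_det g nz)
  then show ?thesis using eq by (subst Ck_on_cong) auto
qed

lemma Ck_on_metric_trace:
  assumes S: "unique_derivs S" and "\<And>z. z \<in> S \<Longrightarrow> posdef_form (B z)"
    and "\<And>i j. Ck_on k S (\<lambda>z. B z (axis i 1) (axis j 1))"
    and "\<And>i j. Ck_on k S (\<lambda>z. Q z (axis i 1) (axis j 1))"
  shows "Ck_on k S (\<lambda>z. metric_trace (B z) (Q z))"
  unfolding metric_trace_def
  by (intro Ck_on_sum Ck_on_mult S Ck_on_ginv assms)

text \<open>The frame \<open>e\<close> is orthonormal only at \<open>z\<close>.  The second sum corrects for this: in the frame \<open>e\<close>
  the derivative of the inverse Gram matrix is minus the derivative of the Gram matrix.\<close>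

lemma metric_trace_has_derivative:
  fixes B Q :: "'b::euclidean_space \<Rightarrow> real^'k::finite \<Rightarrow> real^'k \<Rightarrow> real"
    and e :: "'k \<Rightarrow> real^'k"
  assumes U: "open U" "z \<in> U" and pd: "\<And>z. z \<in> U \<Longrightarrow> posdef_form (B z)"
    and C1: "\<And>i j. Ck_on 1 U (\<lambda>z. B z (axis i 1) (axis j 1))"
    and B': "\<And>i j. ((\<lambda>z. B z (axis i 1) (axis j 1)) has_derivative (\<lambda>h. B' h (axis i 1) (axis j 1))) (at z)"
    and Q': "\<And>i j. ((\<lambda>z. Q z (axis i 1) (axis j 1)) has_derivative (\<lambda>h. Q' h (axis i 1) (axis j 1))) (at z)"
    and bil: "\<And>h. bilinear (B' h)" "\<And>h. bilinear (Q' h)" "bilinear (Q z)"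
    and e: "orthonormal_frame (B z) e"
  shows "((\<lambda>z. metric_trace (B z) (Q z)) has_derivative
     (\<lambda>h. (\<Sum>i\<in>UNIV. Q' h (e i) (e i)) - (\<Sum>i\<in>UNIV. \<Sum>j\<in>UNIV. B' h (e i) (e j) * Q z (e i) (e j)))) (at z)"
proof -
  have ud: "unique_derivs U" using U by (simp add: unique_derivs_open)
  define I' where "I' h = (\<chi> i j. frechet_derivative (\<lambda>z. ginv (B z) $ i $ j) (at z) h)" for h
  have I': "((\<lambda>z. ginv (B z) $ i $ j) has_derivative (\<lambda>h. I' h $ i $ j)) (at z)" for i j
  proof -
    have "Ck_on (Suc 0) U (\<lambda>z. ginv (B z) $ i $ j)"
      using Ck_on_ginv[OF ud pd C1] by (simp only: One_nat_def)
    from Ck_on_SucD(1)[OF this U(2)] show ?thesis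
      using U by (simp add: I'_def at_within_open[OF U(2,1)])
  qed
  have I'_matrix: "I' h = - (ginv (B z) ** gram (B' h) ** ginv (B z))" for h
  proof -
    have "(ginv (B z) ** gram (B' h) + I' h ** gram (B z)) $ i $ l = 0" for i l
    proof -
      have "((\<lambda>z. \<Sum>j\<in>UNIV. ginv (B z) $ i $ j * gram (B z) $ j $ l) has_derivative
          (\<lambda>h. \<Sum>j\<in>UNIV. ginv (B z) $ i $ j * gram (B' h) $ j $ l + I' h $ i $ j * gram (B z) $ j $ l)) (at z)"
        using I' B' by (auto simp: gram_def intro!: has_derivative_sum has_derivative_mult)
      moreover have "(\<Sum>j\<in>UNIV. ginv (B z) $ i $ j * gram (B z) $ j $ l) = (mat 1 :: real^'k^'k) $ i $ l" if "z \<in> U" for z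
        unfolding ginv_gram[OF pd[OF that], symmetric] by (simp add: matrix_matrix_mult_def)
      then have "((\<lambda>z. \<Sum>j\<in>UNIV. ginv (B z) $ i $ j * gram (B z) $ j $ l) has_derivative (\<lambda>h. 0)) (at z)"
        by (intro has_derivative_transform_within_open[OF has_derivative_const U]) auto
      ultimately have "(\<lambda>h. \<Sum>j\<in>UNIV. ginv (B z) $ i $ j * gram (B' h) $ j $ l + I' h $ i $ j * gram (B z) $ j $ l) = (\<lambda>h. 0)"
        by (rule has_derivative_unique)
      from fun_cong[OF this, of h] show ?thesis
        by (simp add: matrix_matrix_mult_def sum.distrib)
    qed
    then have 0: "ginv (B z) ** gram (B' h) + I' h ** gram (B z) = 0" by (simp add: vec_eq_iff)
    have "I' h = I' h ** (gram (B z) ** ginv (B z))" by (simp add: gram_ginv[OF pd[OF U(2)]])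
    also have "\<dots> = (I' h ** gram (B z)) ** ginv (B z)" by (simp add: matrix_mul_assoc)
    also have "I' h ** gram (B z) = - (ginv (B z) ** gram (B' h))"
      using 0 by (simp add: add_eq_0_iff)
    finally show ?thesis by (simp add: matrix_matrix_mult_def vec_eq_iff sum_negf)
  qed
  have I'_eq: "I' h $ j $ k = - (\<Sum>a\<in>UNIV. \<Sum>b\<in>UNIV. B' h (e a) (e b) * (e a $ j * e b $ k))" for h j k
  proof -
    have "(\<Sum>a\<in>UNIV. \<Sum>b\<in>UNIV. B' h (e a) (e b) * (e a $ j * e b $ k)) =
      (\<Sum>a\<in>UNIV. \<Sum>b\<in>UNIV. \<Sum>l\<in>UNIV. \<Sum>m\<in>UNIV. (e a $ j * e a $ l) * gram (B' h) $ l $ m * (e b $ m * e b $ k))"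
      by (subst bilinear_expand_axis[OF bil(1)]) (simp add: gram_def sum_distrib_left sum_distrib_right ac_simps)
    also have "\<dots> = (\<Sum>b\<in>UNIV. \<Sum>m\<in>UNIV. \<Sum>l\<in>UNIV. \<Sum>a\<in>UNIV. (e a $ j * e a $ l) * gram (B' h) $ l $ m * (e b $ m * e b $ k))"
      by (subst sum.swap, rule sum.cong[OF refl], subst sum.swap, subst (2) sum.swap, subst sum.swap) (rule refl)
    also have "\<dots> = (\<Sum>m\<in>UNIV. \<Sum>l\<in>UNIV. ginv (B z) $ j $ l * gram (B' h) $ l $ m * ginv (B z) $ m $ k)"
      unfolding ginv_orthonormal_frame[OF pd[OF U(2)] e]
      by (subst sum.swap) (simp add: sum_distrib_left sum_distrib_right, intro sum.cong refl sum.swap)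
    also have "\<dots> = (ginv (B z) ** gram (B' h) ** ginv (B z)) $ j $ k"
      by (simp add: matrix_matrix_mult_def sum_distrib_right)
    finally show ?thesis by (simp add: I'_matrix)
  qed
  have "((\<lambda>z. metric_trace (B z) (Q z)) has_derivative
     (\<lambda>h. \<Sum>j\<in>UNIV. \<Sum>k\<in>UNIV. ginv (B z) $ j $ k * Q' h (axis j 1) (axis k 1) + I' h $ j $ k * Q z (axis j 1) (axis k 1))) (at z)"
    unfolding metric_trace_def using I' Q' by (intro has_derivative_sum has_derivative_mult)
  moreover have "(\<Sum>j\<in>UNIV. \<Sum>k\<in>UNIV. ginv (B z) $ j $ k * Q' h (axis j 1) (axis k 1)) = (\<Sum>i\<in>UNIV. Q' h (e i) (e i))" for h
    using metric_trace_orthonormal_frame[OF pd[OF U(2)] e bil(2)] by (simp add: metric_trace_def)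
  moreover have "(\<Sum>j\<in>UNIV. \<Sum>k\<in>UNIV. I' h $ j $ k * Q z (axis j 1) (axis k 1)) =
       - (\<Sum>a\<in>UNIV. \<Sum>b\<in>UNIV. B' h (e a) (e b) * Q z (e a) (e b))" for h
  proof -
    have "(\<Sum>a\<in>UNIV. \<Sum>b\<in>UNIV. B' h (e a) (e b) * Q z (e a) (e b)) =
      (\<Sum>a\<in>UNIV. \<Sum>b\<in>UNIV. \<Sum>j\<in>UNIV. \<Sum>k\<in>UNIV. B' h (e a) (e b) * (e a $ j * e b $ k) * Q z (axis j 1) (axis k 1))"
      by (subst bilinear_expand_axis[OF bil(3)]) (simp add: sum_distrib_left mult.assoc)
    also have "\<dots> = (\<Sum>j\<in>UNIV. \<Sum>k\<in>UNIV. \<Sum>a\<in>UNIV. \<Sum>b\<in>UNIV. B' h (e a) (e b) * (e a $ j * e b $ k) * Q z (axis j 1) (axis k 1))"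
      (is "?L = ?R")
    proof -
      have "?L = (\<Sum>a\<in>UNIV. \<Sum>j\<in>UNIV. \<Sum>k\<in>UNIV. \<Sum>b\<in>UNIV. B' h (e a) (e b) * (e a $ j * e b $ k) * Q z (axis j 1) (axis k 1))"
        by (rule sum.cong[OF refl], subst sum.swap, rule sum.cong[OF refl], subst sum.swap) (rule refl)
      also have "\<dots> = ?R"
        by (subst sum.swap, rule sum.cong[OF refl], subst sum.swap) (rule refl)
      finally show ?thesis .
    qed
    finally show ?thesis
      by (simp add: I'_eq sum_distrib_right sum_negf)
  qed
  ultimately show ?thesis by (simp add: sum.distrib)
qed

section \<open>Derivatives along lines and fields of multilinear maps\<close>

lemma dirder_eqI:
  assumes "(F has_derivative F') (at z)"
  shows "dirder F z v = F' v"
proof -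
  have "((\<lambda>s. F (z + s *\<^sub>R v)) has_derivative (\<lambda>h. F' (h *\<^sub>R v))) (at 0)"
    by (rule has_derivative_compose[where f = "\<lambda>s. z + s *\<^sub>R v" and g = F])
      (use assms in \<open>auto intro!: derivative_eq_intros\<close>)
  then have "((\<lambda>s. F (z + s *\<^sub>R v)) has_vector_derivative F' v) (at 0)"
    using has_derivative_linear[OF assms] by (simp add: has_vector_derivative_def linear_cmul)
  then show ?thesis by (simp add: dirder_def vector_derivative_at)
qed

lemma has_derivative_dirder:
  assumes "F differentiable (at z)"
  shows "(F has_derivative dirder F z) (at z)"
proof -
  obtain F' where F': "(F has_derivative F') (at z)" using assms by (auto simp: differentiable_def)
  moreover have "dirder F z = F'" using dirder_eqI[OF F'] by auto
  ultimately show ?thesis by simp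
qed

lemma dirder_const [simp]: "dirder (\<lambda>_. c) z v = 0"
  by (rule dirder_eqI) (rule has_derivative_const)

lemma linear_dirder: "F differentiable (at z) \<Longrightarrow> linear (dirder F z)"
  using has_derivative_dirder has_derivative_linear by blast

lemma dirder_cong:
  assumes "open U" "z \<in> U" "\<And>z. z \<in> U \<Longrightarrow> f z = g z"
  shows "dirder f z v = dirder g z v"
proof -
  have "((\<lambda>s. z + s *\<^sub>R v) \<longlongrightarrow> z + 0 *\<^sub>R v) (at 0)" by (intro tendsto_intros)
  then have "\<forall>\<^sub>F s in at 0. z + s *\<^sub>R v \<in> U"
    using assms(1,2) by (intro topological_tendstoD) auto
  then have "\<forall>\<^sub>F s in nhds 0. z + s *\<^sub>R v \<in> U"
    using assms(2) by (simp add: eventually_at_filter) (auto elim: eventually_mono)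
  then have "\<forall>\<^sub>F s in nhds 0. f (z + s *\<^sub>R v) = g (z + s *\<^sub>R v)"
    by eventually_elim (rule assms(3))
  then show ?thesis
    unfolding dirder_def by (intro vector_derivative_cong_eq) auto
qed

lemma differentiable_at_cong:
  assumes "open U" "z \<in> U" "\<And>z. z \<in> U \<Longrightarrow> f z = g z" "f differentiable (at z)"
  shows "g differentiable (at z)"
  using assms has_derivative_transform_within_open unfolding differentiable_def by blast

lemma Ck_on_open_differentiable:
  assumes "open U" "Ck_on (Suc k) U F" "z \<in> U"
  shows "F differentiable (at z)"
  using assms(2) assms(3) at_within_open[OF assms(3,1)] by (auto simp: differentiable_on_def)

lemma dirder_eq_frechet:
  assumes "open U" "Ck_on (Suc k) U F" "z \<in> U"
  shows "frechet_derivative F (at z within U) v = dirder F z v"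
  using dirder_eqI[of F "frechet_derivative F (at z within U)" z v] Ck_on_SucD(1)[OF assms(2,3)]
    at_within_open[OF assms(3,1)] by simp

lemma Ck_on_dirder:
  assumes "open U" "Ck_on (Suc k) U F"
  shows "Ck_on k U (\<lambda>z. dirder F z v)"
  using Ck_on_SucD(2)[OF assms(2), of v] dirder_eq_frechet[OF assms] by (subst (asm) Ck_on_cong) auto

lemma Ck_on_componentwise:
  fixes F :: "'b::euclidean_space \<Rightarrow> 'c::euclidean_space"
  assumes "unique_derivs S" "\<And>i. i \<in> Basis \<Longrightarrow> Ck_on k S (\<lambda>x. F x \<bullet> i)"
  shows "Ck_on k S F"
proof -
  have "Ck_on k S (\<lambda>x. \<Sum>i\<in>Basis. (F x \<bullet> i) *\<^sub>R i)"
    by (intro Ck_on_sum Ck_on_scaleR Ck_on_const assms)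
  then show ?thesis by (simp add: euclidean_representation)
qed

text \<open>Near an interior point all small parallelograms are available, so the real-valued case
  applies to each component.\<close>

lemma dirder_symmetric:
  fixes F :: "'b::euclidean_space \<Rightarrow> 'c::euclidean_space"
  assumes U: "open U" "z \<in> U" and F: "Ck_on 2 U F"
  shows "dirder (\<lambda>z. dirder F z v) z w = dirder (\<lambda>z. dirder F z w) z v"
proof -
  have ud: "unique_derivs U" using U by (simp add: unique_derivs_open)
  have F2: "Ck_on (Suc (Suc 0)) U F" using F by (simp add: numeral_2_eq_2)
  obtain r where r: "r > 0" "ball z r \<subseteq> U" using U by (meson openE)
  define d where "d = r / (2 * (norm v + norm w + 1))"
  have N: "norm v + norm w + 1 > 0" by (smt (verit) norm_ge_zero)
  then have "d > 0" using r by (simp add: d_def)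
  have "d * (norm v + norm w) < r"
  proof -
    have "d * (norm v + norm w) \<le> d * (norm v + norm w + 1)" using \<open>d > 0\<close> by simp
    also have "\<dots> = r / 2" using N by (simp add: d_def field_simps)
    finally show ?thesis using r by simp
  qed
  have seg: "z + s *\<^sub>R v + q *\<^sub>R w \<in> U" if "s \<in> {0..d}" "q \<in> {0..d}" for s q
  proof -
    have "dist (z + s *\<^sub>R v + q *\<^sub>R w) z \<le> s * norm v + q * norm w"
      using norm_triangle_ineq[of "s *\<^sub>R v" "q *\<^sub>R w"] that by (simp add: dist_norm)
    also have "\<dots> \<le> d * norm v + d * norm w" using that by (intro add_mono mult_right_mono) auto
    also have "\<dots> < r" using \<open>d * _ < r\<close> by (simp add: distrib_left)
    finally show ?thesis using r by (auto simp: dist_commute)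
  qed
  have "dirder (\<lambda>z. dirder F z v) z w \<bullet> i = dirder (\<lambda>z. dirder F z w) z v \<bullet> i" for i
  proof -
    let ?F = "\<lambda>z. F z \<bullet> i"
    have Fi: "Ck_on 2 U ?F" by (rule Ck_on_inner[OF ud F])
    then have Fi2: "Ck_on (Suc (Suc 0)) U ?F" by (simp add: numeral_2_eq_2)
    have 1: "dirder ?F x v = dirder F x v \<bullet> i" if "x \<in> U" for x v
      by (rule dirder_eqI[of ?F "\<lambda>v. dirder F x v \<bullet> i"])
        (intro has_derivative_inner_left has_derivative_dirder Ck_on_open_differentiable[OF U(1) F2 that])
    have 2: "dirder (\<lambda>z. dirder F z v) z w \<bullet> i = frechet_derivative (\<lambda>z. frechet_derivative ?F (at z within U) v) (at z within U) w" for v w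
    proof -
      have "dirder (\<lambda>z. dirder F z v) z w \<bullet> i = dirder (\<lambda>z. dirder F z v \<bullet> i) z w"
        by (rule dirder_eqI[symmetric, of _ "\<lambda>w. dirder (\<lambda>z. dirder F z v) z w \<bullet> i"])
          (intro has_derivative_inner_left has_derivative_dirder
            Ck_on_open_differentiable[OF U(1) Ck_on_dirder[OF U(1) F2] U(2)])
      also have "\<dots> = dirder (\<lambda>z. frechet_derivative ?F (at z within U) v) z w"
        by (rule dirder_cong[OF U]) (simp add: dirder_eq_frechet[OF U(1) Fi2] 1)
      also have "\<dots> = frechet_derivative (\<lambda>z. frechet_derivative ?F (at z within U) v) (at z within U) w"
        by (rule dirder_eq_frechet[OF U(1) Ck_on_SucD(2)[OF Fi2] U(2), symmetric])
      finally show ?thesis .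
    qed
    show ?thesis
      unfolding 2 by (rule second_derivative_symmetric_real[OF ud Fi \<open>d > 0\<close> seg])
  qed
  then show ?thesis by (auto intro: euclidean_eqI)
qed

subsection \<open>Fields of linear and bilinear maps\<close>

text \<open>Metrics and Christoffel maps are fields of multilinear maps whose regularity is known for fixed
  arguments only.  Expanding the arguments in a basis gives the regularity and the product rule
  for variable arguments.\<close>

lemma linear_expand_Basis:
  fixes L :: "'e::euclidean_space \<Rightarrow> 'c::real_vector"
  assumes "linear L"
  shows "L x = (\<Sum>i\<in>Basis. (x \<bullet> i) *\<^sub>R L i)"
  by (subst euclidean_representation[symmetric, of x])
    (simp add: linear_sum[OF assms] linear_cmul[OF assms] del: euclidean_representation)

lemma Ck_on_linear_field:
  fixes L :: "'b::euclidean_space \<Rightarrow> 'e::euclidean_space \<Rightarrow> 'c::real_normed_vector"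
  assumes S: "unique_derivs S" and lin: "\<And>z. z \<in> S \<Longrightarrow> linear (L z)"
    and L: "\<And>v. Ck_on k S (\<lambda>z. L z v)" and X: "Ck_on k S X"
  shows "Ck_on k S (\<lambda>z. L z (X z))"
proof -
  have "Ck_on k S (\<lambda>z. \<Sum>i\<in>Basis. (X z \<bullet> i) *\<^sub>R L z i)"
    by (intro Ck_on_sum Ck_on_scaleR Ck_on_inner S L X)
  then show ?thesis
    using linear_expand_Basis[OF lin] by (subst Ck_on_cong) auto
qed

lemma Ck_on_bilinear_field:
  fixes B :: "'b::euclidean_space \<Rightarrow> 'e::euclidean_space \<Rightarrow> 'f::euclidean_space \<Rightarrow> 'c::real_normed_vector"
  assumes S: "unique_derivs S" and bil: "\<And>z. z \<in> S \<Longrightarrow> bilinear (B z)"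
    and B: "\<And>v w. Ck_on k S (\<lambda>z. B z v w)" and X: "Ck_on k S X" and Y: "Ck_on k S Y"
  shows "Ck_on k S (\<lambda>z. B z (X z) (Y z))"
proof (rule Ck_on_linear_field[OF S _ _ Y])
  show "linear (B z (X z))" if "z \<in> S" for z using bil[OF that] by (simp add: bilinear_def)
  show "Ck_on k S (\<lambda>z. B z (X z) w)" for w
    by (rule Ck_on_linear_field[OF S _ B X]) (use bil in \<open>simp add: bilinear_def\<close>)
qed

lemma has_derivative_linear_field:
  fixes L :: "'b::euclidean_space \<Rightarrow> 'e::euclidean_space \<Rightarrow> 'c::real_normed_vector"
  assumes U: "open U" "z \<in> U" and lin: "\<And>z. z \<in> U \<Longrightarrow> linear (L z)"
    and L: "\<And>v. (\<lambda>z. L z v) differentiable (at z)" and X: "(X has_derivative X') (at z)"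
  shows "((\<lambda>z. L z (X z)) has_derivative (\<lambda>h. dirder (\<lambda>z'. L z' (X z)) z h + L z (X' h))) (at z)"
proof -
  have gen: "((\<lambda>z. L z (Y z)) has_derivative
      (\<lambda>h. (\<Sum>i\<in>Basis. (Y z \<bullet> i) *\<^sub>R dirder (\<lambda>z. L z i) z h) + L z (Y' h))) (at z)"
    if Y: "(Y has_derivative Y') (at z)" for Y Y'
  proof -
    have "((\<lambda>z. \<Sum>i\<in>Basis. (Y z \<bullet> i) *\<^sub>R L z i) has_derivative
       (\<lambda>h. \<Sum>i\<in>Basis. (Y z \<bullet> i) *\<^sub>R dirder (\<lambda>z. L z i) z h + (Y' h \<bullet> i) *\<^sub>R L z i)) (at z)"
      by (intro has_derivative_sum has_derivative_scaleR has_derivative_inner_left Y has_derivative_dirder L)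
    then have "((\<lambda>z. L z (Y z)) has_derivative
       (\<lambda>h. \<Sum>i\<in>Basis. (Y z \<bullet> i) *\<^sub>R dirder (\<lambda>z. L z i) z h + (Y' h \<bullet> i) *\<^sub>R L z i)) (at z)"
      by (rule has_derivative_transform_within_open[OF _ U]) (rule linear_expand_Basis[OF lin, symmetric])
    then show ?thesis
      using linear_expand_Basis[OF lin[OF U(2)], symmetric] by (simp add: sum.distrib)
  qed
  have "dirder (\<lambda>z'. L z' (X z)) z h = (\<Sum>i\<in>Basis. (X z \<bullet> i) *\<^sub>R dirder (\<lambda>z. L z i) z h)" for h
    using dirder_eqI[OF gen[OF has_derivative_const[of "X z"]]] linear_0[OF lin[OF U(2)]] by simp
  then show ?thesis using gen[OF X] by simp
qed

lemma has_derivative_bilinear_field: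
  fixes B :: "'b::euclidean_space \<Rightarrow> 'e::euclidean_space \<Rightarrow> 'f::euclidean_space \<Rightarrow> 'c::real_normed_vector"
  assumes U: "open U" "z \<in> U" and bil: "\<And>z. z \<in> U \<Longrightarrow> bilinear (B z)"
    and B: "\<And>v w. (\<lambda>z. B z v w) differentiable (at z)"
    and X: "(X has_derivative X') (at z)" and Y: "(Y has_derivative Y') (at z)"
  shows "((\<lambda>z. B z (X z) (Y z)) has_derivative
     (\<lambda>h. dirder (\<lambda>z'. B z' (X z) (Y z)) z h + B z (X' h) (Y z) + B z (X z) (Y' h))) (at z)"
proof -
  have 1: "((\<lambda>z. B z (X z) w) has_derivative
      (\<lambda>h. dirder (\<lambda>z'. B z' (X z) w) z h + B z (X' h) w)) (at z)" for w
    by (rule has_derivative_linear_field[OF U _ B X]) (use bil in \<open>simp add: bilinear_def\<close>)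
  have "((\<lambda>z. B z (X z) (Y z)) has_derivative
      (\<lambda>h. dirder (\<lambda>z'. B z' (X z') (Y z)) z h + B z (X z) (Y' h))) (at z)"
  proof (rule has_derivative_linear_field[OF U _ _ Y])
    show "linear (B z (X z))" if "z \<in> U" for z using bil[OF that] by (simp add: bilinear_def)
    show "(\<lambda>z. B z (X z) w) differentiable (at z)" for w
      unfolding differentiable_def using 1 by blast
  qed
  then show ?thesis by (simp add: dirder_eqI[OF 1])
qed

section \<open>The orthogonal splitting in a chart\<close>

definition leaf_form :: "('p::finite, 'n::finite) form_field \<Rightarrow> ('p, 'n) pt \<Rightarrow> real^'p \<Rightarrow> real^'p \<Rightarrow> real" where
  "leaf_form G z x y = G z (x, 0) (y, 0)"

definition normal_form :: "('p::finite, 'n::finite) form_field \<Rightarrow> ('p, 'n) pt \<Rightarrow> real^'n \<Rightarrow> real^'n \<Rightarrow> real" where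
  "normal_form G z x y = truncated G z (0, x) (0, y)"

definition leaf_frame_at :: "('p::finite, 'n::finite) form_field \<Rightarrow> ('p, 'n) pt \<Rightarrow> ('p \<Rightarrow> ('p, 'n) pt) \<Rightarrow> bool" where
  "leaf_frame_at G z \<epsilon> \<longleftrightarrow> (\<forall>a. \<epsilon> a \<in> leaf_dirs) \<and> orthonormal_frame (G z) \<epsilon>"

definition normal_frame_at :: "('p::finite, 'n::finite) form_field \<Rightarrow> ('p, 'n) pt \<Rightarrow> ('n \<Rightarrow> ('p, 'n) pt) \<Rightarrow> bool" where
  "normal_frame_at G z e \<longleftrightarrow> (\<forall>i. e i \<in> normal_dirs G z) \<and> orthonormal_frame (G z) e"

lemma leaf_dirs_iff [simp]: "v \<in> leaf_dirs \<longleftrightarrow> snd v = 0"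
  by (simp add: leaf_dirs_def)

lemma linear_inl: "linear (\<lambda>x. (x, 0))"
  by (simp add: linear_iff)

lemma linear_inr: "linear (\<lambda>x. (0, x))"
  by (simp add: linear_iff)

lemma bilinear_compose: "bilinear Q \<Longrightarrow> linear f \<Longrightarrow> linear g \<Longrightarrow> bilinear (\<lambda>x y. Q (f x) (g y))"
  unfolding bilinear_def by (auto simp: linear_iff)

text \<open>The linear algebra of the splitting at one point: leaf and normal frames exist, they expand the
  two projections, and normal vectors are determined by their transverse component, so that the
  normal space is a copy of \<open>\<real>\<^sup>n\<close> with the form \<^const>\<open>normal_form\<close>.\<close>

locale pos_form =
  fixes G :: "('p::finite, 'n::finite) form_field" and z :: "('p, 'n) pt"
  assumes posdef: "posdef_form (G z)"
begin

lemma bil: "bilinear (G z)" and sym: "G z v w = G z w v" and pos: "v \<noteq> 0 \<Longrightarrow> G z v v > 0"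
  using posdef unfolding posdef_form_def by blast+

lemmas Gsimps = bilinear_rules[OF bil]
  bilinear_lsub[OF bil] bilinear_rsub[OF bil] bilinear_lneg[OF bil] bilinear_rneg[OF bil]
  bilinear_lzero[OF bil] bilinear_rzero[OF bil] bilinear_sum_left[OF bil] bilinear_sum_right[OF bil]

lemma posdef_leaf_form: "posdef_form (leaf_form G z)"
proof -
  have "bilinear (\<lambda>x y. G z (x, 0) (y, 0))"
    by (rule bilinear_compose[OF bil linear_inl linear_inl])
  then show ?thesis
    using sym pos by (auto simp: posdef_form_def leaf_form_def[abs_def] zero_prod_def)
qed

lemma leaf_frame_at_obtain:
  assumes "leaf_frame_at G z \<epsilon>"
  obtains c :: "'p \<Rightarrow> real^'p" where "orthonormal_frame (leaf_form G z) c" "\<And>a. \<epsilon> a = (c a, 0)"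
proof
  show e: "\<And>a. \<epsilon> a = (fst (\<epsilon> a), 0)" using assms by (auto simp: leaf_frame_at_def prod_eq_iff)
  show "orthonormal_frame (leaf_form G z) (\<lambda>a. fst (\<epsilon> a))"
    using assms e by (simp add: leaf_frame_at_def orthonormal_frame_def leaf_form_def)
qed

lemma leaf_frame_at_leaf_frame: "leaf_frame_at G z (leaf_frame G z)"
proof -
  obtain c :: "'p \<Rightarrow> real^'p" where "orthonormal_frame (leaf_form G z) c"
    using orthonormal_frame_exists[OF posdef_leaf_form] by blast
  then have "\<exists>\<epsilon>::'p \<Rightarrow> ('p, 'n) pt. (\<forall>a. \<epsilon> a \<in> leaf_dirs) \<and> (\<forall>a b. G z (\<epsilon> a) (\<epsilon> b) = (if a = b then 1 else 0))"
    by (intro exI[of _ "\<lambda>a. (c a, 0)"]) (simp add: orthonormal_frame_def leaf_form_def)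
  from someI_ex[OF this] show ?thesis
    unfolding leaf_frame_def leaf_frame_at_def orthonormal_frame_def .
qed

lemma leaf_expansion:
  assumes "leaf_frame_at G z \<epsilon>" "snd v = 0"
  shows "(\<Sum>a\<in>UNIV. G z v (\<epsilon> a) *\<^sub>R \<epsilon> a) = v"
proof -
  obtain c :: "'p \<Rightarrow> real^'p" where c: "orthonormal_frame (leaf_form G z) c" "\<And>a. \<epsilon> a = (c a, 0)"
    using leaf_frame_at_obtain[OF assms(1)] by blast
  have v: "v = (fst v, 0)" using assms(2) by (simp add: prod_eq_iff)
  have "(\<Sum>a\<in>UNIV. G z v (\<epsilon> a) *\<^sub>R \<epsilon> a) = (\<Sum>a\<in>UNIV. (leaf_form G z (fst v) (c a) *\<^sub>R c a, 0))"
    using v by (intro sum.cong) (auto simp: c(2) leaf_form_def)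
  also have "\<dots> = (\<Sum>a\<in>UNIV. leaf_form G z (fst v) (c a) *\<^sub>R c a, 0)"
    by (simp add: prod_eq_iff fst_sum snd_sum)
  also have "\<dots> = v"
    using v orthonormal_frame_expansion[OF posdef_leaf_form c(1), of "fst v"] by simp
  finally show ?thesis .
qed

lemma proj_leaf_eqI:
  assumes "snd w = 0" "v - w \<in> normal_dirs G z"
  shows "proj_leaf G z v = w"
  unfolding proj_leaf_def
proof (rule the_equality)
  fix w' assume w': "w' \<in> leaf_dirs \<and> v - w' \<in> normal_dirs G z"
  have "G z (w' - w) (v - w) = 0" "G z (w' - w) (v - w') = 0"
    using assms w' by (auto simp: normal_dirs_def)
  then have "G z (w' - w) (w' - w) = 0"
    by (simp add: Gsimps)
  then have "w' - w = 0" using pos by fastforce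
  then show "w' = w" by simp
qed (use assms in simp)

lemma proj_leaf_frame:
  assumes "leaf_frame_at G z \<epsilon>"
  shows "proj_leaf G z v = (\<Sum>a\<in>UNIV. G z v (\<epsilon> a) *\<^sub>R \<epsilon> a)"
proof (rule proj_leaf_eqI)
  show "snd (\<Sum>a\<in>UNIV. G z v (\<epsilon> a) *\<^sub>R \<epsilon> a) = 0"
    using assms by (simp add: snd_sum leaf_frame_at_def)
  have "G z \<xi> (v - (\<Sum>a\<in>UNIV. G z v (\<epsilon> a) *\<^sub>R \<epsilon> a)) = 0" if "snd \<xi> = 0" for \<xi>
  proof -
    have "G z \<xi> (\<Sum>a\<in>UNIV. G z v (\<epsilon> a) *\<^sub>R \<epsilon> a) = (\<Sum>a\<in>UNIV. G z v (\<epsilon> a) * G z \<xi> (\<epsilon> a))"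
      by (simp add: Gsimps)
    also have "\<dots> = G z v (\<Sum>a\<in>UNIV. G z \<xi> (\<epsilon> a) *\<^sub>R \<epsilon> a)"
      by (simp add: Gsimps mult.commute)
    also have "\<dots> = G z v \<xi>" by (simp add: leaf_expansion[OF assms that])
    finally show ?thesis by (simp add: Gsimps sym)
  qed
  then show "v - (\<Sum>a\<in>UNIV. G z v (\<epsilon> a) *\<^sub>R \<epsilon> a) \<in> normal_dirs G z"
    by (simp add: normal_dirs_def)
qed

lemma snd_proj_leaf [simp]: "snd (proj_leaf G z v) = 0"
  using leaf_frame_at_leaf_frame
  by (simp add: proj_leaf_frame[OF leaf_frame_at_leaf_frame] snd_sum leaf_frame_at_def)

lemma snd_proj_normal [simp]: "snd (proj_normal G z v) = snd v"
  by (simp add: proj_normal_def)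

lemma linear_proj_leaf: "linear (proj_leaf G z)"
  unfolding proj_leaf_frame[OF leaf_frame_at_leaf_frame, abs_def]
  by (rule linearI) (simp_all add: Gsimps algebra_simps sum.distrib scaleR_sum_right)

lemma linear_proj_normal: "linear (proj_normal G z)"
  unfolding proj_normal_def[abs_def] by (intro linear_compose_sub linear_id[unfolded id_def] linear_proj_leaf)

lemma proj_leaf_leaf: "snd v = 0 \<Longrightarrow> proj_leaf G z v = v"
  by (rule proj_leaf_eqI) (auto simp: normal_dirs_def Gsimps)

lemma proj_normal_leaf: "snd v = 0 \<Longrightarrow> proj_normal G z v = 0"
  by (simp add: proj_normal_def proj_leaf_leaf)

lemma proj_normal_in: "proj_normal G z v \<in> normal_dirs G z"
proof -
  have "G z \<xi> (v - proj_leaf G z v) = 0" if "snd \<xi> = 0" for \<xi>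
  proof -
    have "G z \<xi> (proj_leaf G z v) = (\<Sum>a\<in>UNIV. G z v (leaf_frame G z a) * G z \<xi> (leaf_frame G z a))"
      by (simp add: proj_leaf_frame[OF leaf_frame_at_leaf_frame] Gsimps)
    also have "\<dots> = G z v (\<Sum>a\<in>UNIV. G z \<xi> (leaf_frame G z a) *\<^sub>R leaf_frame G z a)"
      by (simp add: Gsimps mult.commute)
    also have "\<dots> = G z v \<xi>" by (simp add: leaf_expansion[OF leaf_frame_at_leaf_frame that])
    finally show ?thesis by (simp add: Gsimps sym)
  qed
  then show ?thesis by (simp add: normal_dirs_def proj_normal_def)
qed

lemma orth:
  assumes "snd \<xi> = 0"
  shows "G z (proj_normal G z v) \<xi> = 0" "G z \<xi> (proj_normal G z v) = 0"
  using proj_normal_in[of v] assms sym by (auto simp: normal_dirs_def)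

lemma normal_orth:
  assumes "v \<in> normal_dirs G z" "snd \<xi> = 0"
  shows "G z v \<xi> = 0" "G z \<xi> v = 0"
  using assms sym by (auto simp: normal_dirs_def)

lemma proj_leaf_normal: "v \<in> normal_dirs G z \<Longrightarrow> proj_leaf G z v = 0"
  by (rule proj_leaf_eqI) auto

lemma proj_normal_normal: "v \<in> normal_dirs G z \<Longrightarrow> proj_normal G z v = v"
  by (simp add: proj_normal_def proj_leaf_normal)

lemma proj_normal_snd: "snd v = snd w \<Longrightarrow> proj_normal G z v = proj_normal G z w"
  using proj_normal_leaf[of "v - w"] linear_diff[OF linear_proj_normal, of v w] by simp

lemma decompose: "proj_leaf G z v + proj_normal G z v = v"
  by (simp add: proj_normal_def)

lemma G_leaf_right: "snd \<xi> = 0 \<Longrightarrow> G z (proj_leaf G z v) \<xi> = G z v \<xi>"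
  using decompose[of v] orth(1)[of \<xi> v] by (metis Gsimps(1) add.right_neutral)

lemma bilinear_truncated: "bilinear (truncated G z)"
  unfolding truncated_def[abs_def]
  by (rule bilinear_compose[OF bil linear_proj_normal linear_proj_normal])

lemma truncated_sym: "truncated G z v w = truncated G z w v"
  by (simp add: truncated_def sym)

lemma truncated_pos: "snd v \<noteq> 0 \<Longrightarrow> truncated G z v v > 0"
  unfolding truncated_def by (rule pos) (metis snd_proj_normal snd_zero)

lemma truncated_normal: "v \<in> normal_dirs G z \<Longrightarrow> w \<in> normal_dirs G z \<Longrightarrow> truncated G z v w = G z v w"
  by (simp add: truncated_def proj_normal_normal)

lemma truncated_snd: "snd v = snd v' \<Longrightarrow> snd w = snd w' \<Longrightarrow> truncated G z v w = truncated G z v' w'"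
  using proj_normal_snd unfolding truncated_def by metis

lemma posdef_normal_form: "posdef_form (normal_form G z)"
proof -
  have "bilinear (\<lambda>x y. truncated G z (0, x) (0, y))"
    by (rule bilinear_compose[OF bilinear_truncated linear_inr linear_inr])
  then show ?thesis
    using truncated_sym truncated_pos by (auto simp: posdef_form_def normal_form_def[abs_def])
qed

lemma normal_frame_at_obtain:
  assumes "normal_frame_at G z e"
  obtains w :: "'n \<Rightarrow> real^'n" where "orthonormal_frame (normal_form G z) w" "\<And>i. e i = proj_normal G z (0, w i)" "\<And>i. w i = snd (e i)"
proof
  have n: "\<And>i. e i \<in> normal_dirs G z" using assms by (simp add: normal_frame_at_def)
  show e: "\<And>i. e i = proj_normal G z (0, snd (e i))"
    using proj_normal_normal[OF n] proj_normal_snd by (metis snd_conv)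
  show "orthonormal_frame (normal_form G z) (\<lambda>i. snd (e i))"
    using assms e by (simp add: normal_frame_at_def orthonormal_frame_def normal_form_def truncated_def)
qed auto

lemma normal_frame_at_I:
  assumes "orthonormal_frame (normal_form G z) w"
  shows "normal_frame_at G z (\<lambda>i. proj_normal G z (0, w i))"
  using assms proj_normal_in
  by (simp add: normal_frame_at_def orthonormal_frame_def normal_form_def truncated_def)

lemma normal_frame_at_normal_frame: "normal_frame_at G z (normal_frame G z)"
proof -
  obtain w :: "'n \<Rightarrow> real^'n" where "orthonormal_frame (normal_form G z) w"
    using orthonormal_frame_exists[OF posdef_normal_form] by blast
  from normal_frame_at_I[OF this]
  have "\<exists>e::'n \<Rightarrow> ('p, 'n) pt. (\<forall>i. e i \<in> normal_dirs G z) \<and> (\<forall>i j. G z (e i) (e j) = (if i = j then 1 else 0))"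
    unfolding normal_frame_at_def orthonormal_frame_def
    by (intro exI[of _ "\<lambda>i. proj_normal G z (0, w i)"]) simp
  from someI_ex[OF this] show ?thesis
    unfolding normal_frame_def normal_frame_at_def orthonormal_frame_def .
qed

lemma normal_expansion:
  assumes "normal_frame_at G z e" "v \<in> normal_dirs G z"
  shows "(\<Sum>i\<in>UNIV. G z v (e i) *\<^sub>R e i) = v"
proof -
  obtain w :: "'n \<Rightarrow> real^'n" where w: "orthonormal_frame (normal_form G z) w" "\<And>i. e i = proj_normal G z (0, w i)"
    using normal_frame_at_obtain[OF assms(1)] by metis
  let ?N = "\<lambda>x. proj_normal G z (0, x)"
  have lin: "linear ?N" using linear_compose[OF linear_inr linear_proj_normal] by (simp add: o_def)
  have v: "v = ?N (snd v)" using proj_normal_normal[OF assms(2)] proj_normal_snd by (metis snd_conv)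
  have "v = ?N (\<Sum>i\<in>UNIV. normal_form G z (snd v) (w i) *\<^sub>R w i)"
    by (simp add: orthonormal_frame_expansion[OF posdef_normal_form w(1)] v[symmetric])
  also have "\<dots> = (\<Sum>i\<in>UNIV. normal_form G z (snd v) (w i) *\<^sub>R e i)"
    by (simp add: linear_sum[OF lin] linear_cmul[OF lin] w(2))
  also have "\<dots> = (\<Sum>i\<in>UNIV. G z v (e i) *\<^sub>R e i)"
    using v by (simp add: normal_form_def truncated_def w(2))
  finally show ?thesis by simp
qed

lemma proj_normal_frame:
  assumes "normal_frame_at G z e"
  shows "proj_normal G z v = (\<Sum>i\<in>UNIV. G z v (e i) *\<^sub>R e i)"
proof -
  have "G z (proj_normal G z v) (e i) = G z v (e i)" for i
  proof -
    have "e i \<in> normal_dirs G z" using assms by (simp add: normal_frame_at_def)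
    from normal_orth(2)[OF this, of "proj_leaf G z v"] show ?thesis
      by (subst (2) decompose[symmetric]) (simp add: Gsimps)
  qed
  then show ?thesis using normal_expansion[OF assms proj_normal_in, of v] by simp
qed

lemma parseval:
  assumes "leaf_frame_at G z \<epsilon>" "normal_frame_at G z e"
  shows "G z v w = (\<Sum>a\<in>UNIV. G z v (\<epsilon> a) * G z w (\<epsilon> a)) + (\<Sum>i\<in>UNIV. G z v (e i) * G z w (e i))"
proof -
  have "G z v w = G z v (proj_leaf G z w + proj_normal G z w)" by (simp add: decompose)
  also have "\<dots> = (\<Sum>a\<in>UNIV. G z v (\<epsilon> a) * G z w (\<epsilon> a)) + (\<Sum>i\<in>UNIV. G z v (e i) * G z w (e i))"
    by (simp add: proj_leaf_frame[OF assms(1)] proj_normal_frame[OF assms(2)] Gsimps mult.commute)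
  finally show ?thesis .
qed

lemma sqnorm_proj_leaf:
  assumes "leaf_frame_at G z \<epsilon>"
  shows "sqnorm G z (proj_leaf G z v) = (\<Sum>a\<in>UNIV. (G z v (\<epsilon> a))\<^sup>2)"
proof -
  have "sqnorm G z (proj_leaf G z v) = G z v (proj_leaf G z v)"
    by (simp add: sqnorm_def G_leaf_right)
  then show ?thesis by (simp add: proj_leaf_frame[OF assms] Gsimps power2_eq_square)
qed

lemma sqnorm_proj_normal:
  assumes "normal_frame_at G z e"
  shows "sqnorm G z (proj_normal G z v) = (\<Sum>i\<in>UNIV. (G z v (e i))\<^sup>2)"
proof -
  have "sqnorm G z (proj_normal G z v) = G z v (proj_normal G z v)"
    using bilinear_ladd[OF bil, of "proj_leaf G z v" "proj_normal G z v" "proj_normal G z v"]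
    by (simp add: sqnorm_def decompose orth)
  then show ?thesis by (simp add: proj_normal_frame[OF assms] Gsimps power2_eq_square)
qed

lemma leaf_trace:
  assumes "leaf_frame_at G z \<epsilon>" "bilinear Q"
  shows "(\<Sum>a\<in>UNIV. Q (\<epsilon> a) (\<epsilon> a)) = metric_trace (leaf_form G z) (\<lambda>x y. Q (x, 0) (y, 0))"
proof -
  obtain c :: "'p \<Rightarrow> real^'p" where c: "orthonormal_frame (leaf_form G z) c" "\<And>a. \<epsilon> a = (c a, 0)"
    using leaf_frame_at_obtain[OF assms(1)] by blast
  show ?thesis
    using metric_trace_orthonormal_frame[OF posdef_leaf_form c(1) bilinear_compose[OF assms(2) linear_inl linear_inl]]
    by (simp add: c(2))
qed

lemma normal_trace:
  assumes "normal_frame_at G z e" "bilinear Q"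
  shows "(\<Sum>i\<in>UNIV. Q (e i) (e i)) =
    metric_trace (normal_form G z) (\<lambda>x y. Q (proj_normal G z (0, x)) (proj_normal G z (0, y)))"
proof -
  obtain w :: "'n \<Rightarrow> real^'n" where w: "orthonormal_frame (normal_form G z) w" "\<And>i. e i = proj_normal G z (0, w i)"
    using normal_frame_at_obtain[OF assms(1)] by metis
  have lin: "linear (\<lambda>x. proj_normal G z (0, x))"
    using linear_compose[OF linear_inr linear_proj_normal] by (simp add: o_def)
  show ?thesis
    using metric_trace_orthonormal_frame[OF posdef_normal_form w(1) bilinear_compose[OF assms(2) lin lin]]
    by (simp add: w(2))
qed

end

text \<open>Each component of \<open>proj_leaf G z v = (\<Sum>a. G z v (\<epsilon> a) \<epsilon> a)\<close> is a trace over the leaf directions,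
  and traces depend smoothly on the point even if the frames do not.\<close>

lemma Ck_on_proj_leaf:
  assumes U: "unique_derivs U" and pd: "\<And>z. z \<in> U \<Longrightarrow> posdef_form (G z)"
    and C: "\<And>v w. Ck_on k U (\<lambda>z. G z v w)"
  shows "Ck_on k U (\<lambda>z. proj_leaf G z v)"
proof (rule Ck_on_componentwise[OF U])
  fix l :: "('a, 'b) pt"
  have "proj_leaf G z v \<bullet> l = metric_trace (leaf_form G z) (\<lambda>x y. G z v (x, 0) * ((y, 0) \<bullet> l))" if "z \<in> U" for z
  proof -
    interpret pos_form G z by standard (rule pd[OF that])
    have Q: "bilinear (\<lambda>x y. G z v x * (y \<bullet> l))"
      unfolding bilinear_def by (auto simp: linear_iff Gsimps algebra_simps)
    show ?thesis
      using leaf_trace[OF leaf_frame_at_leaf_frame Q]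
      by (simp add: proj_leaf_frame[OF leaf_frame_at_leaf_frame] inner_sum_left)
  qed
  moreover have "Ck_on k U (\<lambda>z. metric_trace (leaf_form G z) (\<lambda>x y. G z v (x, 0) * ((y, 0) \<bullet> l)))"
  proof (rule Ck_on_metric_trace[OF U])
    show "posdef_form (leaf_form G z)" if "z \<in> U" for z
      by (rule pos_form.posdef_leaf_form) (use pd[OF that] in unfold_locales)
  qed (auto simp: leaf_form_def intro!: Ck_on_mult U C Ck_on_const)
  ultimately show "Ck_on k U (\<lambda>z. proj_leaf G z v \<bullet> l)" by (subst Ck_on_cong) auto
qed

lemma Ck_on_proj_normal:
  assumes "unique_derivs U" "\<And>z. z \<in> U \<Longrightarrow> posdef_form (G z)" "\<And>v w. Ck_on k U (\<lambda>z. G z v w)"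
  shows "Ck_on k U (\<lambda>z. proj_normal G z v)"
  unfolding proj_normal_def by (intro Ck_on_diff Ck_on_const Ck_on_proj_leaf assms)

lemma Ck_on_truncated:
  assumes "unique_derivs U" "\<And>z. z \<in> U \<Longrightarrow> posdef_form (G z)" "\<And>v w. Ck_on k U (\<lambda>z. G z v w)"
  shows "Ck_on k U (\<lambda>z. truncated G z v w)"
  unfolding truncated_def
  by (rule Ck_on_bilinear_field[OF assms(1) _ assms(3)])
    (auto intro!: Ck_on_proj_normal assms posdef_form_bilinear)

section \<open>The Levi-Civita connection in a chart\<close>

text \<open>The Koszul formula for constant vector fields, whose brackets vanish.\<close>

definition koszul :: "('p::finite, 'n::finite) form_field \<Rightarrow> ('p, 'n) pt \<Rightarrow> ('p, 'n) pt \<Rightarrow> ('p, 'n) pt \<Rightarrow> ('p, 'n) pt \<Rightarrow> real" where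
  "koszul G z u v w = (dirder (\<lambda>z'. G z' v w) z u + dirder (\<lambda>z'. G z' u w) z v - dirder (\<lambda>z'. G z' u v) z w) / 2"

text \<open>\<^const>\<open>nabla\<close> depends on its first field only through the value at the point; with a vector in that
  place the connection becomes a linear map.\<close>

definition cov :: "('p::finite, 'n::finite) form_field \<Rightarrow> ('p, 'n) pt \<Rightarrow> ('p, 'n) pt \<Rightarrow> ('p, 'n) vfield \<Rightarrow> ('p, 'n) pt" where
  "cov G z v Y = dirder Y z v + christoffel G z v (Y z)"

lemma nabla_cov: "nabla G X Y z = cov G z (X z) Y"
  by (simp add: nabla_def cov_def)

lemma linear_dirder_field:
  fixes L :: "'b::real_normed_vector \<Rightarrow> 'e::real_vector \<Rightarrow> 'c::real_normed_vector"
  assumes "open U" "z \<in> U" "\<And>z. z \<in> U \<Longrightarrow> linear (L z)" "\<And>v. (\<lambda>z. L z v) differentiable (at z)"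
  shows "linear (\<lambda>v. dirder (\<lambda>z. L z v) z u)"
proof (rule linearI)
  fix v w and c :: real
  have "dirder (\<lambda>z. L z (v + w)) z u = dirder (\<lambda>z. L z v + L z w) z u"
    by (rule dirder_cong[OF assms(1,2)]) (simp add: linear_add[OF assms(3)])
  also have "\<dots> = dirder (\<lambda>z. L z v) z u + dirder (\<lambda>z. L z w) z u"
    by (rule dirder_eqI) (intro has_derivative_add has_derivative_dirder assms(4))
  finally show "dirder (\<lambda>z. L z (v + w)) z u = dirder (\<lambda>z. L z v) z u + dirder (\<lambda>z. L z w) z u" .
  have "dirder (\<lambda>z. L z (c *\<^sub>R v)) z u = dirder (\<lambda>z. c *\<^sub>R L z v) z u"
    by (rule dirder_cong[OF assms(1,2)]) (simp add: linear_cmul[OF assms(3)])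
  also have "\<dots> = c *\<^sub>R dirder (\<lambda>z. L z v) z u"
    by (rule dirder_eqI) (intro has_derivative_scaleR_right has_derivative_dirder assms(4))
  finally show "dirder (\<lambda>z. L z (c *\<^sub>R v)) z u = c *\<^sub>R dirder (\<lambda>z. L z v) z u" .
qed

lemma bilinear_dirder_field:
  fixes B :: "'b::real_normed_vector \<Rightarrow> 'e::real_vector \<Rightarrow> 'f::real_vector \<Rightarrow> 'c::real_normed_vector"
  assumes "open U" "z \<in> U" "\<And>z. z \<in> U \<Longrightarrow> bilinear (B z)" "\<And>v w. (\<lambda>z. B z v w) differentiable (at z)"
  shows "bilinear (\<lambda>v w. dirder (\<lambda>z. B z v w) z u)"
  unfolding bilinear_def
proof (intro conjI allI)
  show "linear (\<lambda>w. dirder (\<lambda>z. B z v w) z u)" for v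
    by (rule linear_dirder_field[OF assms(1,2) _ assms(4)]) (use assms(3) in \<open>simp add: bilinear_def\<close>)
  show "linear (\<lambda>v. dirder (\<lambda>z. B z v w) z u)" for w
    by (rule linear_dirder_field[OF assms(1,2) _ assms(4)]) (use assms(3) in \<open>simp add: bilinear_def\<close>)
qed

locale chart_metric =
  fixes U :: "('p::finite, 'n::finite) pt set" and G :: "('p, 'n) form_field"
  assumes open_U: "open U"
    and posdef_U: "\<And>z. z \<in> U \<Longrightarrow> posdef_form (G z)"
    and C2: "\<And>v w. Ck_on 2 U (\<lambda>z. G z v w)"
begin

lemma pos_form_U: "z \<in> U \<Longrightarrow> pos_form G z"
  by standard (rule posdef_U)

lemma ud: "unique_derivs U"
  by (rule unique_derivs_open[OF open_U])

lemma bil_U: "z \<in> U \<Longrightarrow> bilinear (G z)"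
  using posdef_U by (simp add: posdef_form_def)

lemma sym_U: "z \<in> U \<Longrightarrow> G z v w = G z w v"
  using posdef_U unfolding posdef_form_def by blast

lemma C2': "Ck_on (Suc (Suc 0)) U (\<lambda>z. G z v w)"
  using C2 by (simp add: numeral_2_eq_2)

lemma C1_deriv: "Ck_on (Suc 0) U (\<lambda>z. dirder (\<lambda>z. G z v w) z u)"
  by (rule Ck_on_dirder[OF open_U C2'])

lemma diff_C2: "Ck_on (Suc (Suc 0)) U F \<Longrightarrow> z \<in> U \<Longrightarrow> F differentiable (at z)"
  by (rule Ck_on_open_differentiable[OF open_U])

lemma diff_C1: "Ck_on (Suc 0) U F \<Longrightarrow> z \<in> U \<Longrightarrow> F differentiable (at z)"
  by (rule Ck_on_open_differentiable[OF open_U])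

lemma diff_G: "z \<in> U \<Longrightarrow> (\<lambda>z. G z v w) differentiable (at z)"
  by (rule diff_C2[OF C2'])

lemma bilinear_dG: "z \<in> U \<Longrightarrow> bilinear (\<lambda>v w. dirder (\<lambda>z. G z v w) z u)"
  by (rule bilinear_dirder_field[OF open_U _ bil_U diff_G])

lemma dG_sym: "z \<in> U \<Longrightarrow> dirder (\<lambda>z. G z v w) z u = dirder (\<lambda>z. G z w v) z u"
  by (rule dirder_cong[OF open_U]) (auto intro: sym_U)

lemma linear_koszul:
  assumes "z \<in> U"
  shows "linear (koszul G z u v)" "linear (\<lambda>v. koszul G z u v w)" "linear (\<lambda>u. koszul G z u v w)"
proof -
  note b = bilinear_dG[OF assms]
  note l = linear_dirder[OF diff_G[OF assms]]
  show "linear (koszul G z u v)" "linear (\<lambda>v. koszul G z u v w)" "linear (\<lambda>u. koszul G z u v w)"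
    unfolding koszul_def[abs_def]
    by (rule linearI; simp add: bilinear_ladd[OF b] bilinear_radd[OF b] linear_add[OF l]
        bilinear_lmul[OF b] bilinear_rmul[OF b] linear_cmul[OF l] field_simps)+
qed

lemma koszul_sym: "z \<in> U \<Longrightarrow> koszul G z u v w = koszul G z v u w"
  unfolding koszul_def using dG_sym by simp

lemma koszul_compat:
  assumes "z \<in> U"
  shows "koszul G z u v w + koszul G z u w v = dirder (\<lambda>z. G z v w) z u"
  using dG_sym[OF assms, of w v u] by (simp add: koszul_def field_simps)

lemma koszul_unique:
  assumes z: "z \<in> U" and sym: "\<And>v w. \<Gamma> v w = \<Gamma> w v"
    and comp: "\<And>u v w. dirder (\<lambda>z'. G z' v w) z u = G z (\<Gamma> u v) w + G z v (\<Gamma> u w)"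
  shows "G z (\<Gamma> u v) w = koszul G z u v w"
  unfolding koszul_def
  by (simp add: comp sym[of w u] sym[of w v] sym[of v u] sym_U[OF z, of _ "\<Gamma> _ _"])

lemma vector_eq_by_G:
  assumes "z \<in> U" "\<And>w. G z x w = G z y w"
  shows "x = y"
proof -
  interpret pos_form G z by (rule pos_form_U[OF assms(1)])
  have "G z (x - y) (x - y) = 0" by (simp add: Gsimps assms(2))
  then show ?thesis using pos[of "x - y"] by fastforce
qed

lemma koszul_representable:
  assumes z: "z \<in> U"
  shows "G z ((\<Sum>a\<in>UNIV. koszul G z u v (leaf_frame G z a) *\<^sub>R leaf_frame G z a) +
      (\<Sum>i\<in>UNIV. koszul G z u v (normal_frame G z i) *\<^sub>R normal_frame G z i)) w = koszul G z u v w"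
proof -
  interpret pos_form G z by (rule pos_form_U[OF z])
  note l = linear_koszul(1)[OF z]
  have "koszul G z u v w = koszul G z u v (proj_leaf G z w + proj_normal G z w)" by (simp add: decompose)
  also have "\<dots> = (\<Sum>a\<in>UNIV. G z w (leaf_frame G z a) * koszul G z u v (leaf_frame G z a)) +
      (\<Sum>i\<in>UNIV. G z w (normal_frame G z i) * koszul G z u v (normal_frame G z i))"
    by (simp add: linear_add[OF l] linear_sum[OF l] linear_cmul[OF l]
        proj_leaf_frame[OF leaf_frame_at_leaf_frame] proj_normal_frame[OF normal_frame_at_normal_frame])
  finally show ?thesis by (simp add: Gsimps sym[of w] mult.commute)
qed

lemma christoffel_unique_existence:
  assumes z: "z \<in> U"
  shows "\<exists>!\<Gamma>. bilinear \<Gamma> \<and> (\<forall>v w. \<Gamma> v w = \<Gamma> w v) \<and>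
     (\<forall>u v w. dirder (\<lambda>z'. G z' v w) z u = G z (\<Gamma> u v) w + G z v (\<Gamma> u w))"
proof (rule ex_ex1I)
  define \<Gamma> where "\<Gamma> u v = (\<Sum>a\<in>UNIV. koszul G z u v (leaf_frame G z a) *\<^sub>R leaf_frame G z a) +
      (\<Sum>i\<in>UNIV. koszul G z u v (normal_frame G z i) *\<^sub>R normal_frame G z i)" for u v
  have \<Gamma>: "G z (\<Gamma> u v) w = koszul G z u v w" for u v w
    unfolding \<Gamma>_def by (rule koszul_representable[OF z])
  have "bilinear \<Gamma>"
    unfolding bilinear_def
  proof (intro conjI allI)
    show "linear (\<Gamma> x)" for x
      by (rule linearI; rule vector_eq_by_G[OF z])
        (simp_all add: \<Gamma> bilinear_ladd[OF bil_U[OF z]] bilinear_lmul[OF bil_U[OF z]]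
          linear_add[OF linear_koszul(2)[OF z]] linear_cmul[OF linear_koszul(2)[OF z]])
    show "linear (\<lambda>x. \<Gamma> x y)" for y
      by (rule linearI; rule vector_eq_by_G[OF z])
        (simp_all add: \<Gamma> bilinear_ladd[OF bil_U[OF z]] bilinear_lmul[OF bil_U[OF z]]
          linear_add[OF linear_koszul(3)[OF z]] linear_cmul[OF linear_koszul(3)[OF z]])
  qed
  moreover have "\<Gamma> v w = \<Gamma> w v" for v w
    unfolding \<Gamma>_def by (simp add: koszul_sym[OF z, of v w])
  moreover have "dirder (\<lambda>z'. G z' v w) z u = G z (\<Gamma> u v) w + G z v (\<Gamma> u w)" for u v w
    by (simp add: \<Gamma> sym_U[OF z, of v] koszul_compat[OF z])
  ultimately show "\<exists>\<Gamma>. bilinear \<Gamma> \<and> (\<forall>v w. \<Gamma> v w = \<Gamma> w v) \<and>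
     (\<forall>u v w. dirder (\<lambda>z'. G z' v w) z u = G z (\<Gamma> u v) w + G z v (\<Gamma> u w))" by blast
next
  fix \<Gamma> \<Gamma>'
  assume 1: "bilinear \<Gamma> \<and> (\<forall>v w. \<Gamma> v w = \<Gamma> w v) \<and>
     (\<forall>u v w. dirder (\<lambda>z'. G z' v w) z u = G z (\<Gamma> u v) w + G z v (\<Gamma> u w))"
    and 2: "bilinear \<Gamma>' \<and> (\<forall>v w. \<Gamma>' v w = \<Gamma>' w v) \<and>
     (\<forall>u v w. dirder (\<lambda>z'. G z' v w) z u = G z (\<Gamma>' u v) w + G z v (\<Gamma>' u w))"
  have "G z (\<Gamma> u v) w = koszul G z u v w" "G z (\<Gamma>' u v) w = koszul G z u v w" for u v w
    by (rule koszul_unique[OF z]; use 1 2 in blast)+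
  then show "\<Gamma> = \<Gamma>'" by (intro ext vector_eq_by_G[OF z]) simp
qed

lemma
  assumes z: "z \<in> U"
  shows bilinear_christoffel: "bilinear (christoffel G z)"
    and christoffel_sym: "christoffel G z v w = christoffel G z w v"
    and christoffel_compat: "dirder (\<lambda>z'. G z' v w) z u = G z (christoffel G z u v) w + G z v (christoffel G z u w)"
  using theI'[OF christoffel_unique_existence[OF z]] unfolding christoffel_def[symmetric] by blast+

lemma christoffel_koszul: "z \<in> U \<Longrightarrow> G z (christoffel G z u v) w = koszul G z u v w"
  by (rule koszul_unique) (auto intro: christoffel_sym christoffel_compat)

lemma christoffel_frames:
  assumes z: "z \<in> U"
  shows "christoffel G z u v = (\<Sum>a\<in>UNIV. koszul G z u v (leaf_frame G z a) *\<^sub>R leaf_frame G z a) +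
      (\<Sum>i\<in>UNIV. koszul G z u v (normal_frame G z i) *\<^sub>R normal_frame G z i)"
  by (rule vector_eq_by_G[OF z]) (simp only: christoffel_koszul[OF z] koszul_representable[OF z])

lemma C2_proj_normal: "Ck_on (Suc (Suc 0)) U (\<lambda>z. proj_normal G z v)"
  by (rule Ck_on_proj_normal[OF ud posdef_U C2'])

lemma C2_truncated: "Ck_on (Suc (Suc 0)) U (\<lambda>z. truncated G z v w)"
  by (rule Ck_on_truncated[OF ud posdef_U C2'])

lemma C1_koszul: "Ck_on (Suc 0) U (\<lambda>z. koszul G z u v w)"
  unfolding koszul_def divide_inverse
  by (intro Ck_on_mult Ck_on_add Ck_on_diff Ck_on_const C1_deriv ud)

text \<open>Raising an index with the metric is again a trace, over the leaf and the normal directions.\<close>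

lemma C1_christoffel: "Ck_on (Suc 0) U (\<lambda>z. christoffel G z u v)"
proof (rule Ck_on_componentwise[OF ud])
  fix l :: "('p, 'n) pt"
  let ?N = "\<lambda>z x. proj_normal G z (0, x)"
  have eq: "christoffel G z u v \<bullet> l =
     metric_trace (leaf_form G z) (\<lambda>x y. koszul G z u v (x, 0) * ((y, 0) \<bullet> l)) +
     metric_trace (normal_form G z) (\<lambda>x y. koszul G z u v (?N z x) * (?N z y \<bullet> l))" if z: "z \<in> U" for z
  proof -
    interpret pos_form G z by (rule pos_form_U[OF z])
    have Q: "bilinear (\<lambda>x y. koszul G z u v x * (y \<bullet> l))"
      unfolding bilinear_def
      by (auto simp: linear_iff linear_add[OF linear_koszul(1)[OF z]]
          linear_cmul[OF linear_koszul(1)[OF z]] algebra_simps)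
    show ?thesis
      unfolding christoffel_frames[OF z]
      using leaf_trace[OF leaf_frame_at_leaf_frame Q] normal_trace[OF normal_frame_at_normal_frame Q]
      by (simp add: inner_add_left inner_sum_left)
  qed
  have pl: "posdef_form (leaf_form G z)" and pn: "posdef_form (normal_form G z)" if "z \<in> U" for z
    using pos_form.posdef_leaf_form[OF pos_form_U[OF that]] pos_form.posdef_normal_form[OF pos_form_U[OF that]] by auto
  have N: "Ck_on (Suc 0) U (\<lambda>z. ?N z x)" for x
    by (rule Ck_on_Suc_imp[OF C2_proj_normal])
  have "Ck_on (Suc 0) U (\<lambda>z. metric_trace (leaf_form G z) (\<lambda>x y. koszul G z u v (x, 0) * ((y, 0) \<bullet> l)))"
    by (rule Ck_on_metric_trace[OF ud pl])
      (simp_all add: leaf_form_def Ck_on_Suc_imp[OF C2'] Ck_on_mult Ck_on_const C1_koszul ud del: Ck_on.simps)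
  moreover have "Ck_on (Suc 0) U (\<lambda>z. metric_trace (normal_form G z) (\<lambda>x y. koszul G z u v (?N z x) * (?N z y \<bullet> l)))"
  proof (rule Ck_on_metric_trace[OF ud pn])
    show "Ck_on (Suc 0) U (\<lambda>z. normal_form G z (axis i 1) (axis j 1))" for i j
      unfolding normal_form_def by (rule Ck_on_Suc_imp[OF C2_truncated])
    show "Ck_on (Suc 0) U (\<lambda>z. koszul G z u v (?N z (axis i 1)) * (?N z (axis j 1) \<bullet> l))" for i j
      by (intro Ck_on_mult Ck_on_inner N ud Ck_on_linear_field[OF ud _ C1_koszul N] linear_koszul(1))
  qed
  ultimately have "Ck_on (Suc 0) U (\<lambda>z.
     metric_trace (leaf_form G z) (\<lambda>x y. koszul G z u v (x, 0) * ((y, 0) \<bullet> l)) +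
     metric_trace (normal_form G z) (\<lambda>x y. koszul G z u v (?N z x) * (?N z y \<bullet> l)))"
    by (rule Ck_on_add[OF ud])
  then show "Ck_on (Suc 0) U (\<lambda>z. christoffel G z u v \<bullet> l)" using eq by (subst Ck_on_cong) auto
qed

lemma diff_christoffel: "z \<in> U \<Longrightarrow> (\<lambda>z. christoffel G z u v) differentiable (at z)"
  by (rule diff_C1[OF C1_christoffel])

lemma metric_compat:
  assumes z: "z \<in> U" and "X differentiable (at z)" "Y differentiable (at z)"
  shows "dirder (\<lambda>z. G z (X z) (Y z)) z v = G z (cov G z v X) (Y z) + G z (X z) (cov G z v Y)"
proof -
  have "dirder (\<lambda>z. G z (X z) (Y z)) z v =
      dirder (\<lambda>z'. G z' (X z) (Y z)) z v + G z (dirder X z v) (Y z) + G z (X z) (dirder Y z v)"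
    by (rule dirder_eqI) (rule has_derivative_bilinear_field[OF open_U z bil_U diff_G[OF z]
          has_derivative_dirder[OF assms(2)] has_derivative_dirder[OF assms(3)]])
  then show ?thesis
    by (simp add: cov_def christoffel_compat[OF z] bilinear_ladd[OF bil_U[OF z]] bilinear_radd[OF bil_U[OF z]])
qed

lemma differentiable_pairing:
  assumes z: "z \<in> U" and "X differentiable (at z)" "Y differentiable (at z)"
  shows "(\<lambda>z. G z (X z) (Y z)) differentiable (at z)"
  using has_derivative_bilinear_field[OF open_U z bil_U diff_G[OF z]
          has_derivative_dirder[OF assms(2)] has_derivative_dirder[OF assms(3)]]
  unfolding differentiable_def by blast

lemma Ck_on_pairing:
  assumes "Ck_on k U X" "Ck_on k U Y" "k \<le> 2"
  shows "Ck_on k U (\<lambda>z. G z (X z) (Y z))"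
  by (rule Ck_on_bilinear_field[OF ud bil_U Ck_on_mono[OF C2 assms(3)] assms(1,2)])

lemma linear_cov: "z \<in> U \<Longrightarrow> Y differentiable (at z) \<Longrightarrow> linear (\<lambda>v. cov G z v Y)"
  unfolding cov_def
  by (intro linear_compose_add linear_dirder) (use bilinear_christoffel bilinear_def in blast)+

lemma nabla_has_derivative:
  assumes z: "z \<in> U" and X: "X differentiable (at z)" and Y: "Ck_on (Suc (Suc 0)) U Y"
  shows "(nabla G X Y has_derivative
     (\<lambda>h. dirder (\<lambda>z'. dirder Y z' (X z)) z h + dirder Y z (dirder X z h) +
        (dirder (\<lambda>z'. christoffel G z' (X z) (Y z)) z h + christoffel G z (dirder X z h) (Y z) +
         christoffel G z (X z) (dirder Y z h)))) (at z)"
proof -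
  have "((\<lambda>z. dirder Y z (X z)) has_derivative
      (\<lambda>h. dirder (\<lambda>z'. dirder Y z' (X z)) z h + dirder Y z (dirder X z h))) (at z)"
    by (rule has_derivative_linear_field[OF open_U z _ _ has_derivative_dirder[OF X]])
      (auto intro: linear_dirder diff_C2[OF Y] diff_C1[OF Ck_on_dirder[OF open_U Y]] z)
  moreover have "((\<lambda>z. christoffel G z (X z) (Y z)) has_derivative
      (\<lambda>h. dirder (\<lambda>z'. christoffel G z' (X z) (Y z)) z h + christoffel G z (dirder X z h) (Y z) +
         christoffel G z (X z) (dirder Y z h))) (at z)"
    by (rule has_derivative_bilinear_field[OF open_U z bilinear_christoffel diff_christoffel[OF z]
          has_derivative_dirder[OF X] has_derivative_dirder[OF diff_C2[OF Y z]]])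
  ultimately show ?thesis
    unfolding nabla_def[abs_def] by (rule has_derivative_add)
qed

lemma lie_bracket_const_left: "lie_bracket (\<lambda>_. v) Y z = dirder Y z v"
  by (simp add: lie_bracket_def)

text \<open>The second derivatives of \<open>Z\<close> cancel by symmetry and the terms containing first
  derivatives of \<open>X\<close> and \<open>Y\<close> are absorbed by the bracket.\<close>

lemma curvature_tensorial:
  assumes z: "z \<in> U" and X: "X differentiable (at z)" and Y: "Y differentiable (at z)"
    and Z: "Ck_on (Suc (Suc 0)) U Z"
  shows "curvature G X Y Z z = curvature G (\<lambda>_. X z) (\<lambda>_. Y z) (\<lambda>_. Z z) z"
proof -
  let ?\<Gamma> = "christoffel G"
  note b = bilinear_christoffel[OF z]
  have Z2: "Ck_on 2 U Z" using Z by (simp add: numeral_2_eq_2)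
  have C: "Ck_on (Suc (Suc 0)) U (\<lambda>_. Z z)" by (rule Ck_on_const[OF ud])
  have dz: "linear (dirder Z z)" by (rule linear_dirder[OF diff_C2[OF Z z]])
  have n1: "dirder (nabla G X Z) z v = dirder (\<lambda>z'. dirder Z z' (X z)) z v + dirder Z z (dirder X z v) +
        (dirder (\<lambda>z'. ?\<Gamma> z' (X z) (Z z)) z v + ?\<Gamma> z (dirder X z v) (Z z) + ?\<Gamma> z (X z) (dirder Z z v))"
    if "X differentiable (at z)" for X v
    by (rule dirder_eqI) (rule nabla_has_derivative[OF z that Z])
  have n2: "dirder (nabla G (\<lambda>_. x) (\<lambda>_. Z z)) z v = dirder (\<lambda>z'. ?\<Gamma> z' x (Z z)) z v" for x v
    using dirder_eqI[OF nabla_has_derivative[OF z _ C, of "\<lambda>_. x"], of v]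
    by (simp add: bilinear_lzero[OF b] bilinear_rzero[OF b])
  have "dirder (\<lambda>z'. dirder Z z' (Y z)) z (X z) = dirder (\<lambda>z'. dirder Z z' (X z)) z (Y z)"
    by (rule dirder_symmetric[OF open_U z Z2])
  then show ?thesis
    by (simp add: curvature_def nabla_def[of G _ "nabla G _ _"] nabla_def[of G "lie_bracket _ _"] n1[OF X] n1[OF Y] n2
        lie_bracket_def nabla_def linear_diff[OF dz] bilinear_lsub[OF b] bilinear_radd[OF b]
        bilinear_lzero[OF b] bilinear_rzero[OF b])
qed

end

section \<open>Extrinsic geometry of the two distributions\<close>

context chart_metric
begin

lemma differentiable_N: "z \<in> U \<Longrightarrow> (\<lambda>z. proj_normal G z v) differentiable (at z)"
  by (rule diff_C2[OF C2_proj_normal])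

text \<open>The projection of a constant vector to the normal space has constant transverse component.
  Hence its derivatives, and its brackets with constant leaf fields, are tangent to the leaves.  This is
  what makes the second fundamental form of the normal distribution computable below.\<close>

lemma snd_dirder_N:
  assumes z: "z \<in> U"
  shows "snd (dirder (\<lambda>z. proj_normal G z v) z h) = 0"
proof -
  have "dirder (\<lambda>z. snd (proj_normal G z v)) z h = snd (dirder (\<lambda>z. proj_normal G z v) z h)"
    by (rule dirder_eqI) (intro has_derivative_snd has_derivative_dirder differentiable_N z)
  moreover have "dirder (\<lambda>z. snd (proj_normal G z v)) z h = dirder (\<lambda>z. snd v) z h"
    by (rule dirder_cong[OF open_U z]) (simp add: pos_form.snd_proj_normal[OF pos_form_U])
  ultimately show ?thesis by simp
qed

lemma cov_const: "cov G z v (\<lambda>_. \<xi>) = christoffel G z v \<xi>"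
  by (simp add: cov_def)

lemma cov_const_pairing:
  assumes z: "z \<in> U" and "Y differentiable (at z)"
  shows "G z (cov G z v Y) \<xi> = dirder (\<lambda>z. G z (Y z) \<xi>) z v - G z (Y z) (christoffel G z v \<xi>)"
  using metric_compat[OF z assms(2), of "\<lambda>_. \<xi>"] by (simp add: cov_const)

text \<open>Differentiate the orthogonality of the projected field and a constant leaf field.\<close>

lemma cov_N_leaf:
  assumes z: "z \<in> U" and \<xi>: "snd \<xi> = 0"
  shows "G z (cov G z \<eta> (\<lambda>z. proj_normal G z v)) \<xi> = - G z (proj_normal G z v) (christoffel G z \<eta> \<xi>)"
proof -
  have "dirder (\<lambda>z. G z (proj_normal G z v) \<xi>) z \<eta> = dirder (\<lambda>z. 0) z \<eta>"
    by (rule dirder_cong[OF open_U z]) (simp add: pos_form.orth[OF pos_form_U \<xi>])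
  then show ?thesis using cov_const_pairing[OF z differentiable_N[OF z]] by simp
qed

text \<open>The second fundamental form of the normal distribution is minus half the derivative of the
  normal metric along the leaf.  Both sides are expressed by Christoffel symbols; the brackets of
  \<open>\<xi>\<close> with the projected fields drop out because they are orthogonal to the normal space.\<close>

lemma second_fundamental_form:
  assumes z: "z \<in> U" and \<xi>: "snd \<xi> = 0"
  shows "G z (cov G z (proj_normal G z u) (\<lambda>z. proj_normal G z v) +
           cov G z (proj_normal G z v) (\<lambda>z. proj_normal G z u)) \<xi> =
         - dirder (\<lambda>z. truncated G z u v) z \<xi>"
proof -
  interpret pos_form G z by (rule pos_form_U[OF z])
  have N: "G z (cov G z \<xi> (\<lambda>z. proj_normal G z u)) (proj_normal G z v) =
      G z (christoffel G z \<xi> (proj_normal G z u)) (proj_normal G z v)" for u v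
    by (simp add: cov_def Gsimps orth snd_dirder_N[OF z])
  have "dirder (\<lambda>z. truncated G z u v) z \<xi> =
      G z (christoffel G z \<xi> (proj_normal G z u)) (proj_normal G z v) +
      G z (proj_normal G z u) (christoffel G z \<xi> (proj_normal G z v))"
    unfolding truncated_def
    using metric_compat[OF z differentiable_N[OF z] differentiable_N[OF z], of u v \<xi>] N[of u v] N[of v u]
    by (simp add: sym[of "proj_normal G z _" "cov G z _ _"] sym[of "proj_normal G z _" "christoffel G z _ _"])
  then show ?thesis
    by (simp add: Gsimps cov_N_leaf[OF z \<xi>] christoffel_sym[OF z, of \<xi>]
        sym[of "christoffel G z _ _" "proj_normal G z _"])
qed

text \<open>By tensoriality \<open>e\<close> may be extended to its projection \<open>E\<close> instead of to a constant field.  Metric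
  compatibility then moves all outer derivatives from vector fields to the scalar functions
  \<open>G(\<nabla>\<^sub>E E, \<xi>)\<close> and \<open>G(\<nabla>\<^sub>\<xi> E, \<xi>)\<close>, which are given by the preceding two lemmas.\<close>

lemma riem_mixed:
  assumes z: "z \<in> U" and \<xi>: "snd \<xi> = 0" and e: "e \<in> normal_dirs G z"
  shows "riem G z \<xi> e \<xi> e =
     - (1/2) * dirder (\<lambda>z'. dirder (\<lambda>z. truncated G z e e) z' \<xi>) z \<xi>
     - G z (cov G z e (\<lambda>z. proj_normal G z e)) (christoffel G z \<xi> \<xi>)
     + dirder (\<lambda>z. G z (proj_normal G z e) (christoffel G z \<xi> \<xi>)) z e
     + G z (dirder (\<lambda>z. proj_normal G z e) z \<xi> + christoffel G z \<xi> e) (christoffel G z e \<xi>)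
     + G z e (christoffel G z (dirder (\<lambda>z. proj_normal G z e) z \<xi>) \<xi>)"
proof -
  interpret pos_form G z by (rule pos_form_U[OF z])
  let ?E = "\<lambda>z. proj_normal G z e"
  have Ez: "?E z = e" by (rule proj_normal_normal[OF e])
  have dE: "?E differentiable (at z)" by (rule differentiable_N[OF z])
  have d1: "nabla G ?E ?E differentiable (at z)"
    using nabla_has_derivative[OF z dE C2_proj_normal] unfolding differentiable_def by blast
  have d2: "nabla G (\<lambda>_. \<xi>) ?E differentiable (at z)"
    using nabla_has_derivative[OF z differentiable_const[of \<xi>] C2_proj_normal] unfolding differentiable_def by blast
  have "curvature G (\<lambda>_. \<xi>) (\<lambda>_. e) (\<lambda>_. e) z = curvature G (\<lambda>_. \<xi>) ?E ?E z"
    using curvature_tensorial[OF z _ dE C2_proj_normal, of "\<lambda>_. \<xi>" e] by (simp add: Ez)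
  also have "\<dots> = cov G z \<xi> (nabla G ?E ?E) - cov G z e (nabla G (\<lambda>_. \<xi>) ?E) - cov G z (dirder ?E z \<xi>) ?E"
    by (simp add: curvature_def nabla_cov[of _ _ "nabla G _ _"] nabla_cov[of _ "lie_bracket _ _"] lie_bracket_const_left Ez)
  finally have "riem G z \<xi> e \<xi> e = G z (cov G z \<xi> (nabla G ?E ?E)) \<xi>
      - G z (cov G z e (nabla G (\<lambda>_. \<xi>) ?E)) \<xi> - G z (cov G z (dirder ?E z \<xi>) ?E) \<xi>"
    by (simp add: riem_def Gsimps)
  moreover have "G z (cov G z \<xi> (nabla G ?E ?E)) \<xi> =
      - (1/2) * dirder (\<lambda>z'. dirder (\<lambda>z. truncated G z e e) z' \<xi>) z \<xi> - G z (cov G z e ?E) (christoffel G z \<xi> \<xi>)"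
  proof -
    have "G z' (nabla G ?E ?E z') \<xi> = (-(1/2)) * dirder (\<lambda>z. truncated G z e e) z' \<xi>" if "z' \<in> U" for z'
      using second_fundamental_form[OF that \<xi>, of e e] bilinear_ladd[OF bil_U[OF that]] by (simp add: nabla_cov)
    then have "dirder (\<lambda>z'. G z' (nabla G ?E ?E z') \<xi>) z \<xi> = dirder (\<lambda>z'. (-(1/2)) * dirder (\<lambda>z. truncated G z e e) z' \<xi>) z \<xi>"
      by (intro dirder_cong[OF open_U z])
    also have "\<dots> = (-(1/2)) * dirder (\<lambda>z'. dirder (\<lambda>z. truncated G z e e) z' \<xi>) z \<xi>"
      by (rule dirder_eqI)
        (intro has_derivative_mult_right has_derivative_dirder diff_C1[OF Ck_on_dirder[OF open_U C2_truncated] z])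
    finally show ?thesis
      using cov_const_pairing[OF z d1] by (simp add: nabla_cov Ez)
  qed
  moreover have "G z (cov G z e (nabla G (\<lambda>_. \<xi>) ?E)) \<xi> =
     - dirder (\<lambda>z. G z (?E z) (christoffel G z \<xi> \<xi>)) z e
     - G z (dirder ?E z \<xi> + christoffel G z \<xi> e) (christoffel G z e \<xi>)"
  proof -
    have "dirder (\<lambda>z'. G z' (nabla G (\<lambda>_. \<xi>) ?E z') \<xi>) z e = dirder (\<lambda>z. - G z (?E z) (christoffel G z \<xi> \<xi>)) z e"
      by (rule dirder_cong[OF open_U z]) (simp add: nabla_cov cov_N_leaf[OF _ \<xi>])
    also have "\<dots> = - dirder (\<lambda>z. G z (?E z) (christoffel G z \<xi> \<xi>)) z e"
      by (rule dirder_eqI)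
        (intro has_derivative_minus has_derivative_dirder differentiable_pairing z dE diff_christoffel)
    finally show ?thesis
      using cov_const_pairing[OF z d2] by (simp add: nabla_cov cov_def Ez)
  qed
  moreover have "G z (cov G z (dirder ?E z \<xi>) ?E) \<xi> = - G z e (christoffel G z (dirder ?E z \<xi>) \<xi>)"
    by (simp add: cov_N_leaf[OF z \<xi>] Ez)
  ultimately show ?thesis by simp
qed

subsection \<open>Derivatives of traces\<close>

text \<open>A trace that is differentiated in a frame fixed at \<open>z\<close> picks up a term with the derivative of the
  metric, for the leaf directions and likewise for the normal directions.\<close>

lemma leaf_trace_dirder:
  assumes z: "z \<in> U" and \<epsilon>: "leaf_frame_at G z \<epsilon>"
    and Q: "\<And>z. z \<in> U \<Longrightarrow> bilinear (Q z)" and dQ: "\<And>v w. (\<lambda>z. Q z v w) differentiable (at z)"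
  shows "dirder (\<lambda>z. \<Sum>a\<in>UNIV. Q z (leaf_frame G z a) (leaf_frame G z a)) z h =
     (\<Sum>a\<in>UNIV. dirder (\<lambda>z. Q z (\<epsilon> a) (\<epsilon> a)) z h) -
     (\<Sum>a\<in>UNIV. \<Sum>b\<in>UNIV. dirder (\<lambda>z. G z (\<epsilon> a) (\<epsilon> b)) z h * Q z (\<epsilon> a) (\<epsilon> b))"
proof -
  obtain c :: "'p \<Rightarrow> real^'p" where c: "orthonormal_frame (leaf_form G z) c" "\<And>a. \<epsilon> a = (c a, 0)"
    using pos_form.leaf_frame_at_obtain[OF pos_form_U[OF z] \<epsilon>] by blast
  let ?Q = "\<lambda>z x y. Q z (x, 0) (y, 0)"
  let ?Q' = "\<lambda>h x y. dirder (\<lambda>z. Q z (x, 0) (y, 0)) z h"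
  let ?B' = "\<lambda>h x y. dirder (\<lambda>z. G z (x, 0) (y, 0)) z h"
  have "((\<lambda>z. metric_trace (leaf_form G z) (?Q z)) has_derivative
     (\<lambda>h. (\<Sum>i\<in>UNIV. ?Q' h (c i) (c i)) - (\<Sum>i\<in>UNIV. \<Sum>j\<in>UNIV. ?B' h (c i) (c j) * ?Q z (c i) (c j)))) (at z)"
  proof (rule metric_trace_has_derivative[where B = "leaf_form G" and Q = ?Q and B' = ?B' and Q' = ?Q' and e = c,
        OF open_U z])
    show "orthonormal_frame (leaf_form G z) c" by (rule c(1))
    show "posdef_form (leaf_form G z)" if "z \<in> U" for z
      by (rule pos_form.posdef_leaf_form[OF pos_form_U[OF that]])
    show "Ck_on 1 U (\<lambda>z. leaf_form G z (axis i 1) (axis j 1))" for i j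
      unfolding leaf_form_def One_nat_def by (rule Ck_on_Suc_imp[OF C2'])
    show "((\<lambda>z. leaf_form G z (axis i 1) (axis j 1)) has_derivative (\<lambda>h. ?B' h (axis i 1) (axis j 1))) (at z)" for i j
      unfolding leaf_form_def by (rule has_derivative_dirder[OF diff_G[OF z]])
    show "((\<lambda>z. ?Q z (axis i 1) (axis j 1)) has_derivative (\<lambda>h. ?Q' h (axis i 1) (axis j 1))) (at z)" for i j
      by (rule has_derivative_dirder[OF dQ])
    show "bilinear (?B' h)" for h
      by (rule bilinear_compose[OF bilinear_dG[OF z] linear_inl linear_inl])
    show "bilinear (?Q' h)" for h
      by (rule bilinear_compose[OF bilinear_dirder_field[OF open_U z Q dQ] linear_inl linear_inl])
    show "bilinear (?Q z)"
      by (rule bilinear_compose[OF Q[OF z] linear_inl linear_inl])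
  qed
  note 1 = dirder_eqI[OF this, of h]
  have "dirder (\<lambda>z. \<Sum>a\<in>UNIV. Q z (leaf_frame G z a) (leaf_frame G z a)) z h =
      dirder (\<lambda>z. metric_trace (leaf_form G z) (?Q z)) z h"
    by (rule dirder_cong[OF open_U z])
      (rule pos_form.leaf_trace[OF pos_form_U pos_form.leaf_frame_at_leaf_frame[OF pos_form_U] Q])
  then show ?thesis unfolding 1 c(2) by simp
qed

text \<open>Here the frame is transported by its transverse components, so \<open>Q\<close> has to depend on these only.\<close>

lemma normal_trace_dirder:
  assumes z: "z \<in> U" and e: "normal_frame_at G z e"
    and Q: "\<And>z. z \<in> U \<Longrightarrow> bilinear (Q z)" and dQ: "\<And>v w. (\<lambda>z. Q z v w) differentiable (at z)"
    and Q_snd: "\<And>z u v u' v'. z \<in> U \<Longrightarrow> snd u = snd u' \<Longrightarrow> snd v = snd v' \<Longrightarrow> Q z u v = Q z u' v'"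
  shows "dirder (\<lambda>z. \<Sum>i\<in>UNIV. Q z (normal_frame G z i) (normal_frame G z i)) z h =
     (\<Sum>i\<in>UNIV. dirder (\<lambda>z. Q z (e i) (e i)) z h) -
     (\<Sum>i\<in>UNIV. \<Sum>j\<in>UNIV. dirder (\<lambda>z. truncated G z (e i) (e j)) z h * Q z (e i) (e j))"
proof -
  obtain c :: "'n \<Rightarrow> real^'n" where c: "orthonormal_frame (normal_form G z) c" "\<And>i. c i = snd (e i)"
    using pos_form.normal_frame_at_obtain[OF pos_form_U[OF z] e] by metis
  let ?Q = "\<lambda>z x y. Q z (0, x) (0, y)"
  let ?Q' = "\<lambda>h x y. dirder (\<lambda>z. Q z (0, x) (0, y)) z h"
  let ?B' = "\<lambda>h x y. dirder (\<lambda>z. truncated G z (0, x) (0, y)) z h"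
  have "((\<lambda>z. metric_trace (normal_form G z) (?Q z)) has_derivative
     (\<lambda>h. (\<Sum>i\<in>UNIV. ?Q' h (c i) (c i)) - (\<Sum>i\<in>UNIV. \<Sum>j\<in>UNIV. ?B' h (c i) (c j) * ?Q z (c i) (c j)))) (at z)"
  proof (rule metric_trace_has_derivative[where B = "normal_form G" and Q = ?Q and B' = ?B' and Q' = ?Q' and e = c,
        OF open_U z])
    show "orthonormal_frame (normal_form G z) c" by (rule c(1))
    show "posdef_form (normal_form G z)" if "z \<in> U" for z
      by (rule pos_form.posdef_normal_form[OF pos_form_U[OF that]])
    show "Ck_on 1 U (\<lambda>z. normal_form G z (axis i 1) (axis j 1))" for i j
      unfolding normal_form_def One_nat_def by (rule Ck_on_Suc_imp[OF C2_truncated])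
    show "((\<lambda>z. normal_form G z (axis i 1) (axis j 1)) has_derivative (\<lambda>h. ?B' h (axis i 1) (axis j 1))) (at z)" for i j
      unfolding normal_form_def by (rule has_derivative_dirder[OF diff_C2[OF C2_truncated z]])
    show "((\<lambda>z. ?Q z (axis i 1) (axis j 1)) has_derivative (\<lambda>h. ?Q' h (axis i 1) (axis j 1))) (at z)" for i j
      by (rule has_derivative_dirder[OF dQ])
    show "bilinear (?B' h)" for h
      by (rule bilinear_compose[OF bilinear_dirder_field[OF open_U z
              pos_form.bilinear_truncated[OF pos_form_U] diff_C2[OF C2_truncated z]] linear_inr linear_inr])
    show "bilinear (?Q' h)" for h
      by (rule bilinear_compose[OF bilinear_dirder_field[OF open_U z Q dQ] linear_inr linear_inr])
    show "bilinear (?Q z)"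
      by (rule bilinear_compose[OF Q[OF z] linear_inr linear_inr])
  qed
  note 1 = dirder_eqI[OF this, of h]
  have 2: "dirder (\<lambda>z. \<Sum>i\<in>UNIV. Q z (normal_frame G z i) (normal_frame G z i)) z h =
      dirder (\<lambda>z. metric_trace (normal_form G z) (?Q z)) z h"
  proof (rule dirder_cong[OF open_U z])
    fix z assume z: "z \<in> U"
    interpret pos_form G z by (rule pos_form_U[OF z])
    have "Q z (proj_normal G z (0, x)) (proj_normal G z (0, y)) = ?Q z x y" for x y
      by (rule Q_snd[OF z]) auto
    then show "(\<Sum>i\<in>UNIV. Q z (normal_frame G z i) (normal_frame G z i)) = metric_trace (normal_form G z) (?Q z)"
      using normal_trace[OF normal_frame_at_normal_frame Q[OF z]] by simp
  qed
  have 3: "dirder (\<lambda>z. Q z (0, snd (e i)) (0, snd (e j))) z h = dirder (\<lambda>z. Q z (e i) (e j)) z h" for i j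
    by (rule dirder_cong[OF open_U z]) (rule Q_snd, auto)
  have 4: "dirder (\<lambda>z. truncated G z (0, snd (e i)) (0, snd (e j))) z h = dirder (\<lambda>z. truncated G z (e i) (e j)) z h" for i j
    by (rule dirder_cong[OF open_U z]) (rule pos_form.truncated_snd[OF pos_form_U], auto)
  have 5: "Q z (0, snd (e i)) (0, snd (e j)) = Q z (e i) (e j)" for i j
    by (rule Q_snd[OF z]) auto
  show ?thesis unfolding 2 1 c(2) 3 4 5 ..
qed

end

subsection \<open>Regularity of the extrinsic invariants\<close>

text \<open>The tensor \<open>h\<close>, and the bracket whose half is \<open>T\<close>, as bilinear maps of arbitrary vectors: in this
  form sums over frames are traces.\<close>

definition sff :: "('p::finite, 'n::finite) form_field \<Rightarrow> ('p, 'n) pt \<Rightarrow> ('p, 'n) pt \<Rightarrow> ('p, 'n) pt \<Rightarrow> ('p, 'n) pt" where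
  "sff G z u v = (1/2) *\<^sub>R proj_leaf G z (cov G z (proj_normal G z u) (\<lambda>z. proj_normal G z v) +
     cov G z (proj_normal G z v) (\<lambda>z. proj_normal G z u))"

definition bracket :: "('p::finite, 'n::finite) form_field \<Rightarrow> ('p, 'n) pt \<Rightarrow> ('p, 'n) pt \<Rightarrow> ('p, 'n) pt \<Rightarrow> ('p, 'n) pt" where
  "bracket G z u v = lie_bracket (\<lambda>z. proj_normal G z u) (\<lambda>z. proj_normal G z v) z"

lemma normal_sff_sections: "normal_sff G (normal_section G z i) (normal_section G z j) z = sff G z (normal_frame G z i) (normal_frame G z j)"
  by (simp add: normal_sff_def sff_def normal_section_def nabla_cov)

lemma integrability_sections:
  "integrability G (normal_section G z i) (normal_section G z j) z =
    (1/2) *\<^sub>R proj_leaf G z (bracket G z (normal_frame G z i) (normal_frame G z j))"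
  by (simp add: integrability_def bracket_def normal_section_def)

lemma leaf_sff_sections:
  "leaf_sff G (leaf_section G z a) (leaf_section G z b) z =
     proj_normal G z (christoffel G z (leaf_frame G z a) (leaf_frame G z b))"
  by (simp add: leaf_sff_def leaf_section_def nabla_cov cov_def)

lemma mean_curv_sff: "mean_curv G z = (\<Sum>i\<in>UNIV. sff G z (normal_frame G z i) (normal_frame G z i))"
  by (simp add: mean_curv_def normal_sff_sections)

lemma div_leaf_cov: "div_leaf G X z = (\<Sum>a\<in>UNIV. G z (cov G z (leaf_frame G z a) X) (leaf_frame G z a))"
  by (simp add: div_leaf_def nabla_cov leaf_section_def)

lemma (in pos_form) G_normal_right: "G z (proj_normal G z v) (proj_normal G z w) = G z (proj_normal G z v) w"
  using bilinear_radd[OF bil, of "proj_normal G z v" "proj_leaf G z w" "proj_normal G z w"]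
  by (simp add: decompose orth)

text \<open>Frames chosen arbitrarily at each point need not be continuous, but sums over them of regular
  bilinear forms are regular.  Both \<^const>\<open>leaf_frame\<close> and \<^const>\<open>normal_frame\<close> have this property.\<close>

definition regular_trace :: "('p::finite, 'n::finite) pt set \<Rightarrow> (('p, 'n) pt \<Rightarrow> 'k::finite \<Rightarrow> ('p, 'n) pt) \<Rightarrow> bool" where
  "regular_trace U f \<longleftrightarrow> (\<forall>Q. (\<forall>z\<in>U. bilinear (Q z)) \<longrightarrow> (\<forall>u v. Ck_on (Suc 0) U (\<lambda>z. Q z u v :: real)) \<longrightarrow>
      Ck_on (Suc 0) U (\<lambda>z. \<Sum>i\<in>UNIV. Q z (f z i) (f z i)))"

text \<open>A squared tensor norm is a trace in each of its two arguments.\<close>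

lemma regular_trace_norm2:
  fixes W :: "('p::finite, 'n::finite) pt \<Rightarrow> ('p, 'n) pt \<Rightarrow> ('p, 'n) pt \<Rightarrow> ('p, 'n) pt"
  assumes ud: "unique_derivs U" and f: "regular_trace U f"
    and B: "\<And>z. z \<in> U \<Longrightarrow> bilinear (B z)" "\<And>u v. Ck_on (Suc 0) U (\<lambda>z. B z u v :: real)"
    and W: "\<And>z. z \<in> U \<Longrightarrow> bilinear (W z)" "\<And>u v. Ck_on (Suc 0) U (\<lambda>z. W z u v)"
  shows "Ck_on (Suc 0) U (\<lambda>z. \<Sum>i\<in>UNIV. \<Sum>j\<in>UNIV. B z (W z (f z i) (f z j)) (W z (f z i) (f z j)))"
proof -
  have lin: "linear (\<lambda>u. W z u v)" "linear (W z v)" if "z \<in> U" for z v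
    using W(1)[OF that] unfolding bilinear_def by blast+
  have "Ck_on (Suc 0) U (\<lambda>z. \<Sum>j\<in>UNIV. B z (W z u (f z j)) (W z u' (f z j)))" for u u'
  proof -
    let ?Q = "\<lambda>z v v'. B z (W z u v) (W z u' v')"
    have "bilinear (?Q z)" if "z \<in> U" for z
      by (rule bilinear_compose[OF B(1)[OF that] lin(2)[OF that] lin(2)[OF that]])
    moreover have "Ck_on (Suc 0) U (\<lambda>z. ?Q z v v')" for v v'
      by (rule Ck_on_bilinear_field[OF ud B W(2) W(2)])
    ultimately show ?thesis using f[unfolded regular_trace_def, rule_format, of ?Q] by simp
  qed
  moreover have "bilinear (\<lambda>u u'. \<Sum>j\<in>UNIV. B z (W z u (f z j)) (W z u' (f z j)))" if "z \<in> U" for z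
  proof -
    have "bilinear (\<lambda>u u'. B z (W z u (f z j)) (W z u' (f z j)))" for j
      by (rule bilinear_compose[OF B(1)[OF that] lin(1)[OF that] lin(1)[OF that]])
    then show ?thesis
      unfolding bilinear_def by (intro conjI allI linear_compose_sum ballI) (simp_all del: split_paired_All)
  qed
  ultimately show ?thesis
    using f[unfolded regular_trace_def, rule_format, of "\<lambda>z u u'. \<Sum>j\<in>UNIV. B z (W z u (f z j)) (W z u' (f z j))"]
    by simp
qed

context chart_metric
begin

lemma regular_trace_leaf_frame: "regular_trace U (leaf_frame G)"
  unfolding regular_trace_def
proof (intro allI impI)
  fix Q :: "('p, 'n) pt \<Rightarrow> ('p, 'n) pt \<Rightarrow> ('p, 'n) pt \<Rightarrow> real"
  assume Q: "\<forall>z\<in>U. bilinear (Q z)" "\<forall>u v. Ck_on (Suc 0) U (\<lambda>z. Q z u v)"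
  have "Ck_on (Suc 0) U (\<lambda>z. metric_trace (leaf_form G z) (\<lambda>x y. Q z (x, 0) (y, 0)))"
    by (rule Ck_on_metric_trace[OF ud pos_form.posdef_leaf_form[OF pos_form_U]])
      (use Q Ck_on_Suc_imp[OF C2'] in \<open>simp_all add: leaf_form_def del: Ck_on.simps\<close>)
  moreover have "(\<Sum>i\<in>UNIV. Q z (leaf_frame G z i) (leaf_frame G z i)) =
      metric_trace (leaf_form G z) (\<lambda>x y. Q z (x, 0) (y, 0))" if "z \<in> U" for z
    using Q that by (intro pos_form.leaf_trace pos_form.leaf_frame_at_leaf_frame pos_form_U) auto
  ultimately show "Ck_on (Suc 0) U (\<lambda>z. \<Sum>i\<in>UNIV. Q z (leaf_frame G z i) (leaf_frame G z i))"
    by (subst Ck_on_cong) auto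
qed

lemma regular_trace_normal_frame: "regular_trace U (normal_frame G)"
  unfolding regular_trace_def
proof (intro allI impI)
  fix Q :: "('p, 'n) pt \<Rightarrow> ('p, 'n) pt \<Rightarrow> ('p, 'n) pt \<Rightarrow> real"
  assume Q: "\<forall>z\<in>U. bilinear (Q z)" "\<forall>u v. Ck_on (Suc 0) U (\<lambda>z. Q z u v)"
  let ?T = "\<lambda>z. metric_trace (normal_form G z) (\<lambda>x y. Q z (proj_normal G z (0, x)) (proj_normal G z (0, y)))"
  have "Ck_on (Suc 0) U ?T"
  proof (rule Ck_on_metric_trace[OF ud pos_form.posdef_normal_form[OF pos_form_U]])
    show "Ck_on (Suc 0) U (\<lambda>z. normal_form G z (axis i 1) (axis j 1))" for i j
      unfolding normal_form_def by (rule Ck_on_Suc_imp[OF C2_truncated])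
    show "Ck_on (Suc 0) U (\<lambda>z. Q z (proj_normal G z (0, axis i 1)) (proj_normal G z (0, axis j 1)))" for i j
      by (rule Ck_on_bilinear_field[OF ud _ _ Ck_on_Suc_imp[OF C2_proj_normal] Ck_on_Suc_imp[OF C2_proj_normal]])
        (use Q in blast)+
  qed
  moreover have "(\<Sum>i\<in>UNIV. Q z (normal_frame G z i) (normal_frame G z i)) = ?T z" if "z \<in> U" for z
    using Q that by (intro pos_form.normal_trace pos_form.normal_frame_at_normal_frame pos_form_U) auto
  ultimately show "Ck_on (Suc 0) U (\<lambda>z. \<Sum>i\<in>UNIV. Q z (normal_frame G z i) (normal_frame G z i))"
    by (subst Ck_on_cong) auto
qed

lemma C1_cov:
  assumes "Ck_on (Suc 0) U X" "Ck_on (Suc (Suc 0)) U Y"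
  shows "Ck_on (Suc 0) U (\<lambda>z. cov G z (X z) Y)"
  unfolding cov_def
proof (rule Ck_on_add[OF ud])
  show "Ck_on (Suc 0) U (\<lambda>z. dirder Y z (X z))"
    by (rule Ck_on_linear_field[OF ud _ Ck_on_dirder[OF open_U assms(2)] assms(1)])
      (rule linear_dirder[OF diff_C2[OF assms(2)]])
  show "Ck_on (Suc 0) U (\<lambda>z. christoffel G z (X z) (Y z))"
    by (rule Ck_on_bilinear_field[OF ud bilinear_christoffel C1_christoffel assms(1) Ck_on_Suc_imp[OF assms(2)]])
qed

lemma C1_N: "Ck_on (Suc 0) U (\<lambda>z. proj_normal G z v)"
  by (rule Ck_on_Suc_imp[OF C2_proj_normal])

lemma C1_proj_leaf: "Ck_on (Suc 0) U X \<Longrightarrow> Ck_on (Suc 0) U (\<lambda>z. proj_leaf G z (X z))"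
  by (rule Ck_on_linear_field[OF ud pos_form.linear_proj_leaf[OF pos_form_U]
        Ck_on_Suc_imp[OF Ck_on_proj_leaf[OF ud posdef_U C2']]])

lemma linear_N: "z \<in> U \<Longrightarrow> linear (proj_normal G z)"
  by (rule pos_form.linear_proj_normal[OF pos_form_U])

lemma linear_cov_N: "z \<in> U \<Longrightarrow> linear (\<lambda>v. cov G z \<eta> (\<lambda>z. proj_normal G z v))"
  unfolding cov_def
  by (intro linear_compose_add linear_dirder_field[OF open_U _ linear_N differentiable_N])
    (use linear_compose[OF linear_N, of z "christoffel G z \<eta>"] bilinear_christoffel[unfolded bilinear_def]
      in \<open>simp_all add: o_def del: split_paired_All\<close>)

lemma bilinear_cov_N:
  assumes z: "z \<in> U"
  shows "bilinear (\<lambda>u v. cov G z (proj_normal G z u) (\<lambda>z. proj_normal G z v))"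
  unfolding bilinear_def
  using linear_cov_N[OF z] linear_compose[OF linear_N[OF z] linear_cov[OF z differentiable_N[OF z]]]
  by (auto simp: o_def)

lemma bilinear_sff:
  assumes z: "z \<in> U"
  shows "bilinear (sff G z)"
proof -
  note b = bilinear_cov_N[OF z]
  note l = pos_form.linear_proj_leaf[OF pos_form_U[OF z]]
  show ?thesis
    unfolding bilinear_def sff_def linear_iff
    by (simp add: bilinear_rules[OF b]
        linear_add[OF l] linear_cmul[OF l] algebra_simps)
qed

lemma bracket_eq: "z \<in> U \<Longrightarrow> bracket G z u v =
    cov G z (proj_normal G z u) (\<lambda>z. proj_normal G z v) - cov G z (proj_normal G z v) (\<lambda>z. proj_normal G z u)"
  using christoffel_sym[of z "proj_normal G z u"] by (simp add: bracket_def lie_bracket_def cov_def)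

lemma bilinear_bracket:
  assumes z: "z \<in> U"
  shows "bilinear (bracket G z)"
proof -
  note b = bilinear_cov_N[OF z]
  show ?thesis
    unfolding bilinear_def bracket_eq[OF z] linear_iff
    by (simp add: bilinear_rules[OF b]
        algebra_simps)
qed

lemma C1_sff: "Ck_on (Suc 0) U (\<lambda>z. sff G z u v)"
  unfolding sff_def
  by (intro Ck_on_scaleR Ck_on_const ud C1_proj_leaf Ck_on_add C1_cov C1_N C2_proj_normal)

lemma C1_bracket: "Ck_on (Suc 0) U (\<lambda>z. bracket G z u v)"
proof -
  have "Ck_on (Suc 0) U (\<lambda>z. cov G z (proj_normal G z u) (\<lambda>z. proj_normal G z v) - cov G z (proj_normal G z v) (\<lambda>z. proj_normal G z u))"
    by (intro ud Ck_on_diff C1_cov C1_N C2_proj_normal)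
  then show ?thesis using bracket_eq by (subst Ck_on_cong) auto
qed

lemma C1_mean_curv: "Ck_on (Suc 0) U (mean_curv G)"
proof (rule Ck_on_componentwise[OF ud])
  fix l :: "('p, 'n) pt"
  have "bilinear (\<lambda>u v. sff G z u v \<bullet> l)" if "z \<in> U" for z
    using bilinear_sff[OF that] by (auto simp: bilinear_def linear_iff algebra_simps)
  moreover have "Ck_on (Suc 0) U (\<lambda>z. sff G z u v \<bullet> l)" for u v
    by (rule Ck_on_inner[OF ud C1_sff])
  ultimately have "Ck_on (Suc 0) U (\<lambda>z. \<Sum>i\<in>UNIV. sff G z (normal_frame G z i) (normal_frame G z i) \<bullet> l)"
    using regular_trace_normal_frame[unfolded regular_trace_def, rule_format, of "\<lambda>z u v. sff G z u v \<bullet> l"] by simp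
  then show "Ck_on (Suc 0) U (\<lambda>z. mean_curv G z \<bullet> l)"
    by (simp add: mean_curv_sff inner_sum_left)
qed

lemma C1_normal_sff_norm2: "Ck_on (Suc 0) U (normal_sff_norm2 G)"
  unfolding normal_sff_norm2_def[abs_def] normal_sff_sections sqnorm_def
  by (rule regular_trace_norm2[OF ud regular_trace_normal_frame bil_U Ck_on_Suc_imp[OF C2'] bilinear_sff C1_sff])

lemma C1_integrability_norm2: "Ck_on (Suc 0) U (integrability_norm2 G)"
  unfolding integrability_norm2_def[abs_def] integrability_sections sqnorm_def
proof (rule regular_trace_norm2[OF ud regular_trace_normal_frame bil_U Ck_on_Suc_imp[OF C2'],
      where W = "\<lambda>z u v. (1/2) *\<^sub>R proj_leaf G z (bracket G z u v)"])
  show "bilinear (\<lambda>u v. (1/2) *\<^sub>R proj_leaf G z (bracket G z u v))" if z: "z \<in> U" for z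
    unfolding bilinear_def linear_iff
    by (simp add: bilinear_rules[OF bilinear_bracket[OF z]]
        linear_add[OF pos_form.linear_proj_leaf[OF pos_form_U[OF z]]]
        linear_cmul[OF pos_form.linear_proj_leaf[OF pos_form_U[OF z]]] algebra_simps)
  show "Ck_on (Suc 0) U (\<lambda>z. (1/2) *\<^sub>R proj_leaf G z (bracket G z u v))" for u v
    by (intro Ck_on_scaleR Ck_on_const ud C1_proj_leaf C1_bracket)
qed

lemma C1_leaf_sff_norm2: "Ck_on (Suc 0) U (leaf_sff_norm2 G)"
  unfolding leaf_sff_norm2_def[abs_def] leaf_sff_sections sqnorm_def
proof (rule regular_trace_norm2[OF ud regular_trace_leaf_frame bil_U Ck_on_Suc_imp[OF C2'],
      where W = "\<lambda>z u v. proj_normal G z (christoffel G z u v)"])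
  show "bilinear (\<lambda>u v. proj_normal G z (christoffel G z u v))" if z: "z \<in> U" for z
    unfolding bilinear_def linear_iff
    by (simp add: bilinear_rules[OF bilinear_christoffel[OF z]]
        linear_add[OF linear_N[OF z]] linear_cmul[OF linear_N[OF z]])
  show "Ck_on (Suc 0) U (\<lambda>z. proj_normal G z (christoffel G z u v))" for u v
    by (rule Ck_on_linear_field[OF ud linear_N C1_N C1_christoffel])
qed

lemma C1_mean_curv_norm2: "Ck_on (Suc 0) U (\<lambda>z. sqnorm G z (mean_curv G z))"
  unfolding sqnorm_def by (rule Ck_on_pairing[OF C1_mean_curv C1_mean_curv]) simp

lemma C1_beta_D: "Ck_on (Suc 0) U (beta_D G)"
  unfolding beta_D_def[abs_def] divide_inverse
  by (intro Ck_on_mult Ck_on_diff Ck_on_const ud C1_normal_sff_norm2 C1_mean_curv_norm2)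

end

section \<open>The mixed scalar curvature of a harmonic foliation\<close>

context chart_metric
begin

lemma sff_pairing:
  assumes z: "z \<in> U" and \<xi>: "snd \<xi> = 0"
  shows "G z (sff G z u v) \<xi> = - (1/2) * dirder (\<lambda>z. truncated G z u v) z \<xi>"
proof -
  interpret pos_form G z by (rule pos_form_U[OF z])
  show ?thesis
    unfolding sff_def by (simp add: bilinear_lmul[OF bil] G_leaf_right[OF \<xi>] second_fundamental_form[OF z \<xi>])
qed

lemma snd_sff: "z \<in> U \<Longrightarrow> snd (sff G z u v) = 0"
  by (simp add: sff_def pos_form.snd_proj_leaf[OF pos_form_U])

lemma snd_mean_curv: "z \<in> U \<Longrightarrow> snd (mean_curv G z) = 0"
  by (simp add: mean_curv_sff snd_sum snd_sff)

lemma bilinear_dtruncated: "z \<in> U \<Longrightarrow> bilinear (\<lambda>u v. dirder (\<lambda>z. truncated G z u v) z h)"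
  by (rule bilinear_dirder_field[OF open_U _ pos_form.bilinear_truncated[OF pos_form_U] diff_C2[OF C2_truncated]])

lemma mean_curv_pairing:
  assumes z: "z \<in> U" and \<xi>: "snd \<xi> = 0" and e: "normal_frame_at G z e"
  shows "G z (mean_curv G z) \<xi> = - (1/2) * (\<Sum>i\<in>UNIV. dirder (\<lambda>z. truncated G z (e i) (e i)) z \<xi>)"
proof -
  interpret pos_form G z by (rule pos_form_U[OF z])
  have "G z (mean_curv G z) \<xi> = - (1/2) * (\<Sum>i\<in>UNIV. dirder (\<lambda>z'. truncated G z' (normal_frame G z i) (normal_frame G z i)) z \<xi>)"
    unfolding mean_curv_sff
    by (simp add: bilinear_sum_left[OF bil] sff_pairing[OF z \<xi>] sum_distrib_left sum_negf[symmetric] sum_divide_distrib)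
  then show ?thesis
    using normal_trace[OF e bilinear_dtruncated[OF z]]
      normal_trace[OF normal_frame_at_normal_frame bilinear_dtruncated[OF z]] by simp
qed

lemma normal_sff_norm2_frame:
  assumes z: "z \<in> U"
  shows "normal_sff_norm2 G z = (\<Sum>i\<in>UNIV. \<Sum>j\<in>UNIV. \<Sum>a\<in>UNIV.
     (dirder (\<lambda>z'. truncated G z' (normal_frame G z i) (normal_frame G z j)) z (leaf_frame G z a))\<^sup>2) / 4"
proof -
  interpret pos_form G z by (rule pos_form_U[OF z])
  have "sqnorm G z (sff G z u v) = (\<Sum>a\<in>UNIV. (dirder (\<lambda>z. truncated G z u v) z (leaf_frame G z a))\<^sup>2) / 4" for u v
  proof -
    have "sff G z u v = proj_leaf G z (sff G z u v)" by (rule proj_leaf_leaf[OF snd_sff[OF z], symmetric])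
    then have "sqnorm G z (sff G z u v) = (\<Sum>a\<in>UNIV. (G z (sff G z u v) (leaf_frame G z a))\<^sup>2)"
      using sqnorm_proj_leaf[OF leaf_frame_at_leaf_frame, of "sff G z u v"] by simp
    also have "\<dots> = (\<Sum>a\<in>UNIV. (dirder (\<lambda>z. truncated G z u v) z (leaf_frame G z a))\<^sup>2 / 4)"
      using leaf_frame_at_leaf_frame
      by (intro sum.cong refl) (simp add: sff_pairing[OF z] leaf_frame_at_def power_divide)
    finally show ?thesis by (simp add: sum_divide_distrib)
  qed
  then show ?thesis by (simp add: normal_sff_norm2_def normal_sff_sections sum_divide_distrib)
qed

text \<open>\<open>h\<close> and \<open>T\<close> are the symmetric and the antisymmetric part of the leaf component of \<open>\<nabla>\<^sub>X Y\<close>, so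
  their squared norms add up to the squared norm of this component.\<close>

lemma sff_plus_integrability:
  assumes z: "z \<in> U"
  shows "normal_sff_norm2 G z + integrability_norm2 G z =
    (\<Sum>i\<in>UNIV. \<Sum>j\<in>UNIV. \<Sum>a\<in>UNIV.
       (G z (christoffel G z (normal_frame G z i) (leaf_frame G z a)) (normal_frame G z j))\<^sup>2)"
proof -
  interpret pos_form G z by (rule pos_form_U[OF z])
  let ?e = "normal_frame G z" and ?\<epsilon> = "leaf_frame G z"
  have lf: "snd (?\<epsilon> a) = 0" for a using leaf_frame_at_leaf_frame by (simp add: leaf_frame_at_def)
  have nf: "?e i \<in> normal_dirs G z" for i using normal_frame_at_normal_frame by (simp add: normal_frame_at_def)
  define C where "C i j = cov G z (proj_normal G z (?e i)) (\<lambda>z. proj_normal G z (?e j))" for i j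
  define c where "c i j a = G z (C i j) (?\<epsilon> a)" for i j a
  have c: "c i j a = - G z (christoffel G z (?e i) (?\<epsilon> a)) (?e j)" for i j a
    unfolding c_def C_def cov_N_leaf[OF z lf]
    by (simp add: proj_normal_normal[OF nf] sym[of "?e j"])
  have h: "sqnorm G z (sff G z (?e i) (?e j)) = (\<Sum>a\<in>UNIV. ((c i j a + c j i a) / 2)\<^sup>2)" for i j
  proof -
    have "sff G z (?e i) (?e j) = proj_leaf G z ((1/2) *\<^sub>R (C i j + C j i))"
      unfolding sff_def C_def by (rule linear_cmul[OF linear_proj_leaf, symmetric])
    then show ?thesis
      unfolding sqnorm_proj_leaf[OF leaf_frame_at_leaf_frame]
      using sqnorm_proj_leaf[OF leaf_frame_at_leaf_frame]
      by (simp add: c_def bilinear_lmul[OF bil] bilinear_ladd[OF bil])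
  qed
  have t: "sqnorm G z ((1/2) *\<^sub>R proj_leaf G z (bracket G z (?e i) (?e j))) = (\<Sum>a\<in>UNIV. ((c i j a - c j i a) / 2)\<^sup>2)" for i j
  proof -
    have "(1/2) *\<^sub>R proj_leaf G z (bracket G z (?e i) (?e j)) = proj_leaf G z ((1/2) *\<^sub>R (C i j - C j i))"
      unfolding bracket_eq[OF z] C_def by (rule linear_cmul[OF linear_proj_leaf, symmetric])
    then show ?thesis
      using sqnorm_proj_leaf[OF leaf_frame_at_leaf_frame]
      by (simp add: c_def bilinear_lmul[OF bil] bilinear_lsub[OF bil])
  qed
  have "normal_sff_norm2 G z + integrability_norm2 G z =
     (\<Sum>i\<in>UNIV. \<Sum>j\<in>UNIV. \<Sum>a\<in>UNIV. ((c i j a)\<^sup>2 + (c j i a)\<^sup>2) / 2)"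
    unfolding normal_sff_norm2_def integrability_norm2_def normal_sff_sections integrability_sections h t
      sum.distrib[symmetric]
    by (intro sum.cong refl) (simp add: power2_eq_square field_simps)
  also have "\<dots> = ((\<Sum>i\<in>UNIV. \<Sum>j\<in>UNIV. \<Sum>a\<in>UNIV. (c i j a)\<^sup>2) + (\<Sum>i\<in>UNIV. \<Sum>j\<in>UNIV. \<Sum>a\<in>UNIV. (c j i a)\<^sup>2)) / 2"
    by (simp add: sum.distrib sum_divide_distrib add_divide_distrib)
  also have "(\<Sum>i\<in>UNIV. \<Sum>j\<in>UNIV. \<Sum>a\<in>UNIV. (c j i a)\<^sup>2) = (\<Sum>i\<in>UNIV. \<Sum>j\<in>UNIV. \<Sum>a\<in>UNIV. (c i j a)\<^sup>2)"
    by (rule sum.swap)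
  finally show ?thesis by (simp add: c)
qed

lemma leaf_sff_norm2_frame:
  assumes z: "z \<in> U" and e: "normal_frame_at G z e"
  shows "leaf_sff_norm2 G z = (\<Sum>a\<in>UNIV. \<Sum>b\<in>UNIV. \<Sum>i\<in>UNIV.
     (G z (e i) (christoffel G z (leaf_frame G z a) (leaf_frame G z b)))\<^sup>2)"
proof -
  interpret pos_form G z by (rule pos_form_U[OF z])
  show ?thesis
    by (simp add: leaf_sff_norm2_def leaf_sff_sections sqnorm_proj_normal[OF e] sym[of "e _"])
qed

lemma leaf_mean_curv_eq:
  assumes z: "z \<in> U"
  shows "leaf_mean_curv G z = proj_normal G z (\<Sum>a\<in>UNIV. christoffel G z (leaf_frame G z a) (leaf_frame G z a))"
  by (simp add: leaf_mean_curv_def leaf_sff_sections linear_sum[OF linear_N[OF z]])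

text \<open>Summation over the leaf frame.  With \<open>\<kappa>(\<xi>, \<eta>) = G(E, \<nabla>\<^sub>\<xi> \<eta>)\<close>, the term of \<open>riem_mixed\<close> that differentiates
  \<open>\<kappa>\<close> transversely seems to involve derivatives of the second
  fundamental form of the leaves.  Harmonicity removes them: the trace of
  \<open>\<kappa>\<close> vanishes identically, so the trace of its derivative only comes from the variation of the leaf
  metric, which is itself expressed by \<open>\<kappa>\<close> and the derivative \<open>d\<close> of \<open>E\<close>.  The terms with \<open>d\<close>
  cancel.\<close>

lemma sum_riem_mixed:
  assumes harm: "\<And>z. z \<in> U \<Longrightarrow> leaf_mean_curv G z = 0"
    and z: "z \<in> U" and e: "e \<in> normal_dirs G z"
  defines "\<epsilon> \<equiv> leaf_frame G z"
  shows "(\<Sum>a\<in>UNIV. riem G z (\<epsilon> a) e (\<epsilon> a) e) =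
     - (1/2) * (\<Sum>a\<in>UNIV. dirder (\<lambda>z'. dirder (\<lambda>z. truncated G z e e) z' (\<epsilon> a)) z (\<epsilon> a))
     - G z (cov G z e (\<lambda>z. proj_normal G z e)) (\<Sum>a\<in>UNIV. christoffel G z (\<epsilon> a) (\<epsilon> a))
     - (\<Sum>a\<in>UNIV. \<Sum>b\<in>UNIV. (G z e (christoffel G z (\<epsilon> a) (\<epsilon> b)))\<^sup>2)
     + (\<Sum>a\<in>UNIV. \<Sum>j\<in>UNIV. (G z (christoffel G z e (\<epsilon> a)) (normal_frame G z j))\<^sup>2)"
proof -
  interpret pos_form G z by (rule pos_form_U[OF z])
  let ?E = "\<lambda>z. proj_normal G z e" and ?\<Gamma> = "christoffel G z"
  have Ez: "?E z = e" by (rule proj_normal_normal[OF e])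
  have \<epsilon>: "leaf_frame_at G z \<epsilon>" unfolding \<epsilon>_def by (rule leaf_frame_at_leaf_frame)
  have lf: "snd (\<epsilon> a) = 0" for a using \<epsilon> by (simp add: leaf_frame_at_def)
  \<comment> \<open>The second fundamental form of the leaves in direction \<open>e\<close>, and the leaf components of \<open>[\<epsilon> a, E]\<close>.\<close>
  define \<kappa> where "\<kappa> a b = G z e (?\<Gamma> (\<epsilon> a) (\<epsilon> b))" for a b
  define d where "d a b = G z (dirder ?E z (\<epsilon> a)) (\<epsilon> b)" for a b
  define D where "D a = dirder (\<lambda>z. G z (?E z) (christoffel G z (\<epsilon> a) (\<epsilon> a))) z e" for a
  have \<kappa>_sym: "\<kappa> a b = \<kappa> b a" for a b
    by (simp add: \<kappa>_def christoffel_sym[OF z, of "\<epsilon> a"])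
  have covE: "G z (dirder ?E z (\<epsilon> a) + ?\<Gamma> (\<epsilon> a) e) (\<epsilon> b) = - \<kappa> a b" for a b
    using cov_N_leaf[OF z lf, of "\<epsilon> a" e b] by (simp add: cov_def Ez \<kappa>_def)
  have \<Gamma>e: "G z (?\<Gamma> e (\<epsilon> a)) (\<epsilon> b) = - \<kappa> a b - d a b" for a b
    using covE[of a b] by (simp add: bilinear_ladd[OF bil] d_def christoffel_sym[OF z, of e])
  have "(\<Sum>a\<in>UNIV. D a) = (\<Sum>a\<in>UNIV. \<Sum>b\<in>UNIV. dirder (\<lambda>z. G z (\<epsilon> a) (\<epsilon> b)) z e * \<kappa> a b)"
  proof -
    let ?Q = "\<lambda>z \<xi> \<eta>. G z (?E z) (christoffel G z \<xi> \<eta>)"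
    have "dirder (\<lambda>z. \<Sum>a\<in>UNIV. ?Q z (leaf_frame G z a) (leaf_frame G z a)) z e = dirder (\<lambda>z. 0) z e"
    proof (rule dirder_cong[OF open_U z])
      fix z assume z: "z \<in> U"
      have "(\<Sum>a\<in>UNIV. ?Q z (leaf_frame G z a) (leaf_frame G z a)) =
          G z (?E z) (\<Sum>a\<in>UNIV. christoffel G z (leaf_frame G z a) (leaf_frame G z a))"
        by (simp add: bilinear_sum_right[OF bil_U[OF z]])
      also have "\<dots> = G z (?E z) (leaf_mean_curv G z)"
        by (simp add: leaf_mean_curv_eq[OF z] pos_form.G_normal_right[OF pos_form_U[OF z]])
      finally show "(\<Sum>a\<in>UNIV. ?Q z (leaf_frame G z a) (leaf_frame G z a)) = 0"
        by (simp add: harm[OF z] bilinear_rzero[OF bil_U[OF z]])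
    qed
    moreover have "bilinear (?Q z)" if z: "z \<in> U" for z
      unfolding bilinear_def linear_iff
      by (simp add: bilinear_rules[OF bilinear_christoffel[OF z]]
          bilinear_radd[OF bil_U[OF z]] bilinear_rmul[OF bil_U[OF z]])
    moreover have "(\<lambda>z. ?Q z v w) differentiable (at z)" for v w
      by (rule differentiable_pairing[OF z differentiable_N[OF z] diff_christoffel[OF z]])
    ultimately show ?thesis
      using leaf_trace_dirder[OF z \<epsilon>, of ?Q e] by (simp add: D_def \<kappa>_def Ez)
  qed
  also have "\<dots> = (\<Sum>a\<in>UNIV. \<Sum>b\<in>UNIV. (- 2 * \<kappa> a b - d a b - d b a) * \<kappa> a b)"
  proof (intro sum.cong refl)
    fix a b
    show "dirder (\<lambda>z. G z (\<epsilon> a) (\<epsilon> b)) z e * \<kappa> a b = (- 2 * \<kappa> a b - d a b - d b a) * \<kappa> a b"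
      by (simp add: christoffel_compat[OF z] sym[of "\<epsilon> a" "?\<Gamma> e (\<epsilon> b)"] \<Gamma>e \<kappa>_sym[of b a])
  qed
  also have "\<dots> = (\<Sum>a\<in>UNIV. \<Sum>b\<in>UNIV. - 2 * (\<kappa> a b)\<^sup>2 - 2 * d a b * \<kappa> a b)"
  proof -
    have "(\<Sum>a\<in>UNIV. \<Sum>b\<in>UNIV. d b a * \<kappa> a b) = (\<Sum>a\<in>UNIV. \<Sum>b\<in>UNIV. d a b * \<kappa> a b)"
      by (subst sum.swap) (simp add: \<kappa>_sym)
    then show ?thesis
      by (simp add: algebra_simps sum.distrib sum_subtractf sum_negf sum_distrib_left[symmetric] power2_eq_square)
  qed
  finally have D: "(\<Sum>a\<in>UNIV. D a) = (\<Sum>a\<in>UNIV. \<Sum>b\<in>UNIV. - 2 * (\<kappa> a b)\<^sup>2 - 2 * d a b * \<kappa> a b)" .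
  have P: "G z (dirder ?E z (\<epsilon> a) + ?\<Gamma> (\<epsilon> a) e) (?\<Gamma> e (\<epsilon> a)) =
      (\<Sum>b\<in>UNIV. (\<kappa> a b)\<^sup>2 + d a b * \<kappa> a b) + (\<Sum>j\<in>UNIV. (G z (?\<Gamma> e (\<epsilon> a)) (normal_frame G z j))\<^sup>2)" for a
  proof -
    have nf: "normal_frame G z j \<in> normal_dirs G z" for j
      using normal_frame_at_normal_frame by (simp add: normal_frame_at_def)
    have "G z (dirder ?E z (\<epsilon> a) + ?\<Gamma> (\<epsilon> a) e) (normal_frame G z j) = G z (?\<Gamma> e (\<epsilon> a)) (normal_frame G z j)" for j
      by (simp add: bilinear_ladd[OF bil] normal_orth[OF nf] snd_dirder_N[OF z] christoffel_sym[OF z, of e])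
    then show ?thesis
      by (subst parseval[OF \<epsilon> normal_frame_at_normal_frame], unfold covE \<Gamma>e)
        (simp add: power2_eq_square algebra_simps)
  qed
  have L: "G z e (?\<Gamma> (dirder ?E z (\<epsilon> a)) (\<epsilon> a)) = (\<Sum>b\<in>UNIV. d a b * \<kappa> a b)" for a
  proof -
    note b = bilinear_christoffel[OF z]
    have "?\<Gamma> (dirder ?E z (\<epsilon> a)) (\<epsilon> a) = (\<Sum>b\<in>UNIV. d a b *\<^sub>R ?\<Gamma> (\<epsilon> b) (\<epsilon> a))"
      unfolding d_def
      by (subst (1) leaf_expansion[OF \<epsilon> snd_dirder_N[OF z], symmetric])
        (simp add: bilinear_sum_left[OF b] bilinear_lmul[OF b])
    then show ?thesis
      by (simp add: bilinear_sum_right[OF bil] bilinear_rmul[OF bil] \<kappa>_def christoffel_sym[OF z, of _ "\<epsilon> a"])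
  qed
  have R: "riem G z (\<epsilon> a) e (\<epsilon> a) e =
     - (1/2) * dirder (\<lambda>z'. dirder (\<lambda>z. truncated G z e e) z' (\<epsilon> a)) z (\<epsilon> a)
     - G z (cov G z e ?E) (?\<Gamma> (\<epsilon> a) (\<epsilon> a)) + D a
     + ((\<Sum>b\<in>UNIV. (\<kappa> a b)\<^sup>2 + d a b * \<kappa> a b) + (\<Sum>j\<in>UNIV. (G z (?\<Gamma> e (\<epsilon> a)) (normal_frame G z j))\<^sup>2))
     + (\<Sum>b\<in>UNIV. d a b * \<kappa> a b)" for a
    using riem_mixed[OF z lf e, of a] by (simp only: P L D_def)
  have "(\<Sum>a\<in>UNIV. riem G z (\<epsilon> a) e (\<epsilon> a) e) =
     - (1/2) * (\<Sum>a\<in>UNIV. dirder (\<lambda>z'. dirder (\<lambda>z. truncated G z e e) z' (\<epsilon> a)) z (\<epsilon> a))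
     - (\<Sum>a\<in>UNIV. G z (cov G z e ?E) (?\<Gamma> (\<epsilon> a) (\<epsilon> a))) + (\<Sum>a\<in>UNIV. D a)
     + (\<Sum>a\<in>UNIV. (\<Sum>b\<in>UNIV. (\<kappa> a b)\<^sup>2 + d a b * \<kappa> a b) + (\<Sum>j\<in>UNIV. (G z (?\<Gamma> e (\<epsilon> a)) (normal_frame G z j))\<^sup>2))
     + (\<Sum>a\<in>UNIV. \<Sum>b\<in>UNIV. d a b * \<kappa> a b)"
    unfolding R by (simp only: sum.distrib sum_subtractf sum_distrib_left)
  then show ?thesis
    unfolding D \<kappa>_def[symmetric]
    by (simp add: sum.distrib sum_subtractf sum_negf sum_distrib_left[symmetric] bilinear_sum_right[OF bil] mult.assoc)
qed

text \<open>The divergence differentiates the trace \<open>G(H, \<xi>) = -1/2 tr (\<partial>\<^sub>\<xi> g\<^sup>\<bottom>)\<close>; the variation of the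
  inverse metric contributes the term with the norm of \<open>h\<close>.\<close>

lemma div_leaf_mean_curv:
  assumes z: "z \<in> U"
  defines "\<epsilon> \<equiv> leaf_frame G z" and "e \<equiv> normal_frame G z"
  shows "div_leaf G (mean_curv G) z =
     - (1/2) * (\<Sum>i\<in>UNIV. \<Sum>a\<in>UNIV. dirder (\<lambda>z'. dirder (\<lambda>z. truncated G z (e i) (e i)) z' (\<epsilon> a)) z (\<epsilon> a))
     + 2 * normal_sff_norm2 G z
     - G z (mean_curv G z) (\<Sum>a\<in>UNIV. christoffel G z (\<epsilon> a) (\<epsilon> a))"
proof -
  interpret pos_form G z by (rule pos_form_U[OF z])
  have \<epsilon>: "leaf_frame_at G z \<epsilon>" unfolding \<epsilon>_def by (rule leaf_frame_at_leaf_frame)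
  have lf: "snd (\<epsilon> a) = 0" for a using \<epsilon> by (simp add: leaf_frame_at_def)
  have e: "normal_frame_at G z e" unfolding e_def by (rule normal_frame_at_normal_frame)
  have d: "mean_curv G differentiable (at z)" by (rule diff_C1[OF C1_mean_curv z])
  have 1: "dirder (\<lambda>z. G z (mean_curv G z) (\<epsilon> a)) z (\<epsilon> a) =
     - (1/2) * ((\<Sum>i\<in>UNIV. dirder (\<lambda>z'. dirder (\<lambda>z. truncated G z (e i) (e i)) z' (\<epsilon> a)) z (\<epsilon> a)) -
        (\<Sum>i\<in>UNIV. \<Sum>j\<in>UNIV. (dirder (\<lambda>z. truncated G z (e i) (e j)) z (\<epsilon> a))\<^sup>2))" for a
  proof -
    let ?Q = "\<lambda>z' u v. dirder (\<lambda>z. truncated G z u v) z' (\<epsilon> a)"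
    have dQ: "(\<lambda>z. ?Q z v w) differentiable (at z)" for v w
      by (rule diff_C1[OF Ck_on_dirder[OF open_U C2_truncated] z])
    have Qs: "?Q z u v = ?Q z u' v'" if "z \<in> U" "snd u = snd u'" "snd v = snd v'" for z u v u' v'
      by (rule dirder_cong[OF open_U that(1)]) (rule pos_form.truncated_snd[OF pos_form_U that(2,3)])
    let ?T = "\<lambda>z. \<Sum>i\<in>UNIV. ?Q z (normal_frame G z i) (normal_frame G z i)"
    have T: "dirder ?T z (\<epsilon> a) = (\<Sum>i\<in>UNIV. dirder (\<lambda>z. ?Q z (e i) (e i)) z (\<epsilon> a)) -
        (\<Sum>i\<in>UNIV. \<Sum>j\<in>UNIV. (dirder (\<lambda>z. truncated G z (e i) (e j)) z (\<epsilon> a))\<^sup>2)"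
      unfolding power2_eq_square
      by (rule normal_trace_dirder[where Q = ?Q and h = "\<epsilon> a", OF z e bilinear_dtruncated dQ Qs])
    have "?T differentiable (at z)"
      by (rule diff_C1[OF regular_trace_normal_frame[unfolded regular_trace_def, rule_format, of ?Q] z])
        (auto intro: bilinear_dtruncated Ck_on_dirder[OF open_U C2_truncated] simp del: Ck_on.simps)
    then have "dirder (\<lambda>z. - (1/2) * ?T z) z (\<epsilon> a) = - (1/2) * dirder ?T z (\<epsilon> a)"
      by (intro dirder_eqI[of _ "\<lambda>h. - (1/2) * dirder ?T z h"] has_derivative_mult_right has_derivative_dirder)
    moreover have "dirder (\<lambda>z. G z (mean_curv G z) (\<epsilon> a)) z (\<epsilon> a) = dirder (\<lambda>z. - (1/2) * ?T z) z (\<epsilon> a)"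
      by (rule dirder_cong[OF open_U z])
        (rule mean_curv_pairing[OF _ lf pos_form.normal_frame_at_normal_frame[OF pos_form_U]])
    ultimately show ?thesis by (simp only: T)
  qed
  have "div_leaf G (mean_curv G) z = (\<Sum>a\<in>UNIV. dirder (\<lambda>z. G z (mean_curv G z) (\<epsilon> a)) z (\<epsilon> a))
     - G z (mean_curv G z) (\<Sum>a\<in>UNIV. christoffel G z (\<epsilon> a) (\<epsilon> a))"
    unfolding div_leaf_cov \<epsilon>_def[symmetric] cov_const_pairing[OF z d]
    by (simp add: sum_subtractf bilinear_sum_right[OF bil])
  also have "(\<Sum>a\<in>UNIV. dirder (\<lambda>z. G z (mean_curv G z) (\<epsilon> a)) z (\<epsilon> a)) =
     - (1/2) * (\<Sum>a\<in>UNIV. \<Sum>i\<in>UNIV. dirder (\<lambda>z'. dirder (\<lambda>z. truncated G z (e i) (e i)) z' (\<epsilon> a)) z (\<epsilon> a))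
     + (1/2) * (\<Sum>a\<in>UNIV. \<Sum>i\<in>UNIV. \<Sum>j\<in>UNIV. (dirder (\<lambda>z. truncated G z (e i) (e j)) z (\<epsilon> a))\<^sup>2)"
    unfolding 1 by (simp only: sum_distrib_left[symmetric] sum_subtractf right_diff_distrib)
  also have "(\<Sum>a\<in>UNIV. \<Sum>i\<in>UNIV. \<Sum>j\<in>UNIV. (dirder (\<lambda>z. truncated G z (e i) (e j)) z (\<epsilon> a))\<^sup>2) = 4 * normal_sff_norm2 G z"
  proof -
    have "(\<Sum>a\<in>UNIV. \<Sum>i\<in>UNIV. \<Sum>j\<in>UNIV. (dirder (\<lambda>z. truncated G z (e i) (e j)) z (\<epsilon> a))\<^sup>2) =
        (\<Sum>i\<in>UNIV. \<Sum>j\<in>UNIV. \<Sum>a\<in>UNIV. (dirder (\<lambda>z. truncated G z (e i) (e j)) z (\<epsilon> a))\<^sup>2)"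
      by (subst sum.swap, rule sum.cong[OF refl], rule sum.swap)
    then show ?thesis using normal_sff_norm2_frame[OF z] by (simp add: e_def \<epsilon>_def)
  qed
  also have "(\<Sum>a\<in>UNIV. \<Sum>i\<in>UNIV. dirder (\<lambda>z'. dirder (\<lambda>z. truncated G z (e i) (e i)) z' (\<epsilon> a)) z (\<epsilon> a)) =
      (\<Sum>i\<in>UNIV. \<Sum>a\<in>UNIV. dirder (\<lambda>z'. dirder (\<lambda>z. truncated G z (e i) (e i)) z' (\<epsilon> a)) z (\<epsilon> a))"
    by (rule sum.swap)
  finally show ?thesis by simp
qed

text \<open>The second order terms of the mixed curvature are those of the divergence of \<open>H\<close>.  The two terms
  with the leafwise acceleration \<open>Z = \<Sum>\<nabla>\<^sub>\<epsilon> \<epsilon>\<close> cancel because \<open>Z\<close> is tangent to the leaf, again by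
  harmonicity.\<close>

theorem Sc_mix_harmonic:
  assumes harm: "\<And>z. z \<in> U \<Longrightarrow> leaf_mean_curv G z = 0" and z: "z \<in> U"
  shows "Sc_mix G z = div_leaf G (mean_curv G) z - normal_sff_norm2 G z + integrability_norm2 G z - leaf_sff_norm2 G z"
proof -
  interpret pos_form G z by (rule pos_form_U[OF z])
  let ?e = "normal_frame G z" and ?\<epsilon> = "leaf_frame G z"
  define Z where "Z = (\<Sum>a\<in>UNIV. christoffel G z (?\<epsilon> a) (?\<epsilon> a))"
  have e: "normal_frame_at G z ?e" by (rule normal_frame_at_normal_frame)
  have nf: "?e i \<in> normal_dirs G z" for i using e by (simp add: normal_frame_at_def)
  have "proj_normal G z Z = 0" using harm[OF z] leaf_mean_curv_eq[OF z] by (simp add: Z_def)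
  then have "snd Z = 0" using snd_proj_normal[of Z] by simp
  have "Sc_mix G z = (\<Sum>i\<in>UNIV. - (1/2) * (\<Sum>a\<in>UNIV. dirder (\<lambda>z'. dirder (\<lambda>z. truncated G z (?e i) (?e i)) z' (?\<epsilon> a)) z (?\<epsilon> a))
     - G z (cov G z (?e i) (\<lambda>z. proj_normal G z (?e i))) Z
     - (\<Sum>a\<in>UNIV. \<Sum>b\<in>UNIV. (G z (?e i) (christoffel G z (?\<epsilon> a) (?\<epsilon> b)))\<^sup>2)
     + (\<Sum>a\<in>UNIV. \<Sum>j\<in>UNIV. (G z (christoffel G z (?e i) (?\<epsilon> a)) (?e j))\<^sup>2))"
    unfolding Sc_mix_def Z_def by (intro sum.cong refl sum_riem_mixed harm z nf)
  also have "\<dots> = - (1/2) * (\<Sum>i\<in>UNIV. \<Sum>a\<in>UNIV. dirder (\<lambda>z'. dirder (\<lambda>z. truncated G z (?e i) (?e i)) z' (?\<epsilon> a)) z (?\<epsilon> a))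
     - (\<Sum>i\<in>UNIV. G z (cov G z (?e i) (\<lambda>z. proj_normal G z (?e i))) Z)
     - (\<Sum>i\<in>UNIV. \<Sum>a\<in>UNIV. \<Sum>b\<in>UNIV. (G z (?e i) (christoffel G z (?\<epsilon> a) (?\<epsilon> b)))\<^sup>2)
     + (\<Sum>i\<in>UNIV. \<Sum>a\<in>UNIV. \<Sum>j\<in>UNIV. (G z (christoffel G z (?e i) (?\<epsilon> a)) (?e j))\<^sup>2)"
    by (simp only: sum.distrib sum_subtractf sum_distrib_left)
  also have "(\<Sum>i\<in>UNIV. G z (cov G z (?e i) (\<lambda>z. proj_normal G z (?e i))) Z) = G z (mean_curv G z) Z"
    unfolding mean_curv_sff bilinear_sum_left[OF bil]
  proof (intro sum.cong refl)
    fix i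
    have "sff G z (?e i) (?e i) = proj_leaf G z (cov G z (?e i) (\<lambda>z. proj_normal G z (?e i)))"
      unfolding sff_def
      by (simp add: linear_cmul[OF linear_proj_leaf, symmetric] proj_normal_normal[OF nf] scaleR_add_right[symmetric]
          flip: scaleR_2)
    then show "G z (cov G z (?e i) (\<lambda>z. proj_normal G z (?e i))) Z = G z (sff G z (?e i) (?e i)) Z"
      by (simp add: G_leaf_right[OF \<open>snd Z = 0\<close>])
  qed
  also have "(\<Sum>i\<in>UNIV. \<Sum>a\<in>UNIV. \<Sum>b\<in>UNIV. (G z (?e i) (christoffel G z (?\<epsilon> a) (?\<epsilon> b)))\<^sup>2) = leaf_sff_norm2 G z"
    unfolding leaf_sff_norm2_frame[OF z e]
    by (subst sum.swap, rule sum.cong[OF refl], rule sum.swap)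
  also have "(\<Sum>i\<in>UNIV. \<Sum>a\<in>UNIV. \<Sum>j\<in>UNIV. (G z (christoffel G z (?e i) (?\<epsilon> a)) (?e j))\<^sup>2) =
      normal_sff_norm2 G z + integrability_norm2 G z"
    unfolding sff_plus_integrability[OF z] by (rule sum.cong[OF refl], rule sum.swap)
  finally show ?thesis
    unfolding div_leaf_mean_curv[OF z] Z_def[symmetric] by simp
qed

end

section \<open>Leafwise gradient, divergence and Laplacian\<close>

text \<open>Potentials and the speed of the flow are only known to be differentiable along the leaves.\<close>

definition leaf_differentiable :: "(('p::finite, 'n::finite) pt \<Rightarrow> 'c::real_normed_vector) \<Rightarrow> ('p, 'n) pt \<Rightarrow> bool" where
  "leaf_differentiable f z \<longleftrightarrow> (\<lambda>x. f (x, snd z)) differentiable (at (fst z))"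

lemma dirder_leaf: "snd \<xi> = 0 \<Longrightarrow> dirder f z \<xi> = dirder (\<lambda>x. f (x, snd z)) (fst z) (fst \<xi>)"
  unfolding dirder_def by (cases z, cases \<xi>) simp

lemma leaf_differentiable_has_derivative:
  "leaf_differentiable f z \<Longrightarrow>
     ((\<lambda>x. f (x, snd z)) has_derivative dirder (\<lambda>x. f (x, snd z)) (fst z)) (at (fst z))"
  unfolding leaf_differentiable_def by (rule has_derivative_dirder)

lemma differentiable_imp_leaf_differentiable:
  assumes "f differentiable (at z)"
  shows "leaf_differentiable f z"
proof -
  have "((\<lambda>x. (x, snd z)) has_derivative (\<lambda>h. (h, 0))) (at (fst z))"
    by (auto intro!: derivative_eq_intros)
  moreover have "(f has_derivative dirder f z) (at (fst z, snd z))" using has_derivative_dirder[OF assms] by simp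
  ultimately have "((\<lambda>x. f (x, snd z)) has_derivative (\<lambda>h. dirder f z (h, 0))) (at (fst z))"
    by (rule has_derivative_compose)
  then show ?thesis unfolding leaf_differentiable_def differentiable_def by blast
qed

lemma dirder_leaf_eqI:
  assumes "((\<lambda>x. f (x, snd z)) has_derivative F) (at (fst z))" "snd \<xi> = 0"
  shows "dirder f z \<xi> = F (fst \<xi>)"
  using dirder_eqI[OF assms(1)] dirder_leaf[OF assms(2)] by metis

lemma leaf_differentiable_add:
  assumes "leaf_differentiable f z" "leaf_differentiable g z"
  shows "leaf_differentiable (\<lambda>z. f z + g z) z"
    and "snd \<xi> = 0 \<Longrightarrow> dirder (\<lambda>z. f z + g z) z \<xi> = dirder f z \<xi> + dirder g z \<xi>"
proof -
  note d = has_derivative_add[OF leaf_differentiable_has_derivative[OF assms(1)] leaf_differentiable_has_derivative[OF assms(2)]]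
  show "leaf_differentiable (\<lambda>z. f z + g z) z"
    using d unfolding leaf_differentiable_def differentiable_def by blast
  show "dirder (\<lambda>z. f z + g z) z \<xi> = dirder f z \<xi> + dirder g z \<xi>" if "snd \<xi> = 0"
    using dirder_leaf_eqI[of "\<lambda>z. f z + g z", OF d that] by (simp add: dirder_leaf[OF that])
qed

lemma leaf_differentiable_scaleR:
  fixes f :: "('p::finite, 'n::finite) pt \<Rightarrow> real"
  assumes "leaf_differentiable f z" "leaf_differentiable X z"
  shows "leaf_differentiable (\<lambda>z. f z *\<^sub>R X z) z"
    and "snd \<xi> = 0 \<Longrightarrow> dirder (\<lambda>z. f z *\<^sub>R X z) z \<xi> = dirder f z \<xi> *\<^sub>R X z + f z *\<^sub>R dirder X z \<xi>"
proof -
  note d = has_derivative_scaleR[OF leaf_differentiable_has_derivative[OF assms(1)] leaf_differentiable_has_derivative[OF assms(2)]]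
  show "leaf_differentiable (\<lambda>z. f z *\<^sub>R X z) z"
    using d unfolding leaf_differentiable_def differentiable_def by blast
  show "dirder (\<lambda>z. f z *\<^sub>R X z) z \<xi> = dirder f z \<xi> *\<^sub>R X z + f z *\<^sub>R dirder X z \<xi>" if "snd \<xi> = 0"
    using dirder_leaf_eqI[of "\<lambda>z. f z *\<^sub>R X z", OF d that] by (simp add: dirder_leaf[OF that] add.commute)
qed

lemma leaf_differentiable_const: "leaf_differentiable (\<lambda>_. c) z"
  by (simp add: leaf_differentiable_def)

lemma leaf_differentiable_cmult:
  fixes f :: "('p::finite, 'n::finite) pt \<Rightarrow> real"
  assumes "leaf_differentiable f z"
  shows "leaf_differentiable (\<lambda>z. c * f z) z"
    and "snd \<xi> = 0 \<Longrightarrow> dirder (\<lambda>z. c * f z) z \<xi> = c * dirder f z \<xi>"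
  using leaf_differentiable_scaleR[OF leaf_differentiable_const[of c] assms] by auto

lemma leaf_differentiable_diff:
  fixes f :: "('p::finite, 'n::finite) pt \<Rightarrow> real"
  assumes "leaf_differentiable f z" "leaf_differentiable g z"
  shows "leaf_differentiable (\<lambda>z. f z - g z) z"
    and "snd \<xi> = 0 \<Longrightarrow> dirder (\<lambda>z. f z - g z) z \<xi> = dirder f z \<xi> - dirder g z \<xi>"
  using leaf_differentiable_add[OF assms(1) leaf_differentiable_cmult(1)[OF assms(2), of "-1"]]
    leaf_differentiable_cmult(2)[OF assms(2), of \<xi> "-1"] by auto

lemma leaf_differentiable_ln:
  fixes f :: "('p::finite, 'n::finite) pt \<Rightarrow> real"
  assumes "leaf_differentiable f z" "f z > 0"
  shows "leaf_differentiable (\<lambda>z. ln (f z)) z"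
    and "snd \<xi> = 0 \<Longrightarrow> dirder (\<lambda>z. ln (f z)) z \<xi> = dirder f z \<xi> / f z"
proof -
  have "f (fst z, snd z) > 0" using assms by simp
  note d = has_derivative_ln[OF this leaf_differentiable_has_derivative[OF assms(1)]]
  show "leaf_differentiable (\<lambda>z. ln (f z)) z"
    using d unfolding leaf_differentiable_def differentiable_def by blast
  show "dirder (\<lambda>z. ln (f z)) z \<xi> = dirder f z \<xi> / f z" if "snd \<xi> = 0"
    using dirder_leaf_eqI[of "\<lambda>z. ln (f z)", OF d that] by (simp add: dirder_leaf[OF that] divide_inverse)
qed

lemma leaf_differentiable_cong:
  assumes "open U" "z \<in> U" "\<And>z. z \<in> U \<Longrightarrow> f z = g z" "leaf_differentiable f z"
  shows "leaf_differentiable g z"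
  unfolding leaf_differentiable_def
proof (rule differentiable_at_cong)
  show "open ((\<lambda>x. (x, snd z)) -` U)" by (intro open_vimage assms(1) continuous_intros)
qed (use assms in \<open>auto simp: leaf_differentiable_def\<close>)

lemma leaf_differentiable_linear:
  fixes f :: "('p::finite, 'n::finite) pt \<Rightarrow> 'c::real_normed_vector"
  assumes "leaf_differentiable f z"
  shows "linear (\<lambda>v::('p, 'n) pt. dirder f z (fst v, 0))"
proof -
  have "dirder f z (fst v, 0) = dirder (\<lambda>x. f (x, snd z)) (fst z) (fst v)" for v :: "('p, 'n) pt"
    by (simp add: dirder_leaf)
  moreover have "linear (dirder (\<lambda>x. f (x, snd z)) (fst z) \<circ> fst)"
    using assms unfolding leaf_differentiable_def
    by (intro linear_compose linear_dirder linear_fst)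
  ultimately show ?thesis by (simp add: o_def)
qed

context pos_form
begin

lemma leaf_vector_eqI:
  assumes "snd x = 0" "snd y = 0" "\<And>\<xi>. snd \<xi> = 0 \<Longrightarrow> G z x \<xi> = G z y \<xi>"
  shows "x = y"
proof -
  have "G z (x - y) (x - y) = 0" using assms(3)[of "x - y"] assms(1,2) by (simp add: Gsimps)
  then show ?thesis using pos[of "x - y"] by fastforce
qed

lemma grad_leaf_eqI:
  assumes "snd w = 0" "\<And>\<xi>. snd \<xi> = 0 \<Longrightarrow> G z w \<xi> = dirder f z \<xi>"
  shows "grad_leaf G f z = w"
  unfolding grad_leaf_def
  by (rule the_equality) (use assms in \<open>auto intro!: leaf_vector_eqI simp del: split_paired_All\<close>)

lemma
  fixes f :: "('p, 'n) pt \<Rightarrow> real"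
  assumes f: "leaf_differentiable f z"
  shows snd_grad_leaf: "snd (grad_leaf G f z) = 0"
    and grad_leaf_pairing: "snd \<xi> = 0 \<Longrightarrow> G z (grad_leaf G f z) \<xi> = dirder f z \<xi>"
proof -
  define w where "w = (\<Sum>a\<in>UNIV. dirder f z (leaf_frame G z a) *\<^sub>R leaf_frame G z a)"
  have lf: "snd (leaf_frame G z a) = 0" for a using leaf_frame_at_leaf_frame by (simp add: leaf_frame_at_def)
  have w: "snd w = 0" by (simp add: w_def snd_sum lf)
  have p: "G z w \<xi> = dirder f z \<xi>" if \<xi>: "snd \<xi> = 0" for \<xi>
  proof -
    note l = leaf_differentiable_linear[OF f]
    have fst0: "(fst v, 0) = v" if "snd v = 0" for v :: "('p, 'n) pt" using that by (simp add: prod_eq_iff)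
    have "dirder f z \<xi> = dirder f z (fst (\<Sum>a\<in>UNIV. G z \<xi> (leaf_frame G z a) *\<^sub>R leaf_frame G z a), 0)"
      by (simp only: leaf_expansion[OF leaf_frame_at_leaf_frame \<xi>] fst0[OF \<xi>])
    also have "\<dots> = (\<Sum>a\<in>UNIV. G z \<xi> (leaf_frame G z a) * dirder f z (leaf_frame G z a))"
      by (subst linear_sum[OF l]) (simp add: linear_cmul[OF l] fst0[OF lf] del: fst_scaleR)
    finally show ?thesis by (simp add: w_def Gsimps sym[of \<xi>] mult.commute)
  qed
  have "grad_leaf G f z = w" by (rule grad_leaf_eqI[OF w p])
  then show "snd (grad_leaf G f z) = 0" "snd \<xi> = 0 \<Longrightarrow> G z (grad_leaf G f z) \<xi> = dirder f z \<xi>"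
    using w p by auto
qed

end

context chart_metric
begin

lemma leaf_differentiable_C1: "Ck_on (Suc 0) U f \<Longrightarrow> z \<in> U \<Longrightarrow> leaf_differentiable f z"
  by (rule differentiable_imp_leaf_differentiable[OF diff_C1])

lemma beta_D_eq:
  "real CARD('n) * beta_D G z = normal_sff_norm2 G z - sqnorm G z (mean_curv G z) / real CARD('n)"
  by (simp add: beta_D_def power2_eq_square field_simps)

text \<open>For a metric of class \<open>C\<^sup>2\<close> the divergence of \<open>H\<close> is merely continuous a priori.  Since all other
  terms of \<open>Sc_mix_harmonic\<close> are differentiable, it is as differentiable along the leaf as the mixed scalar
  curvature, and the gradient may be taken term by term.\<close>

lemma grad_leaf_Sc_mix:
  assumes harm: "\<And>z. z \<in> U \<Longrightarrow> leaf_mean_curv G z = 0" and z: "z \<in> U"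
    and Sc: "leaf_differentiable (Sc_mix G) z"
  defines "n \<equiv> real CARD('n)"
  shows "n *\<^sub>R grad_leaf G (Sc_mix G) z + grad_leaf G (\<lambda>w. sqnorm G w (mean_curv G w)) z =
     n *\<^sub>R grad_leaf G (div_leaf G (mean_curv G)) z
     + n *\<^sub>R grad_leaf G (\<lambda>w. integrability_norm2 G w - leaf_sff_norm2 G w - n * beta_D G w) z"
proof -
  interpret pos_form G z by (rule pos_form_U[OF z])
  define S where "S = (\<lambda>w. integrability_norm2 G w - leaf_sff_norm2 G w - n * beta_D G w)"
  let ?H2 = "\<lambda>w. sqnorm G w (mean_curv G w)"
  have n: "n > 0" by (simp add: n_def)
  have S: "leaf_differentiable S z"
    unfolding S_def by (intro leaf_differentiable_diff(1) leaf_differentiable_cmult(1) leaf_differentiable_C1 z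
        C1_integrability_norm2 C1_leaf_sff_norm2 C1_beta_D)
  have H2: "leaf_differentiable ?H2 z" by (rule leaf_differentiable_C1[OF C1_mean_curv_norm2 z])
  have div_eq: "Sc_mix G w - S w + 1 / n * ?H2 w = div_leaf G (mean_curv G) w" if "w \<in> U" for w
    using Sc_mix_harmonic[OF harm that] beta_D_eq[of w] n by (simp add: n_def S_def)
  have d: "leaf_differentiable (\<lambda>w. Sc_mix G w - S w + 1 / n * ?H2 w) z"
    by (intro leaf_differentiable_add(1) leaf_differentiable_diff(1) leaf_differentiable_cmult(1) Sc S H2)
  have div: "leaf_differentiable (div_leaf G (mean_curv G)) z"
    by (rule leaf_differentiable_cong[OF open_U z div_eq d])
  have "dirder (div_leaf G (mean_curv G)) z \<xi> = dirder (Sc_mix G) z \<xi> - dirder S z \<xi> + 1 / n * dirder ?H2 z \<xi>"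
    if "snd \<xi> = 0" for \<xi>
  proof -
    have "dirder (div_leaf G (mean_curv G)) z \<xi> = dirder (\<lambda>w. Sc_mix G w - S w + 1 / n * ?H2 w) z \<xi>"
      by (rule dirder_cong[OF open_U z div_eq[symmetric]])
    then show ?thesis
      by (simp only: leaf_differentiable_add(2)[OF leaf_differentiable_diff(1)[OF Sc S] leaf_differentiable_cmult(1)[OF H2] that]
          leaf_differentiable_diff(2)[OF Sc S that] leaf_differentiable_cmult(2)[OF H2 that])
  qed
  then show ?thesis
    unfolding S_def[symmetric] using n by (intro leaf_vector_eqI)
      (simp_all add: snd_grad_leaf[OF Sc] snd_grad_leaf[OF S] snd_grad_leaf[OF H2] snd_grad_leaf[OF div] Gsimps
        grad_leaf_pairing[OF Sc] grad_leaf_pairing[OF S] grad_leaf_pairing[OF H2] grad_leaf_pairing[OF div] field_simps)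
qed

text \<open>The hypothesis means that \<open>\<nabla>u = -(u/n) H\<close> on the leaves, so that the Laplacian is the divergence of a multiple
  of \<open>H\<close>; in this way no second derivatives of \<open>u\<close> enter.\<close>

lemma laplace_leaf_potential:
  fixes u :: "('p, 'n) pt \<Rightarrow> real"
  assumes u: "\<And>z. z \<in> U \<Longrightarrow> leaf_differentiable u z" "\<And>z. z \<in> U \<Longrightarrow> u z > 0"
    and H: "\<And>z. z \<in> U \<Longrightarrow> mean_curv G z = - real CARD('n) *\<^sub>R grad_leaf G (\<lambda>z. ln (u z)) z"
    and z: "z \<in> U"
  defines "n \<equiv> real CARD('n)"
  shows "laplace_leaf G u z = - (u z / n) * div_leaf G (mean_curv G) z + u z / n\<^sup>2 * sqnorm G z (mean_curv G z)"
proof -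
  have n: "n > 0" by (simp add: n_def)
  have g: "grad_leaf G u w = (- (1 / n) * u w) *\<^sub>R mean_curv G w" if w: "w \<in> U" for w
  proof -
    interpret pos_form G w by (rule pos_form_U[OF w])
    note l = leaf_differentiable_ln[OF u(1)[OF w] u(2)[OF w]]
    show ?thesis
    proof (rule grad_leaf_eqI)
      show "snd ((- (1 / n) * u w) *\<^sub>R mean_curv G w) = 0" by (simp add: snd_mean_curv[OF w])
      show "G w ((- (1 / n) * u w) *\<^sub>R mean_curv G w) \<xi> = dirder u w \<xi>" if "snd \<xi> = 0" for \<xi>
        using n u(2)[OF w] by (simp add: H[OF w] Gsimps grad_leaf_pairing[OF l(1) that] l(2)[OF that] n_def)
    qed
  qed
  interpret pos_form G z by (rule pos_form_U[OF z])
  have lf: "snd (leaf_frame G z a) = 0" for a using leaf_frame_at_leaf_frame by (simp add: leaf_frame_at_def)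
  let ?f = "\<lambda>w. - (1 / n) * u w"
  have df: "leaf_differentiable ?f z" by (rule leaf_differentiable_cmult(1)[OF u(1)[OF z]])
  have dH: "leaf_differentiable (mean_curv G) z" by (rule leaf_differentiable_C1[OF C1_mean_curv z])
  have c: "cov G z (leaf_frame G z a) (grad_leaf G u) =
      (- (1 / n) * dirder u z (leaf_frame G z a)) *\<^sub>R mean_curv G z + ?f z *\<^sub>R cov G z (leaf_frame G z a) (mean_curv G)" for a
  proof -
    have "dirder (grad_leaf G u) z (leaf_frame G z a) = dirder (\<lambda>w. ?f w *\<^sub>R mean_curv G w) z (leaf_frame G z a)"
      by (rule dirder_cong[OF open_U z g])
    also have "\<dots> = (- (1 / n) * dirder u z (leaf_frame G z a)) *\<^sub>R mean_curv G z + ?f z *\<^sub>R dirder (mean_curv G) z (leaf_frame G z a)"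
      unfolding leaf_differentiable_scaleR(2)[OF df dH lf] leaf_differentiable_cmult(2)[OF u(1)[OF z] lf] ..
    finally show ?thesis
      unfolding cov_def by (simp add: g[OF z] bilinear_rmul[OF bilinear_christoffel[OF z]] scaleR_add_right
          del: scaleR_minus_left mult_minus_left)
  qed
  have du: "dirder u z (leaf_frame G z a) = - (u z / n) * G z (mean_curv G z) (leaf_frame G z a)" for a
    using grad_leaf_pairing[OF u(1)[OF z] lf, of a] by (simp add: g[OF z] Gsimps)
  have "sqnorm G z (mean_curv G z) = (\<Sum>a\<in>UNIV. (G z (mean_curv G z) (leaf_frame G z a))\<^sup>2)"
    using sqnorm_proj_leaf[OF leaf_frame_at_leaf_frame, of "mean_curv G z"] proj_leaf_leaf[OF snd_mean_curv[OF z]] by simp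
  moreover have "G z (cov G z (leaf_frame G z a) (grad_leaf G u)) (leaf_frame G z a) =
      - (u z / n) * G z (cov G z (leaf_frame G z a) (mean_curv G)) (leaf_frame G z a) +
      u z / n\<^sup>2 * (G z (mean_curv G z) (leaf_frame G z a))\<^sup>2" for a
    unfolding c bilinear_ladd[OF bil] bilinear_lmul[OF bil] du by (simp add: power2_eq_square)
  ultimately show ?thesis
    unfolding laplace_leaf_def div_leaf_cov by (simp only: sum.distrib sum_distrib_left)
qed

end

section \<open>Conformal change of the metric along the normal distribution\<close>

text \<open>The second fundamental form of the leaves only involves the metric on leaf vectors and
  the splitting.  Both will turn out to be constant in time.\<close>

lemma (in chart_metric) leaf_sff_by_metric:
  assumes z: "z \<in> U" and "snd \<xi> = 0" "snd \<eta> = 0"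
  shows "2 * G z (proj_normal G z v) (christoffel G z \<xi> \<eta>) =
    - (dirder (\<lambda>z. G z \<xi> \<eta>) z (proj_normal G z v) + G z (dirder (\<lambda>z. proj_normal G z v) z \<xi>) \<eta>
       + G z \<xi> (dirder (\<lambda>z. proj_normal G z v) z \<eta>))"
proof -
  let ?N = "proj_normal G z v"
  have "G z (christoffel G z ?N \<xi>) \<eta> = - G z ?N (christoffel G z \<xi> \<eta>) - G z (dirder (\<lambda>z. proj_normal G z v) z \<xi>) \<eta>"
    if "snd \<xi> = 0" "snd \<eta> = 0" for \<xi> \<eta>
    using cov_N_leaf[OF z that(2), of \<xi> v]
    by (simp add: cov_def bilinear_ladd[OF bil_U[OF z]] christoffel_sym[OF z, of ?N])
  from this[OF assms(2,3)] this[OF assms(3,2)] show ?thesis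
    using christoffel_compat[OF z, of \<xi> \<eta> ?N]
    by (simp add: sym_U[OF z, of \<xi>] christoffel_sym[OF z, of \<eta>])
qed

lemma (in pos_form) normal_double_trace:
  assumes "normal_frame_at G z e" "normal_frame_at G z e'" and W: "bilinear W"
  shows "(\<Sum>i\<in>UNIV. \<Sum>j\<in>UNIV. G z (W (e i) (e j)) (W (e i) (e j))) =
         (\<Sum>i\<in>UNIV. \<Sum>j\<in>UNIV. G z (W (e' i) (e' j)) (W (e' i) (e' j)))"
proof -
  have lin: "linear (\<lambda>u. W u v)" "linear (W v)" for v using W unfolding bilinear_def by blast+
  have 1: "(\<Sum>j\<in>UNIV. G z (W u (e j)) (W u (e j))) = (\<Sum>j\<in>UNIV. G z (W u (e' j)) (W u (e' j)))" for u
    using normal_trace[OF assms(1) bilinear_compose[OF bil lin(2) lin(2)]]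
      normal_trace[OF assms(2) bilinear_compose[OF bil lin(2) lin(2)]] by metis
  have 2: "(\<Sum>i\<in>UNIV. G z (W (e i) v) (W (e i) v)) = (\<Sum>i\<in>UNIV. G z (W (e' i) v) (W (e' i) v))" for v
    using normal_trace[OF assms(1) bilinear_compose[OF bil lin(1) lin(1)]]
      normal_trace[OF assms(2) bilinear_compose[OF bil lin(1) lin(1)]] by metis
  show ?thesis
    unfolding 1 by (subst (1 2) sum.swap) (simp add: 2)
qed

text \<open>Two metrics that agree as soon as one argument is tangent to the leaves, and whose normal parts
  are proportional.  The splitting is then the same, an orthonormal normal frame is rescaled by
  \<open>\<rho>\<^sup>-\<^sup>1\<^sup>/\<^sup>2\<close>, and the norms of the second fundamental form of the leaves and
  of \<open>T\<close> scale according to the number of normal arguments.\<close>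

locale normal_conformal = G: chart_metric U G + G': chart_metric U G'
  for U :: "('p::finite, 'n::finite) pt set" and G G' +
  fixes \<rho> :: "('p, 'n) pt \<Rightarrow> real"
  assumes leaf_eq: "\<And>z v w. z \<in> U \<Longrightarrow> snd v = 0 \<Longrightarrow> G' z v w = G z v w"
    and truncated_eq: "\<And>z v w. z \<in> U \<Longrightarrow> truncated G' z v w = \<rho> z * truncated G z v w"
    and rho_pos: "\<And>z. z \<in> U \<Longrightarrow> \<rho> z > 0"
    and rho_diff: "\<And>z. z \<in> U \<Longrightarrow> \<rho> differentiable (at z)"
begin

lemma leaf_eq_right: "z \<in> U \<Longrightarrow> snd w = 0 \<Longrightarrow> G' z v w = G z v w"
  using leaf_eq G.sym_U G'.sym_U by metis

lemma normal_dirs_eq: "z \<in> U \<Longrightarrow> normal_dirs G' z = normal_dirs G z"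
  unfolding normal_dirs_def by (intro Collect_cong ball_cong refl) (simp add: leaf_eq)

lemma proj_leaf_eq: "z \<in> U \<Longrightarrow> proj_leaf G' z = proj_leaf G z"
  unfolding proj_leaf_def[abs_def] by (simp add: normal_dirs_eq)

lemma proj_normal_eq: "z \<in> U \<Longrightarrow> proj_normal G' z = proj_normal G z"
  unfolding proj_normal_def[abs_def] by (simp add: proj_leaf_eq)

lemma leaf_frame_eq: "z \<in> U \<Longrightarrow> leaf_frame G' z = leaf_frame G z"
  unfolding leaf_frame_def by (rule arg_cong[where f = Eps]) (auto simp: leaf_eq fun_eq_iff)

lemma grad_leaf_eq: "z \<in> U \<Longrightarrow> grad_leaf G' f z = grad_leaf G f z"
  unfolding grad_leaf_def by (rule arg_cong[where f = The]) (auto simp: leaf_eq fun_eq_iff)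

lemma dirder_N_eq: "z \<in> U \<Longrightarrow> dirder (\<lambda>z. proj_normal G' z v) z h = dirder (\<lambda>z. proj_normal G z v) z h"
  by (rule dirder_cong[OF G.open_U]) (auto simp: proj_normal_eq)

lemma leaf_sff_eq:
  assumes z: "z \<in> U" and "snd \<xi> = 0" "snd \<eta> = 0"
  shows "G' z (proj_normal G z v) (christoffel G' z \<xi> \<eta>) = G z (proj_normal G z v) (christoffel G z \<xi> \<eta>)"
proof -
  have "dirder (\<lambda>z. G' z \<xi> \<eta>) z h = dirder (\<lambda>z. G z \<xi> \<eta>) z h" for h
    by (rule dirder_cong[OF G.open_U z]) (simp add: leaf_eq assms(2))
  then have "2 * G' z (proj_normal G z v) (christoffel G' z \<xi> \<eta>) = 2 * G z (proj_normal G z v) (christoffel G z \<xi> \<eta>)"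
    using G'.leaf_sff_by_metric[OF assms, of v] G.leaf_sff_by_metric[OF assms, of v]
    by (simp add: dirder_N_eq[OF z] proj_normal_eq[OF z] leaf_eq[OF z] G.snd_dirder_N[OF z] assms(2,3))
  then show ?thesis by simp
qed

lemma snd_leaf_frame: "z \<in> U \<Longrightarrow> snd (leaf_frame G z a) = 0"
  using pos_form.leaf_frame_at_leaf_frame[OF G.pos_form_U] by (simp add: leaf_frame_at_def)

lemma normal_frame_scaled:
  assumes z: "z \<in> U" and e: "normal_frame_at G z e"
  shows "normal_frame_at G' z (\<lambda>i. (1 / sqrt (\<rho> z)) *\<^sub>R e i)"
proof -
  interpret P: pos_form G z by (rule G.pos_form_U[OF z])
  interpret P': pos_form G' z by (rule G'.pos_form_U[OF z])
  have n: "e i \<in> normal_dirs G z" for i using e by (simp add: normal_frame_at_def)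
  have "G' z (e i) (e j) = \<rho> z * G z (e i) (e j)" for i j
    using truncated_eq[OF z, of "e i" "e j"] n P.truncated_normal P'.truncated_normal by (simp add: normal_dirs_eq[OF z])
  then have "G' z ((1 / sqrt (\<rho> z)) *\<^sub>R e i) ((1 / sqrt (\<rho> z)) *\<^sub>R e j) = (if i = j then 1 else 0)" for i j
    using e rho_pos[OF z]
    by (simp add: bilinear_lmul[OF P'.bil] bilinear_rmul[OF P'.bil] normal_frame_at_def orthonormal_frame_def)
  moreover have "(1 / sqrt (\<rho> z)) *\<^sub>R e i \<in> normal_dirs G' z" for i
    using n[of i] by (simp add: normal_dirs_def leaf_eq[OF z] bilinear_rmul[OF P.bil])
  ultimately show ?thesis by (simp add: normal_frame_at_def orthonormal_frame_def)
qed

lemma leaf_mean_curv_zero: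
  assumes z: "z \<in> U" and "leaf_mean_curv G z = 0"
  shows "leaf_mean_curv G' z = 0"
proof -
  interpret P: pos_form G z by (rule G.pos_form_U[OF z])
  interpret P': pos_form G' z by (rule G'.pos_form_U[OF z])
  note lf = snd_leaf_frame[OF z]
  let ?S' = "\<Sum>a\<in>UNIV. christoffel G' z (leaf_frame G z a) (leaf_frame G z a)"
  let ?S = "\<Sum>a\<in>UNIV. christoffel G z (leaf_frame G z a) (leaf_frame G z a)"
  have m: "leaf_mean_curv G' z = proj_normal G z ?S'"
    using G'.leaf_mean_curv_eq[OF z] by (simp add: leaf_frame_eq[OF z] proj_normal_eq[OF z])
  have "G' z (proj_normal G z ?S') (proj_normal G z ?S') = G' z (proj_normal G z ?S') ?S'"
    using P'.G_normal_right by (simp add: proj_normal_eq[OF z])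
  also have "\<dots> = G z (proj_normal G z ?S') ?S"
    by (simp add: bilinear_sum_right[OF P.bil] bilinear_sum_right[OF P'.bil] leaf_sff_eq[OF z lf lf])
  also have "\<dots> = G z (proj_normal G z ?S') (leaf_mean_curv G z)"
    by (simp add: G.leaf_mean_curv_eq[OF z] P.G_normal_right)
  also have "\<dots> = 0" by (simp add: assms(2) bilinear_rzero[OF P.bil])
  finally show ?thesis using P'.pos[of "proj_normal G z ?S'"] unfolding m by fastforce
qed

text \<open>One normal frame vector enters quadratically.\<close>

lemma leaf_sff_norm2_scaled:
  assumes z: "z \<in> U"
  shows "leaf_sff_norm2 G' z = leaf_sff_norm2 G z / \<rho> z"
proof -
  interpret P: pos_form G z by (rule G.pos_form_U[OF z])
  interpret P': pos_form G' z by (rule G'.pos_form_U[OF z])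
  note lf = snd_leaf_frame[OF z]
  let ?e = "normal_frame G z"
  have e: "normal_frame_at G z ?e" by (rule P.normal_frame_at_normal_frame)
  then have n: "?e i \<in> normal_dirs G z" for i by (simp add: normal_frame_at_def)
  have "G' z (?e i) (christoffel G' z (leaf_frame G z a) (leaf_frame G z b)) =
      G z (?e i) (christoffel G z (leaf_frame G z a) (leaf_frame G z b))" for i a b
    using leaf_sff_eq[OF z lf lf, of "?e i" a b] by (simp add: P.proj_normal_normal[OF n])
  then show ?thesis
    unfolding G'.leaf_sff_norm2_frame[OF z normal_frame_scaled[OF z e]] G.leaf_sff_norm2_frame[OF z e] leaf_frame_eq[OF z]
    using rho_pos[OF z] by (simp add: bilinear_lmul[OF P'.bil] power_divide sum_divide_distrib)
qed

lemma bracket_metric_eq: "z \<in> U \<Longrightarrow> bracket G' z u v = bracket G z u v"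
  by (simp add: bracket_def lie_bracket_def dirder_N_eq proj_normal_eq)

text \<open>Brackets are unchanged; two normal frame vectors enter quadratically.\<close>

lemma integrability_norm2_scaled:
  assumes z: "z \<in> U"
  shows "integrability_norm2 G' z = integrability_norm2 G z / (\<rho> z)\<^sup>2"
proof -
  interpret P: pos_form G z by (rule G.pos_form_U[OF z])
  interpret P': pos_form G' z by (rule G'.pos_form_U[OF z])
  let ?e = "normal_frame G z" and ?W = "\<lambda>u v. (1/2) *\<^sub>R proj_leaf G z (bracket G z u v)"
  have e: "normal_frame_at G z ?e" by (rule P.normal_frame_at_normal_frame)
  have W: "bilinear ?W"
    unfolding bilinear_def linear_iff
    by (simp add: bilinear_rules[OF G.bilinear_bracket[OF z]]
        linear_add[OF P.linear_proj_leaf] linear_cmul[OF P.linear_proj_leaf] algebra_simps)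
  have "integrability_norm2 G' z =
      (\<Sum>i\<in>UNIV. \<Sum>j\<in>UNIV. G' z (?W (normal_frame G' z i) (normal_frame G' z j)) (?W (normal_frame G' z i) (normal_frame G' z j)))"
    by (simp add: integrability_norm2_def integrability_sections sqnorm_def proj_leaf_eq[OF z] bracket_metric_eq[OF z])
  also have "\<dots> = (\<Sum>i\<in>UNIV. \<Sum>j\<in>UNIV. G' z (?W ((1 / sqrt (\<rho> z)) *\<^sub>R ?e i) ((1 / sqrt (\<rho> z)) *\<^sub>R ?e j))
      (?W ((1 / sqrt (\<rho> z)) *\<^sub>R ?e i) ((1 / sqrt (\<rho> z)) *\<^sub>R ?e j)))"
    by (rule P'.normal_double_trace[OF P'.normal_frame_at_normal_frame normal_frame_scaled[OF z e] W])
  also have "\<dots> = (\<Sum>i\<in>UNIV. \<Sum>j\<in>UNIV. G z (?W (?e i) (?e j)) (?W (?e i) (?e j)) / (\<rho> z)\<^sup>2)"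
    using rho_pos[OF z]
    by (intro sum.cong refl)
      (simp add: bilinear_lmul[OF W] bilinear_rmul[OF W] bilinear_lmul[OF P'.bil] bilinear_rmul[OF P'.bil]
        bilinear_lmul[OF P.bil] bilinear_rmul[OF P.bil] leaf_eq[OF z] power2_eq_square
        bilinear_lmul[OF G.bilinear_bracket[OF z]] bilinear_rmul[OF G.bilinear_bracket[OF z]]
        linear_cmul[OF P.linear_proj_leaf])
  also have "\<dots> = integrability_norm2 G z / (\<rho> z)\<^sup>2"
    by (simp add: integrability_norm2_def integrability_sections sqnorm_def sum_divide_distrib)
  finally show ?thesis .
qed

text \<open>\<open>G(H, \<xi>)\<close> is \<open>-1/2\<close> times the derivative of the logarithm of the determinant of the normal
  metric, and this determinant is multiplied by \<open>\<rho>\<^sup>n\<close>.\<close>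

lemma mean_curv_change:
  assumes z: "z \<in> U" and \<xi>: "snd \<xi> = 0"
  shows "G z (mean_curv G' z) \<xi> = G z (mean_curv G z) \<xi> - real CARD('n) / 2 * (dirder \<rho> z \<xi> / \<rho> z)"
proof -
  interpret P: pos_form G z by (rule G.pos_form_U[OF z])
  interpret P': pos_form G' z by (rule G'.pos_form_U[OF z])
  let ?e = "normal_frame G z" and ?c = "1 / sqrt (\<rho> z)"
  have e: "normal_frame_at G z ?e" by (rule P.normal_frame_at_normal_frame)
  have d: "dirder (\<lambda>w. truncated G' w (?c *\<^sub>R ?e i) (?c *\<^sub>R ?e i)) z \<xi> =
      dirder (\<lambda>z'. truncated G z' (?e i) (?e i)) z \<xi> + dirder \<rho> z \<xi> / \<rho> z" for i
  proof -
    have t1: "truncated G z (?e i) (?e i) = 1"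
      using e P.truncated_normal by (simp add: normal_frame_at_def orthonormal_frame_def)
    have "dirder (\<lambda>w. truncated G' w (?c *\<^sub>R ?e i) (?c *\<^sub>R ?e i)) z \<xi> =
       dirder (\<lambda>w. (1 / \<rho> z) * (\<rho> w * truncated G w (?e i) (?e i))) z \<xi>"
    proof (rule dirder_cong[OF G.open_U z])
      fix w assume w: "w \<in> U"
      interpret P: pos_form G w by (rule G.pos_form_U[OF w])
      show "truncated G' w (?c *\<^sub>R ?e i) (?c *\<^sub>R ?e i) = (1 / \<rho> z) * (\<rho> w * truncated G w (?e i) (?e i))"
        using rho_pos[OF z]
        by (simp add: truncated_eq[OF w] bilinear_lmul[OF P.bilinear_truncated] bilinear_rmul[OF P.bilinear_truncated])
    qed
    also have "\<dots> = (1 / \<rho> z) * (\<rho> z * dirder (\<lambda>z'. truncated G z' (?e i) (?e i)) z \<xi> + dirder \<rho> z \<xi> * truncated G z (?e i) (?e i))"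
      by (rule dirder_eqI)
        (intro has_derivative_mult_right has_derivative_mult has_derivative_dirder rho_diff z G.diff_C2[OF G.C2_truncated])
    finally show ?thesis using rho_pos[OF z] by (simp add: t1 field_simps)
  qed
  have "G z (mean_curv G' z) \<xi> = G' z (mean_curv G' z) \<xi>" by (simp add: leaf_eq_right[OF z \<xi>])
  also have "\<dots> = - (1/2) * (\<Sum>i\<in>UNIV. dirder (\<lambda>z'. truncated G z' (?e i) (?e i)) z \<xi> + dirder \<rho> z \<xi> / \<rho> z)"
    unfolding G'.mean_curv_pairing[OF z \<xi> normal_frame_scaled[OF z e]] d ..
  also have "\<dots> = G z (mean_curv G z) \<xi> - real CARD('n) / 2 * (dirder \<rho> z \<xi> / \<rho> z)"
    unfolding G.mean_curv_pairing[OF z \<xi> e] by (simp add: sum.distrib algebra_simps)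
  finally show ?thesis .
qed

end

section \<open>Families of functions on half-open time intervals\<close>

text \<open>From each time a short step forward is possible, but none backward if \<open>0\<close> is the initial time.\<close>

definition forward_interval :: "real set \<Rightarrow> bool" where
  "forward_interval J \<longleftrightarrow> convex J \<and> 0 \<in> J \<and> (\<forall>t\<in>J. \<exists>d>0. {t..t + d} \<subseteq> J)"

lemma unique_derivs_forward_interval:
  assumes "forward_interval J"
  shows "unique_derivs J"
  unfolding unique_derivs_def
proof (intro ballI allI impI)
  fix t i e :: real
  assume *: "t \<in> J" "i \<in> Basis" "e > 0"
  obtain d where d: "d > 0" "{t..t + d} \<subseteq> J" using assms *(1) unfolding forward_interval_def by blast
  show "\<exists>d. 0 < \<bar>d\<bar> \<and> \<bar>d\<bar> < e \<and> t + d *\<^sub>R i \<in> J"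
    using d * by (intro exI[of _ "min d e / 2"]) auto
qed

lemma time_derivative_unique:
  assumes "unique_derivs J" "t \<in> J"
    and "(f has_real_derivative a) (at t within J)" "(f has_real_derivative b) (at t within J)"
  shows "a = b"
proof -
  have "(*) a = (*) b"
    using frechet_derivative_within_eqI[OF assms(1,2)] assms(3,4) unfolding has_field_derivative_def by metis
  from fun_cong[OF this, of 1] show ?thesis by simp
qed

text \<open>The time derivative of a leafwise derivative, by symmetry of the second derivatives of \<open>B\<close> on the
  product \<open>J \<times> W\<close>.\<close>

lemma mixed_partial:
  fixes B :: "real \<times> 'x::euclidean_space \<Rightarrow> real"
  assumes J: "forward_interval J" and W: "open W" and B: "Ck_on 2 (J \<times> W) B" and t: "t \<in> J" and x: "x \<in> W"
    and Bt: "\<And>t x. t \<in> J \<Longrightarrow> x \<in> W \<Longrightarrow> ((\<lambda>r. B (r, x)) has_real_derivative Bt t x) (at t within J)"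
  shows "(\<lambda>x. B (t, x)) differentiable (at x)"
    and "(\<lambda>x. Bt t x) differentiable (at x)"
    and "((\<lambda>r. dirder (\<lambda>x. B (r, x)) x v) has_real_derivative dirder (Bt t) x v) (at t within J)"
proof -
  let ?S = "J \<times> W"
  have udJ: "unique_derivs J" by (rule unique_derivs_forward_interval[OF J])
  have ud: "unique_derivs ?S" by (rule unique_derivs_Times[OF udJ unique_derivs_open[OF W]])
  have B2: "Ck_on (Suc (Suc 0)) ?S B" using B by (simp add: numeral_2_eq_2)
  have space: "((\<lambda>x. C (t, x)) has_derivative (\<lambda>h. frechet_derivative C (at (t, x) within ?S) (0, h))) (at x)"
    if C: "Ck_on (Suc k) ?S C" and "t \<in> J" "x \<in> W" for k C t x
  proof -
    have "((\<lambda>x. C (t, x)) has_derivative (\<lambda>h. frechet_derivative C (at (t, x) within ?S) (0, h))) (at x within W)"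
      by (rule has_derivative_in_compose2[where g = C and t = ?S and f = "\<lambda>x. (t, x)", OF Ck_on_SucD(1)[OF C]])
        (use that(2,3) in \<open>auto intro!: derivative_eq_intros\<close>)
    then show ?thesis by (simp add: at_within_open[OF that(3) W])
  qed
  have time: "((\<lambda>r. C (r, x)) has_real_derivative frechet_derivative C (at (t, x) within ?S) (1, 0)) (at t within J)"
    if C: "Ck_on (Suc k) ?S C" and "t \<in> J" "x \<in> W" for k C t x
  proof -
    have d: "((\<lambda>r. C (r, x)) has_derivative (\<lambda>h. frechet_derivative C (at (t, x) within ?S) (h, 0))) (at t within J)"
      by (rule has_derivative_in_compose2[where g = C and t = ?S and f = "\<lambda>r. (r, x)", OF Ck_on_SucD(1)[OF C]])
        (use that(2,3) in \<open>auto intro!: derivative_eq_intros\<close>)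
    have lin: "linear (frechet_derivative C (at (t, x) within ?S))"
      using Ck_on_SucD(1)[OF C, of "(t, x)"] that(2,3) has_derivative_linear by blast
    have "frechet_derivative C (at (t, x) within ?S) (h, 0) = frechet_derivative C (at (t, x) within ?S) (1, 0) * h" for h
      using linear_cmul[OF lin, of h "(1, 0)"] by (simp only: scaleR_Pair real_scaleR_def mult_1_left mult_1_right scaleR_zero_right mult.commute)
    then have "(\<lambda>h. frechet_derivative C (at (t, x) within ?S) (h, 0)) = (*) (frechet_derivative C (at (t, x) within ?S) (1, 0))"
      by (intro ext)
    with d show ?thesis by (simp only: has_field_derivative_def)
  qed
  have Bt_eq: "Bt t x = frechet_derivative B (at (t, x) within ?S) (1, 0)" if "t \<in> J" "x \<in> W" for t x
    by (rule time_derivative_unique[OF udJ that(1) Bt[OF that] time[OF B2 that]])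
  let ?X = "\<lambda>q. frechet_derivative B (at q within ?S) (0, v)" and ?T = "\<lambda>q. frechet_derivative B (at q within ?S) (1, 0)"
  show "(\<lambda>x. B (t, x)) differentiable (at x)"
    using space[OF B2 t x] unfolding differentiable_def by blast
  have T: "((\<lambda>x. Bt t x) has_derivative (\<lambda>h. frechet_derivative ?T (at (t, x) within ?S) (0, h))) (at x)"
    by (rule has_derivative_transform_within_open[OF space[OF Ck_on_SucD(2)[OF B2] t x] W x])
      (simp add: Bt_eq[OF t])
  then show "(\<lambda>x. Bt t x) differentiable (at x)" unfolding differentiable_def by blast
  have X: "dirder (\<lambda>x. B (r, x)) x v = ?X (r, x)" if "r \<in> J" for r
    by (rule dirder_eqI[OF space[OF B2 that x]])
  obtain d1 where d1: "d1 > 0" "{t..t + d1} \<subseteq> J" using J t unfolding forward_interval_def by blast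
  obtain e where e: "e > 0" "ball x e \<subseteq> W" using W x by (meson openE)
  \<comment> \<open>Steps of length \<open>d\<close> stay in \<open>J\<close> forward in time and in \<open>W\<close> along \<open>v\<close>.\<close>
  define d where "d = min d1 (e / (2 * (norm v + 1)))"
  have N: "norm v + 1 > 0" by (smt (verit) norm_ge_zero)
  have d: "d > 0" using d1 e N by (simp add: d_def)
  have "d * norm v < e"
  proof -
    have "d * norm v \<le> d * (norm v + 1)" using d by simp
    also have "\<dots> \<le> e / (2 * (norm v + 1)) * (norm v + 1)" using N by (intro mult_right_mono) (auto simp: d_def)
    also have "\<dots> = e / 2" using N by (simp add: field_simps)
    finally show ?thesis using e by simp
  qed
  have seg: "(t, x) + s *\<^sub>R (1, 0) + r *\<^sub>R (0, v) \<in> ?S" if "s \<in> {0..d}" "r \<in> {0..d}" for s r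
  proof -
    have "t + s \<in> J" using d1 that by (auto simp: d_def)
    moreover have "dist (x + r *\<^sub>R v) x < e"
      using that mult_right_mono[of r d "norm v"] \<open>d * norm v < e\<close> by (auto simp: dist_norm)
    then have "x + r *\<^sub>R v \<in> W" using e by (auto simp: dist_commute)
    ultimately show ?thesis by simp
  qed
  have "frechet_derivative ?X (at (t, x) within ?S) (1, 0) = frechet_derivative ?T (at (t, x) within ?S) (0, v)"
    by (rule second_derivative_symmetric_real[OF ud B d seg, symmetric])
  also have "\<dots> = dirder (Bt t) x v" by (rule dirder_eqI[OF T, symmetric])
  finally have "((\<lambda>r. ?X (r, x)) has_real_derivative dirder (Bt t) x v) (at t within J)"
    using time[OF Ck_on_SucD(2)[OF B2] t x, of "(0, v)"] by simp
  then show "((\<lambda>r. dirder (\<lambda>x. B (r, x)) x v) has_real_derivative dirder (Bt t) x v) (at t within J)"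
    unfolding has_field_derivative_def
    by (rule has_derivative_transform[OF t, rotated]) (simp add: X)
qed

section \<open>The flow in a chart\<close>

text \<open>The flow equation in one chart, with the speed \<open>s = Sc\<^sub>m\<^sub>i\<^sub>x - \<Phi>\<close> regarded as a given function.  At each
  point it is then a linear ordinary differential equation.\<close>

locale chart_flow =
  fixes J :: "real set" and U :: "('p::finite, 'n::finite) pt set"
    and G :: "real \<Rightarrow> ('p, 'n) form_field" and s :: "real \<Rightarrow> ('p, 'n) pt \<Rightarrow> real"
  assumes J: "forward_interval J"
    and metrics: "\<And>t. t \<in> J \<Longrightarrow> chart_metric U (G t)"
    and smooth_leaves: "\<And>k y v w. Ck_on k (J \<times> {x. (x, y) \<in> U}) (\<lambda>(t, x). G t (x, y) v w)"
    and smooth_initial: "\<And>k v w. Ck_on k U (\<lambda>z. G 0 z v w)"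
    and flow: "\<And>t z v w. t \<in> J \<Longrightarrow> z \<in> U \<Longrightarrow>
      ((\<lambda>r. G r z v w) has_real_derivative - 2 * s t z * truncated (G t) z v w) (at t within J)"
begin

lemma zero_in_J: "0 \<in> J" and convex_J: "convex J"
  using J by (auto simp: forward_interval_def)

lemma open_U: "open U"
  by (rule chart_metric.open_U[OF metrics[OF zero_in_J]])

lemma pos: "t \<in> J \<Longrightarrow> z \<in> U \<Longrightarrow> pos_form (G t) z"
  by (rule chart_metric.pos_form_U[OF metrics])

lemma constant_in_time:
  assumes "\<And>t. t \<in> J \<Longrightarrow> (f has_real_derivative 0) (at t within J)" "t \<in> J"
  shows "f t = f 0"
  using has_field_derivative_zero_constant[OF convex_J assms(1)] assms(2) zero_in_J by metis

text \<open>The truncated metric vanishes on leaf vectors, so these products do not move.  Consequently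
  the splitting does not move either.\<close>

lemma leaf_part_constant:
  assumes "t \<in> J" "z \<in> U" "snd v = 0"
  shows "G t z v w = G 0 z v w"
proof (rule constant_in_time[OF _ assms(1), of "\<lambda>t. G t z v w"])
  fix t assume t: "t \<in> J"
  interpret pos_form "G t" z by (rule pos[OF t assms(2)])
  show "((\<lambda>t. G t z v w) has_real_derivative 0) (at t within J)"
    using flow[OF t assms(2), of v w] by (simp add: truncated_def proj_normal_leaf[OF assms(3)] Gsimps)
qed

lemma proj_leaf_constant: "t \<in> J \<Longrightarrow> z \<in> U \<Longrightarrow> proj_leaf (G t) z = proj_leaf (G 0) z"
  unfolding proj_leaf_def[abs_def] normal_dirs_def by (simp add: leaf_part_constant)

lemma proj_normal_constant: "t \<in> J \<Longrightarrow> z \<in> U \<Longrightarrow> proj_normal (G t) z = proj_normal (G 0) z"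
  unfolding proj_normal_def[abs_def] by (simp add: proj_leaf_constant)

lemma truncated_flow:
  assumes "t \<in> J" "z \<in> U"
  shows "((\<lambda>r. truncated (G r) z v w) has_real_derivative - 2 * s t z * truncated (G t) z v w) (at t within J)"
proof -
  interpret pos_form "G t" z by (rule pos[OF assms])
  let ?v = "proj_normal (G t) z v" and ?w = "proj_normal (G t) z w"
  have "truncated (G t) z ?v ?w = truncated (G t) z v w"
    by (simp add: truncated_def proj_normal_normal[OF proj_normal_in])
  then have "((\<lambda>r. G r z ?v ?w) has_real_derivative - 2 * s t z * truncated (G t) z v w) (at t within J)"
    using flow[OF assms, of ?v ?w] by simp
  then show ?thesis
    unfolding has_field_derivative_def
    by (rule has_derivative_transform[OF assms(1), rotated])
      (simp add: truncated_def proj_normal_constant assms)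
qed

text \<open>The conformal factor is read off from one fixed transverse vector.\<close>

definition height :: "real \<Rightarrow> ('p, 'n) pt \<Rightarrow> real" where
  "height t z = truncated (G t) z (0, 1) (0, 1)"

definition factor :: "real \<Rightarrow> ('p, 'n) pt \<Rightarrow> real" where
  "factor t z = height t z / height 0 z"

lemma height_pos: "t \<in> J \<Longrightarrow> z \<in> U \<Longrightarrow> height t z > 0"
  unfolding height_def by (rule pos_form.truncated_pos[OF pos]) (auto simp: vec_eq_iff)

lemma factor_pos: "t \<in> J \<Longrightarrow> z \<in> U \<Longrightarrow> factor t z > 0"
  unfolding factor_def using height_pos zero_in_J by simp

lemma factor_zero: "z \<in> U \<Longrightarrow> factor 0 z = 1"
  unfolding factor_def using height_pos[OF zero_in_J] by fastforce

text \<open>All coefficients of the normal metric solve the same scalar equation \<open>f' = -2 s f\<close>, so their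
  quotients are constant.\<close>

lemma truncated_factor:
  assumes "t \<in> J" "z \<in> U"
  shows "truncated (G t) z v w = factor t z * truncated (G 0) z v w"
proof -
  have "truncated (G t) z v w / height t z = truncated (G 0) z v w / height 0 z"
  proof (rule constant_in_time[OF _ assms(1), of "\<lambda>t. truncated (G t) z v w / height t z"])
    fix t assume t: "t \<in> J"
    show "((\<lambda>t. truncated (G t) z v w / height t z) has_real_derivative 0) (at t within J)"
      unfolding height_def
      by (rule DERIV_cong[OF DERIV_divide[OF truncated_flow[OF t assms(2)] truncated_flow[OF t assms(2)]]])
        (use height_pos[OF t assms(2)] in \<open>simp_all add: height_def\<close>)
  qed
  then show ?thesis
    using height_pos[OF assms] by (simp add: factor_def field_simps)
qed

lemma factor_flow:
  assumes "t \<in> J" "z \<in> U"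
  shows "((\<lambda>r. factor r z) has_real_derivative - 2 * s t z * factor t z) (at t within J)"
  unfolding factor_def
  by (rule DERIV_cong[OF DERIV_cdivide[OF truncated_flow[OF assms, of "(0, 1)" "(0, 1)", folded height_def]]]) simp

lemma slice_open: "open {x. (x, y) \<in> U}"
proof -
  have "open ((\<lambda>x. (x, y)) -` U)" by (intro open_vimage open_U continuous_intros)
  then show ?thesis by (simp add: vimage_def)
qed

lemma unique_derivs_slice: "unique_derivs (J \<times> {x. (x, y) \<in> U})"
  by (rule unique_derivs_Times[OF unique_derivs_forward_interval[OF J] unique_derivs_open[OF slice_open]])

lemma Ck_on_initial_slice:
  assumes "Ck_on k U f"
  shows "Ck_on k (J \<times> {x. (x, y) \<in> U}) (\<lambda>(t, x). f (x, y))"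
proof -
  have "bounded_linear (\<lambda>q. (snd q, 0) :: ('p, 'n) pt)"
    by (intro bounded_linear_Pair bounded_linear_snd bounded_linear_zero)
  from Ck_on_compose_affine[OF unique_derivs_slice this _ assms, where c = "(0, y)"]
  show ?thesis by (auto simp: case_prod_unfold)
qed

text \<open>The normal metric differs from the metric by a leaf part that is constant in time.  So
  \<open>height\<close> is a metric coefficient, smooth in time and along the leaf, minus a function of the
  smooth initial metric.\<close>

lemma smooth_height: "Ck_on k (J \<times> {x. (x, y) \<in> U}) (\<lambda>(t, x). height t (x, y))"
proof -
  let ?c = "(0, 1) :: ('p, 'n) pt"
  have 0: "chart_metric U (G 0)" by (rule metrics[OF zero_in_J])
  have "Ck_on k U (\<lambda>z. G 0 z ?c ?c - height 0 z)"
    unfolding height_def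
    by (intro Ck_on_diff chart_metric.ud[OF 0] smooth_initial Ck_on_truncated chart_metric.posdef_U[OF 0])
  note r = Ck_on_initial_slice[OF this, of y]
  have eq: "height t z = G t z ?c ?c - (G 0 z ?c ?c - height 0 z)" if t: "t \<in> J" and z: "z \<in> U" for t z
  proof -
    have "G t z ?c ?c = height t z + G 0 z (proj_leaf (G 0) z ?c) (proj_leaf (G 0) z ?c)" if t: "t \<in> J" for t
    proof -
      interpret pos_form "G t" z by (rule pos[OF t z])
      have "G t z ?c ?c = G t z (proj_leaf (G t) z ?c + proj_normal (G t) z ?c) (proj_leaf (G t) z ?c + proj_normal (G t) z ?c)"
        by (simp add: decompose)
      also have "\<dots> = G t z (proj_leaf (G t) z ?c) (proj_leaf (G t) z ?c) + height t z"
        by (simp only: Gsimps(1,2) orth[OF snd_proj_leaf] height_def truncated_def)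
      also have "G t z (proj_leaf (G t) z ?c) (proj_leaf (G t) z ?c) = G 0 z (proj_leaf (G 0) z ?c) (proj_leaf (G 0) z ?c)"
        using leaf_part_constant[OF t z snd_proj_leaf] by (simp add: proj_leaf_constant[OF t z])
      finally show ?thesis by simp
    qed
    from this[OF t] this[OF zero_in_J] show ?thesis by simp
  qed
  have "Ck_on k (J \<times> {x. (x, y) \<in> U}) (\<lambda>q. (case q of (t, x) \<Rightarrow> G t (x, y) ?c ?c) -
      (case q of (t, x) \<Rightarrow> G 0 (x, y) ?c ?c - height 0 (x, y)))"
    by (rule Ck_on_diff[OF unique_derivs_slice smooth_leaves r])
  then show ?thesis using eq by (subst Ck_on_cong) auto
qed

lemma smooth_factor: "Ck_on k (J \<times> {x. (x, y) \<in> U}) (\<lambda>(t, x). factor t (x, y))"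
proof -
  have 0: "chart_metric U (G 0)" by (rule metrics[OF zero_in_J])
  have "Ck_on k U (\<lambda>z. inverse (height 0 z))"
    by (rule Ck_on_inverse[OF chart_metric.ud[OF 0]])
      (use height_pos[OF zero_in_J] in force, unfold height_def,
       intro Ck_on_truncated chart_metric.ud[OF 0] chart_metric.posdef_U[OF 0] smooth_initial)
  note r = Ck_on_initial_slice[OF this, of y]
  have "Ck_on k (J \<times> {x. (x, y) \<in> U}) (\<lambda>q. (case q of (t, x) \<Rightarrow> height t (x, y)) *
      (case q of (t, x) \<Rightarrow> inverse (height 0 (x, y))))"
    by (rule Ck_on_mult[OF unique_derivs_slice smooth_height r])
  then show ?thesis by (subst Ck_on_cong) (auto simp: factor_def divide_inverse)
qed

lemma factor_differentiable:
  assumes t: "t \<in> J" and z: "z \<in> U"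
  shows "factor t differentiable (at z)"
proof -
  interpret chart_metric U "G t" by (rule metrics[OF t])
  interpret G0: chart_metric U "G 0" by (rule metrics[OF zero_in_J])
  have "Ck_on (Suc (Suc 0)) U (\<lambda>z. height t z * inverse (height 0 z))"
    unfolding height_def
    by (intro Ck_on_mult ud C2_truncated Ck_on_inverse G0.C2_truncated)
      (use height_pos[OF zero_in_J] in \<open>force simp: height_def\<close>)
  from diff_C2[OF this z] show ?thesis by (simp add: factor_def[abs_def] divide_inverse)
qed

lemma conformal: "t \<in> J \<Longrightarrow> normal_conformal U (G 0) (G t) (factor t)"
  by (intro normal_conformal.intro normal_conformal_axioms.intro metrics zero_in_J)
    (auto simp: leaf_part_constant truncated_factor factor_pos factor_differentiable)

text \<open>The speed is recovered from the factor as \<open>-1/2\<close> times its logarithmic time derivative, which is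
  smooth along the leaf.  Interchanging the derivatives then gives the evolution of the logarithmic
  leafwise derivative.\<close>

lemma
  assumes t: "t \<in> J" and z: "z \<in> U"
  shows speed_leaf_differentiable: "leaf_differentiable (s t) z"
    and log_factor_flow: "snd \<xi> = 0 \<Longrightarrow>
      ((\<lambda>r. dirder (factor r) z \<xi> / factor r z) has_real_derivative - 2 * dirder (s t) z \<xi>) (at t within J)"
proof -
  obtain x y where zxy: "z = (x, y)" by (cases z)
  let ?W = "{x. (x, y) \<in> U}"
  let ?B = "\<lambda>(t, x). factor t (x, y)"
  let ?Bt = "\<lambda>t x. - 2 * s t (x, y) * factor t (x, y)"
  have x: "x \<in> ?W" using z zxy by simp
  have Bt: "((\<lambda>r. ?B (r, x)) has_real_derivative ?Bt t x) (at t within J)" if "t \<in> J" "x \<in> ?W" for t x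
    using factor_flow[of t "(x, y)"] that by simp
  note mp = mixed_partial[OF J slice_open smooth_factor t x Bt]
  have mp1: "(\<lambda>x. factor t (x, y)) differentiable (at x)" using mp(1) by simp
  have mp3: "((\<lambda>r. dirder (\<lambda>x. factor r (x, y)) x v) has_real_derivative dirder (?Bt t) x v) (at t within J)" for v
    using mp(3)[of v] by simp
  have f: "factor t (x, y) > 0" if "x \<in> ?W" for x using factor_pos[OF t] that by simp
  have nz: "factor t (x, y) \<noteq> 0" using f[OF x] by simp
  have "(\<lambda>x. (- 1 / 2) * (?Bt t x * inverse (factor t (x, y)))) differentiable (at x)"
    by (rule differentiable_mult[OF differentiable_const differentiable_mult[OF mp(2) differentiable_inverse[OF mp1 nz]]])
  then have d: "(\<lambda>x. s t (x, y)) differentiable (at x)"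
    by (rule differentiable_at_cong[OF slice_open x, rotated]) (use f in \<open>force simp: field_simps\<close>)
  then show "leaf_differentiable (s t) z" by (simp add: leaf_differentiable_def zxy)
  assume \<xi>: "snd \<xi> = 0"
  have e: "dirder (factor r) (x, y) \<xi> = dirder (\<lambda>x. factor r (x, y)) x (fst \<xi>)" for r
    using dirder_leaf[OF \<xi>, of "factor r" z] by (simp add: zxy)
  have "dirder (?Bt t) x (fst \<xi>) = (- 2 * s t (x, y)) * dirder (\<lambda>x. factor t (x, y)) x (fst \<xi>) +
      (- 2 * dirder (\<lambda>x. s t (x, y)) x (fst \<xi>)) * factor t (x, y)"
    by (rule dirder_eqI)
      (intro has_derivative_mult has_derivative_mult_right has_derivative_dirder d mp1)
  moreover have "dirder (s t) z \<xi> = dirder (\<lambda>x. s t (x, y)) x (fst \<xi>)"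
    using dirder_leaf[OF \<xi>, of "s t" z] by (simp add: zxy)
  ultimately have "((\<lambda>r. dirder (factor r) z \<xi>) has_real_derivative
      - 2 * s t z * dirder (factor t) z \<xi> - 2 * dirder (s t) z \<xi> * factor t z) (at t within J)"
    using mp3[of "fst \<xi>"] by (simp add: e zxy)
  from DERIV_divide[OF this factor_flow[OF t z]]
  show "((\<lambda>r. dirder (factor r) z \<xi> / factor r z) has_real_derivative - 2 * dirder (s t) z \<xi>) (at t within J)"
    by (rule DERIV_cong) (use factor_pos[OF t z] in \<open>simp_all add: field_simps\<close>)
qed

text \<open>By \<open>mean_curv_change\<close> the mean curvature is \<open>H\<^sub>t = H\<^sub>0 - n/2 \<nabla> log \<rho>\<^sub>t\<close>, expanded in a leaf frame that
  does not depend on time.\<close>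

theorem mean_curv_flow:
  assumes t: "t \<in> J" and z: "z \<in> U"
  shows "((\<lambda>r. mean_curv (G r) z) has_vector_derivative real CARD('n) *\<^sub>R grad_leaf (G t) (s t) z) (at t within J)"
proof -
  interpret G0: chart_metric U "G 0" by (rule metrics[OF zero_in_J])
  interpret P: pos_form "G 0" z by (rule pos[OF zero_in_J z])
  let ?\<epsilon> = "leaf_frame (G 0) z" and ?n = "real CARD('n)"
  have lf: "snd (?\<epsilon> a) = 0" for a using P.leaf_frame_at_leaf_frame by (simp add: leaf_frame_at_def)
  have H: "mean_curv (G r) z = (\<Sum>a\<in>UNIV. (G 0 z (mean_curv (G 0) z) (?\<epsilon> a) -
      ?n / 2 * (dirder (factor r) z (?\<epsilon> a) / factor r z)) *\<^sub>R ?\<epsilon> a)" if r: "r \<in> J" for r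
    unfolding normal_conformal.mean_curv_change[OF conformal[OF r] z lf, symmetric]
    by (rule P.leaf_expansion[OF P.leaf_frame_at_leaf_frame chart_metric.snd_mean_curv[OF metrics[OF r] z], symmetric])
  have "((\<lambda>r. \<Sum>a\<in>UNIV. (G 0 z (mean_curv (G 0) z) (?\<epsilon> a) -
      ?n / 2 * (dirder (factor r) z (?\<epsilon> a) / factor r z)) *\<^sub>R ?\<epsilon> a) has_vector_derivative
      (\<Sum>a\<in>UNIV. (?n * dirder (s t) z (?\<epsilon> a)) *\<^sub>R ?\<epsilon> a)) (at t within J)"
  proof (rule has_vector_derivative_sum)
    fix a
    have "((\<lambda>r. G 0 z (mean_curv (G 0) z) (?\<epsilon> a) - ?n / 2 * (dirder (factor r) z (?\<epsilon> a) / factor r z))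
        has_real_derivative 0 - ?n / 2 * (- 2 * dirder (s t) z (?\<epsilon> a))) (at t within J)"
      by (intro DERIV_diff DERIV_const DERIV_cmult log_factor_flow[OF t z lf])
    from has_vector_derivative_scaleR[OF this has_vector_derivative_const[of "?\<epsilon> a"]]
    show "((\<lambda>r. (G 0 z (mean_curv (G 0) z) (?\<epsilon> a) - ?n / 2 * (dirder (factor r) z (?\<epsilon> a) / factor r z)) *\<^sub>R ?\<epsilon> a)
        has_vector_derivative (?n * dirder (s t) z (?\<epsilon> a)) *\<^sub>R ?\<epsilon> a) (at t within J)"
      by simp
  qed
  then have "((\<lambda>r. mean_curv (G r) z) has_vector_derivative (\<Sum>a\<in>UNIV. (?n * dirder (s t) z (?\<epsilon> a)) *\<^sub>R ?\<epsilon> a)) (at t within J)"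
    unfolding has_vector_derivative_def
    by (rule has_derivative_transform[OF t, rotated]) (simp add: H)
  moreover have "(\<Sum>a\<in>UNIV. (?n * dirder (s t) z (?\<epsilon> a)) *\<^sub>R ?\<epsilon> a) = ?n *\<^sub>R grad_leaf (G t) (s t) z"
  proof -
    note sd = speed_leaf_differentiable[OF t z]
    have "grad_leaf (G 0) (s t) z = (\<Sum>a\<in>UNIV. dirder (s t) z (?\<epsilon> a) *\<^sub>R ?\<epsilon> a)"
      using P.leaf_expansion[OF P.leaf_frame_at_leaf_frame P.snd_grad_leaf[OF sd]]
      by (simp add: P.grad_leaf_pairing[OF sd lf])
    then show ?thesis
      by (simp add: normal_conformal.grad_leaf_eq[OF conformal[OF t] z] scaleR_sum_right)
  qed
  ultimately show ?thesis by simp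
qed

end

section \<open>The flow on the manifold\<close>

lemma forward_interval_time_interval:
  assumes "0 < t0"
  shows "forward_interval (time_interval t0)"
  unfolding forward_interval_def
proof (intro conjI ballI)
  show "convex (time_interval t0)"
  proof (rule is_interval_convex, unfold is_interval_1, intro ballI allI impI)
    fix a b x assume "a \<in> time_interval t0" "b \<in> time_interval t0" "a \<le> x \<and> x \<le> b"
    then show "x \<in> time_interval t0"
      unfolding time_interval_def using order.strict_trans1[of "ereal x" "ereal b" t0] by simp
  qed
  show "0 \<in> time_interval t0" using assms by (simp add: time_interval_def zero_ereal_def[symmetric])
  fix t assume t: "t \<in> time_interval t0"
  then obtain r where r: "ereal t < ereal r" "ereal r < t0"
    unfolding time_interval_def using ereal_dense2[of "ereal t" t0] by auto
  show "\<exists>d>0. {t..t + d} \<subseteq> time_interval t0"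
  proof (intro exI conjI subsetI)
    show "0 < r - t" using r by simp
    fix x assume "x \<in> {t..t + (r - t)}"
    then have "0 \<le> x" "ereal x \<le> ereal r" using t by (auto simp: time_interval_def)
    then show "x \<in> time_interval t0"
      using order.strict_trans1[of "ereal x" "ereal r" t0] r(2) by (simp add: time_interval_def)
  qed
qed

lemma
  assumes "smooth_atlas A" "c \<in> A"
  shows chart_open: "open (cdom c)" "open (cimg c)"
    and chart_homeo: "homeomorphism (cdom c) (cimg c) (coords c) (cinv c)"
  using assms unfolding smooth_atlas_def by blast+

lemma
  assumes "smooth_atlas A" "c \<in> A"
  shows coords_cinv: "z \<in> cimg c \<Longrightarrow> coords c (cinv c z) = z"
    and cinv_coords: "x \<in> cdom c \<Longrightarrow> cinv c (coords c x) = x"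
    and cinv_in: "z \<in> cimg c \<Longrightarrow> cinv c z \<in> cdom c"
    and coords_in: "x \<in> cdom c \<Longrightarrow> coords c x \<in> cimg c"
  using chart_homeo[OF assms] unfolding homeomorphism_def by auto

lemma overlap_open:
  assumes "smooth_atlas A" "c \<in> A" "c' \<in> A"
  shows "open (overlap c c')"
proof -
  have "openin (top_of_set (cdom c)) (cdom c \<inter> cdom c')"
    using chart_open(1)[OF assms(1,3)] by (intro openin_open_Int)
  then have "openin (top_of_set (cimg c)) (coords c ` (cdom c \<inter> cdom c'))"
    by (rule homeomorphism_imp_open_map[OF chart_homeo[OF assms(1,2)]])
  then show ?thesis
    unfolding overlap_def using chart_open(2)[OF assms(1,2)] by (rule openin_open_trans)
qed

lemma transition_derivative:
  assumes A: "smooth_atlas A" "c \<in> A" "c' \<in> A" and z: "z \<in> overlap c c'"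
  shows "(transition c c' has_derivative frechet_derivative (transition c c') (at z)) (at z)"
proof -
  have "Ck_on (Suc 0) (overlap c c') (transition c c')"
    using A unfolding smooth_atlas_def smooth_on_def by blast
  from Ck_on_open_differentiable[OF overlap_open[OF A] this z] show ?thesis
    by (simp add: frechet_derivative_works)
qed

lemma transition_derivative_leaf:
  assumes A: "foliated_atlas A" "c \<in> A" "c' \<in> A" and z: "z \<in> overlap c c'" and \<xi>: "snd \<xi> = 0"
  shows "snd (frechet_derivative (transition c c') (at z) \<xi>) = 0"
proof -
  have sm: "smooth_atlas A" using A(1) by (simp add: foliated_atlas_def)
  obtain W \<gamma> where W: "open W" "z \<in> W" "\<forall>w\<in>W. snd (transition c c' w) = \<gamma> (snd w)"
    using A z unfolding foliated_atlas_def by meson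
  have "snd (frechet_derivative (transition c c') (at z) \<xi>) = dirder (\<lambda>w. snd (transition c c' w)) z \<xi>"
    by (rule dirder_eqI[OF has_derivative_snd[OF transition_derivative[OF sm A(2,3) z]], symmetric])
  also have "\<dots> = dirder (\<lambda>w. \<gamma> (snd w)) z \<xi>"
    by (rule dirder_cong[OF W(1,2)]) (use W(3) in blast)
  also have "\<dots> = 0" unfolding dirder_leaf[OF \<xi>] by simp
  finally show ?thesis .
qed

text \<open>Nearby points of a slice lie on a common plaque, hence on the same leaf.\<close>

lemma leafwise_constant_locally:
  assumes A: "smooth_atlas A" "c \<in> A" and f: "leafwise_constant A f" and z: "(x, y) \<in> cimg c"
  shows "\<exists>e>0. \<forall>x'. dist x' x < e \<longrightarrow> f (cinv c (x', y)) = f (cinv c (x, y))"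
proof -
  have "open ((\<lambda>x. (x, y)) -` cimg c)" by (intro open_vimage chart_open(2)[OF A] continuous_intros)
  then obtain e where e: "e > 0" "ball x e \<subseteq> (\<lambda>x. (x, y)) -` cimg c" using z by (meson openE vimageI)
  have "f (cinv c (x', y)) = f (cinv c (x, y))" if "dist x' x < e" for x'
  proof -
    have in_img: "(x', y) \<in> cimg c" using e that by (auto simp: dist_commute)
    have "connected_component (cimg c \<inter> {w. snd w = y}) (x, y) (x', y)"
      unfolding connected_component_def
    proof (intro exI conjI)
      show "connected (ball x e \<times> {y})" by (intro connected_Times connected_ball connected_sing)
      show "ball x e \<times> {y} \<subseteq> cimg c \<inter> {w. snd w = y}" using e(2) by auto
      show "(x, y) \<in> ball x e \<times> {y}" "(x', y) \<in> ball x e \<times> {y}" using e that by (auto simp: dist_commute)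
    qed
    then have "same_plaque A (cinv c (x, y)) (cinv c (x', y))"
      unfolding same_plaque_def using A cinv_in[OF A z] cinv_in[OF A in_img]
      by (intro bexI[of _ c]) (auto simp: coords_cinv[OF A z] coords_cinv[OF A in_img])
    then have "cinv c (x', y) \<in> leaf A (cinv c (x, y))" by (auto simp: leaf_def)
    then show ?thesis using f unfolding leafwise_constant_def by blast
  qed
  with e(1) show ?thesis by blast
qed

locale mixed_scalar_flow =
  fixes A :: "('a::{t2_space, second_countable_topology}, 'p::finite, 'n::finite) chart set"
    and g :: "real \<Rightarrow> ('a, 'p, 'n) metric"
    and \<Phi> :: "'a \<Rightarrow> real"
    and t0 :: ereal
  assumes manifold: "closed_foliated_manifold A"
    and initial: "\<forall>k. riemannian_metric k A (g 0)"
    and harmonic_initial: "harmonic A (g 0)"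
    and \<Phi>_const: "leafwise_constant A \<Phi>"
    and t0_pos: "0 < t0"
    and solution: "Sc_mix_flow A (time_interval t0) \<Phi> g"
begin

abbreviation J :: "real set" where "J \<equiv> time_interval t0"

abbreviation speed :: "('a, 'p, 'n) chart \<Rightarrow> real \<Rightarrow> ('p, 'n) pt \<Rightarrow> real" where
  "speed c t z \<equiv> Sc_mix (g t c) z - \<Phi> (cinv c z)"

abbreviation fac :: "('a, 'p, 'n) chart \<Rightarrow> real \<Rightarrow> ('p, 'n) pt \<Rightarrow> real" where
  "fac c \<equiv> chart_flow.factor (\<lambda>t. g t c)"

lemma foliated: "foliated_atlas A" and atlas: "smooth_atlas A"
  using manifold by (simp_all add: closed_foliated_manifold_def foliated_atlas_def)

lemma metric_at: "t \<in> J \<Longrightarrow> riemannian_metric 2 A (g t)"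
  using solution by (simp add: Sc_mix_flow_def)

lemma flow_in_chart:
  assumes c: "c \<in> A"
  shows "chart_flow J (cimg c) (\<lambda>t. g t c) (speed c)"
proof
  show "forward_interval J" by (rule forward_interval_time_interval[OF t0_pos])
  show "open (cimg c)" by (rule chart_open(2)[OF atlas c])
  show "posdef_form (g t c z)" if "t \<in> J" "z \<in> cimg c" for t z
    using metric_at[OF that(1)] c that(2) unfolding riemannian_metric_def posdef_form_def by blast
  show "Ck_on 2 (cimg c) (\<lambda>z. g t c z v w)" if "t \<in> J" for t v w
    using metric_at[OF that] c unfolding riemannian_metric_def by blast
  show "Ck_on k (cimg c) (\<lambda>z. g 0 c z v w)" for k v w
    using initial c unfolding riemannian_metric_def by blast
  show "Ck_on k (J \<times> {x. (x, y) \<in> cimg c}) (\<lambda>(t, x). g t c (x, y) v w)" for k y v w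
    using solution c unfolding Sc_mix_flow_def leaf_smooth_metrics_def smooth_on_def by blast
  show "((\<lambda>r. g r c z v w) has_real_derivative - 2 * speed c t z * truncated (g t c) z v w) (at t within J)"
    if "t \<in> J" "z \<in> cimg c" for t z v w
    using solution c that unfolding Sc_mix_flow_def by blast
qed

lemma zero_J: "0 \<in> J"
  using forward_interval_time_interval[OF t0_pos] by (simp add: forward_interval_def)

text \<open>Harmonicity is preserved by the flow.\<close>

lemma harmonic_at:
  assumes "t \<in> J" "c \<in> A" "z \<in> cimg c"
  shows "leaf_mean_curv (g t c) z = 0"
  by (rule normal_conformal.leaf_mean_curv_zero[OF chart_flow.conformal[OF flow_in_chart[OF assms(2)] assms(1)] assms(3)])
    (use harmonic_initial assms in \<open>auto simp: harmonic_def\<close>)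

lemma \<Phi>_leaf:
  assumes c: "c \<in> A" and z: "z \<in> cimg c"
  shows "leaf_differentiable (\<lambda>w. \<Phi> (cinv c w)) z" and "snd \<xi> = 0 \<Longrightarrow> dirder (\<lambda>w. \<Phi> (cinv c w)) z \<xi> = 0"
proof -
  obtain e where e: "e > 0" "\<forall>x'. dist x' (fst z) < e \<longrightarrow> \<Phi> (cinv c (x', snd z)) = \<Phi> (cinv c (fst z, snd z))"
    using leafwise_constant_locally[OF atlas c \<Phi>_const, of "fst z" "snd z"] z by auto
  have d: "((\<lambda>x. \<Phi> (cinv c (x, snd z))) has_derivative (\<lambda>_. 0)) (at (fst z))"
    by (rule has_derivative_transform_within[OF has_derivative_const[of "\<Phi> (cinv c (fst z, snd z))"] e(1)])
      (use e(2) in auto)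
  then show "leaf_differentiable (\<lambda>w. \<Phi> (cinv c w)) z"
    unfolding leaf_differentiable_def differentiable_def by blast
  show "dirder (\<lambda>w. \<Phi> (cinv c w)) z \<xi> = 0" if "snd \<xi> = 0"
    by (rule dirder_leaf_eqI[OF d that])
qed

lemma Sc_mix_leaf:
  assumes "t \<in> J" "c \<in> A" "z \<in> cimg c"
  shows "leaf_differentiable (Sc_mix (g t c)) z"
    and "grad_leaf (g t c) (speed c t) z = grad_leaf (g t c) (Sc_mix (g t c)) z"
proof -
  note s = chart_flow.speed_leaf_differentiable[OF flow_in_chart[OF assms(2)] assms(1,3)]
  note p = \<Phi>_leaf[OF assms(2,3)]
  show Sc: "leaf_differentiable (Sc_mix (g t c)) z"
    using leaf_differentiable_add(1)[OF s p(1)] by simp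
  have "dirder (speed c t) z v = dirder (Sc_mix (g t c)) z v" if "snd v = 0" for v
    using leaf_differentiable_diff(2)[OF Sc p(1) that] p(2)[OF that] by simp
  then show "grad_leaf (g t c) (speed c t) z = grad_leaf (g t c) (Sc_mix (g t c)) z"
    unfolding grad_leaf_def by (intro arg_cong[where f = The]) (auto simp: fun_eq_iff)
qed

lemma mean_curv_evolution:
  assumes "t \<in> J" "c \<in> A" "z \<in> cimg c"
  defines "n \<equiv> real CARD('n)"
  shows "\<exists>H'. ((\<lambda>s. mean_curv (g s c) z) has_vector_derivative H') (at t within J) \<and>
        H' + grad_leaf (g t c) (\<lambda>w. sqnorm (g t c) w (mean_curv (g t c) w)) z =
          n *\<^sub>R grad_leaf (g t c) (div_leaf (g t c) (mean_curv (g t c))) z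
          + n *\<^sub>R grad_leaf (g t c) (\<lambda>w. integrability_norm2 (g t c) w
                - leaf_sff_norm2 (g t c) w - n * beta_D (g t c) w) z"
proof (intro exI conjI)
  interpret chart_flow J "cimg c" "\<lambda>t. g t c" "speed c" by (rule flow_in_chart[OF assms(2)])
  interpret chart_metric "cimg c" "g t c" by (rule metrics[OF assms(1)])
  show "((\<lambda>s. mean_curv (g s c) z) has_vector_derivative n *\<^sub>R grad_leaf (g t c) (Sc_mix (g t c)) z) (at t within J)"
    using mean_curv_flow[OF assms(1,3)] unfolding Sc_mix_leaf(2)[OF assms(1-3)] n_def .
  show "n *\<^sub>R grad_leaf (g t c) (Sc_mix (g t c)) z + grad_leaf (g t c) (\<lambda>w. sqnorm (g t c) w (mean_curv (g t c) w)) z =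
     n *\<^sub>R grad_leaf (g t c) (div_leaf (g t c) (mean_curv (g t c))) z
     + n *\<^sub>R grad_leaf (g t c) (\<lambda>w. integrability_norm2 (g t c) w - leaf_sff_norm2 (g t c) w - n * beta_D (g t c) w) z"
    unfolding n_def
    by (rule grad_leaf_Sc_mix[OF harmonic_at[OF assms(1,2)] assms(3) Sc_mix_leaf(1)[OF assms(1-3)]])
qed

text \<open>The derivative \<open>D\<close> of a transition map is an isometry for all metrics of the family, and it maps leaf
  directions onto leaf directions.  So it maps normal vectors to normal vectors, and the factor in
  both charts is the quotient of the squared lengths of one and the same normal vector.\<close>

lemma factor_chart_independent:
  assumes t: "t \<in> J" and c: "c \<in> A" "c' \<in> A" and x: "x \<in> cdom c" "x \<in> cdom c'"
  shows "fac c t (coords c x) = fac c' t (coords c' x)"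
proof -
  let ?z = "coords c x" and ?z' = "coords c' x"
  interpret F: chart_flow J "cimg c" "\<lambda>t. g t c" "speed c" by (rule flow_in_chart[OF c(1)])
  interpret F': chart_flow J "cimg c'" "\<lambda>t. g t c'" "speed c'" by (rule flow_in_chart[OF c(2)])
  have z: "?z \<in> cimg c" and z': "?z' \<in> cimg c'"
    by (auto intro: coords_in[OF atlas c(1) x(1)] coords_in[OF atlas c(2) x(2)])
  have ov: "?z \<in> overlap c c'" using x by (auto simp: overlap_def)
  have tr: "transition c c' ?z = ?z'" by (simp add: transition_def cinv_coords[OF atlas c(1) x(1)])
  define D where "D = frechet_derivative (transition c c') (at ?z)"
  have lin: "linear D"
    unfolding D_def using transition_derivative[OF atlas c ov] has_derivative_linear by blast
  have change: "g t c ?z v w = g t c' ?z' (D v) (D w)" if "t \<in> J" for t v w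
    using metric_at[OF that] c ov unfolding riemannian_metric_def Let_def D_def by (metis tr)
  interpret P: pos_form "g 0 c" ?z by (rule F.pos[OF zero_J z])
  interpret P': pos_form "g 0 c'" ?z' by (rule F'.pos[OF zero_J z'])
  have leaf: "snd (D \<xi>) = 0" if "snd \<xi> = 0" for \<xi>
    unfolding D_def by (rule transition_derivative_leaf[OF foliated c ov that])
  have onto: "\<exists>\<xi>. snd \<xi> = 0 \<and> D \<xi> = \<xi>'" if \<xi>': "snd \<xi>' = 0" for \<xi>'
  proof -
    let ?f = "\<lambda>x. fst (D (x, 0))"
    have lf: "linear ?f"
      using linear_compose[OF linear_compose[OF linear_inl lin] linear_fst] by (simp add: o_def)
    have "inj ?f"
      unfolding linear_injective_0[OF lf]
    proof (intro allI impI)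
      fix x assume "fst (D (x, 0)) = 0"
      then have "D (x, 0) = 0" using leaf[of "(x, 0)"] by (simp add: prod_eq_iff)
      then have "g 0 c ?z (x, 0) (x, 0) = 0"
        using change[OF zero_J, of "(x, 0)" "(x, 0)"] by (simp add: bilinear_lzero[OF P'.bil])
      then have "(x, 0) = (0 :: ('p, 'n) pt)" using P.pos by fastforce
      then show "x = 0" by (simp add: prod_eq_iff)
    qed
    then have "surj ?f" by (rule linear_injective_imp_surjective[OF lf]) simp
    from surjD[OF this, of "fst \<xi>'"] obtain x where "fst (D (x, 0)) = fst \<xi>'" by (elim exE) simp
    then have "D (x, 0) = \<xi>'" using leaf[of "(x, 0)"] \<xi>' by (simp add: prod_eq_iff)
    then show ?thesis by (intro exI[of _ "(x, 0)"]) simp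
  qed
  \<comment> \<open>Any nonzero normal vector would do.\<close>
  define e where "e = proj_normal (g 0 c) ?z (0, 1)"
  have e: "e \<in> normal_dirs (g 0 c) ?z" unfolding e_def by (rule P.proj_normal_in)
  have "snd e \<noteq> 0" by (simp add: e_def vec_eq_iff)
  then have "e \<noteq> 0" by auto
  have De: "D e \<in> normal_dirs (g 0 c') ?z'"
    unfolding normal_dirs_def
  proof (intro CollectI ballI)
    fix \<xi>' assume "\<xi>' \<in> (leaf_dirs :: ('p, 'n) pt set)"
    then have "snd \<xi>' = 0" by simp
    from onto[OF this] obtain \<xi> where "snd \<xi> = 0" "D \<xi> = \<xi>'" by blast
    then show "g 0 c' ?z' \<xi>' (D e) = 0"
      using change[OF zero_J, of \<xi> e] P.normal_orth(2)[OF e] by simp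
  qed
  have "g t c ?z e e = fac c t ?z * g 0 c ?z e e"
  proof -
    interpret N: normal_conformal "cimg c" "g 0 c" "g t c" "fac c t" by (rule F.conformal[OF t])
    interpret Pt: pos_form "g t c" ?z by (rule F.pos[OF t z])
    show ?thesis
      using N.truncated_eq[OF z, of e e] e by (simp add: P.truncated_normal Pt.truncated_normal N.normal_dirs_eq[OF z])
  qed
  moreover have "g t c' ?z' (D e) (D e) = fac c' t ?z' * g 0 c' ?z' (D e) (D e)"
  proof -
    interpret N: normal_conformal "cimg c'" "g 0 c'" "g t c'" "fac c' t" by (rule F'.conformal[OF t])
    interpret Pt: pos_form "g t c'" ?z' by (rule F'.pos[OF t z'])
    show ?thesis
      using N.truncated_eq[OF z', of "D e" "D e"] De by (simp add: P'.truncated_normal Pt.truncated_normal N.normal_dirs_eq[OF z'])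
  qed
  ultimately have "fac c t ?z * g 0 c ?z e e = fac c' t ?z' * g 0 c ?z e e"
    unfolding change[OF t, of e e, symmetric] change[OF zero_J, of e e, symmetric] by linarith
  then show ?thesis using P.pos[OF \<open>e \<noteq> 0\<close>] by simp
qed

text \<open>The normal metric at the time \<open>t\<close> is \<open>factor_at t\<close> times the initial one.\<close>

definition factor_at :: "real \<Rightarrow> 'a \<Rightarrow> real" where
  "factor_at t x = (let c = (SOME c. c \<in> A \<and> x \<in> cdom c) in fac c t (coords c x))"

lemma factor_at_chart:
  assumes t: "t \<in> J" and c: "c \<in> A" and z: "z \<in> cimg c"
  shows "factor_at t (cinv c z) = fac c t z"
proof -
  let ?x = "cinv c z"
  have x: "?x \<in> cdom c" by (rule cinv_in[OF atlas c z])
  let ?c = "SOME c. c \<in> A \<and> ?x \<in> cdom c"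
  have "?c \<in> A \<and> ?x \<in> cdom ?c" by (rule someI[of _ c]) (use c x in simp)
  then have "fac ?c t (coords ?c ?x) = fac c t (coords c ?x)"
    using factor_chart_independent[OF t _ c _ x] by blast
  then show ?thesis by (simp add: factor_at_def Let_def coords_cinv[OF atlas c z])
qed

lemma point_in_chart: "\<exists>c\<in>A. \<exists>z\<in>cimg c. x = cinv c z"
proof -
  obtain c where c: "c \<in> A" "x \<in> cdom c" using atlas unfolding smooth_atlas_def by blast
  then show ?thesis using cinv_coords[OF atlas c] coords_in[OF atlas c] by metis
qed

text \<open>The potential of \<open>H\<^sub>t\<close>, namely \<open>u\<^sub>0\<close> times the conformal factor of lengths.  The last factor is
  constant on the leaves and thus invisible to the gradient of the logarithm; with \<open>\<kappa> = 1\<close> it removes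
  \<open>\<Phi>\<close> from the evolution of the potential, with \<open>\<kappa> = 0\<close> it is absent.\<close>

definition potential :: "real \<Rightarrow> ('a \<Rightarrow> real) \<Rightarrow> real \<Rightarrow> 'a \<Rightarrow> real" where
  "potential \<kappa> u0 t x = u0 x * sqrt (factor_at t x) * exp (- \<kappa> * \<Phi> x * t)"

lemma potential_chart:
  assumes "t \<in> J" "c \<in> A" "z \<in> cimg c"
  shows "potential \<kappa> u0 t (cinv c z) = u0 (cinv c z) * sqrt (fac c t z) * exp (- \<kappa> * \<Phi> (cinv c z) * t)"
  by (simp add: potential_def factor_at_chart[OF assms])

lemma potential_zero: "potential \<kappa> u0 0 = u0"
proof
  fix x
  obtain c z where c: "c \<in> A" "z \<in> cimg c" "x = cinv c z" using point_in_chart by blast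
  show "potential \<kappa> u0 0 x = u0 x"
    unfolding c(3) potential_chart[OF zero_J c(1,2)]
    by (simp add: chart_flow.factor_zero[OF flow_in_chart[OF c(1)] c(2)])
qed

lemma potential_smooth:
  assumes u0: "leaf_smooth A u0"
  shows "leaf_smooth_family A J (potential \<kappa> u0)"
  unfolding leaf_smooth_family_def smooth_on_def
proof (intro ballI allI)
  fix c y k assume c: "c \<in> A"
  interpret chart_flow J "cimg c" "\<lambda>t. g t c" "speed c" by (rule flow_in_chart[OF c])
  let ?S = "J \<times> {x. (x, y) \<in> cimg c}"
  note ud = unique_derivs_slice[of y]
  have slice: "Ck_on k ?S (\<lambda>q. f (snd q))" if "Ck_on k {x. (x, y) \<in> cimg c} f" for f :: "real^'p \<Rightarrow> real"
    using Ck_on_compose_affine[OF ud bounded_linear_snd _ that, where c = 0] by auto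
  have "Ck_on k {x. (x, y) \<in> cimg c} (\<lambda>x. u0 (cinv c (x, y)))"
    using u0 c unfolding leaf_smooth_def smooth_on_def by blast
  note 1 = slice[OF this]
  have "Ck_on k {x. (x, y) \<in> cimg c} (\<lambda>x. \<Phi> (cinv c (x, y)))"
    by (rule Ck_on_locally_constant[OF unique_derivs_open[OF slice_open]])
      (use leafwise_constant_locally[OF atlas c \<Phi>_const] in blast)
  note 2 = slice[OF this]
  show "Ck_on k ?S (\<lambda>(t, x). potential \<kappa> u0 t (cinv c (x, y)))"
  proof -
    have "Ck_on k ?S (\<lambda>q. u0 (cinv c (snd q, y)) * sqrt (case q of (t, x) \<Rightarrow> fac c t (x, y))
        * exp (- \<kappa> * \<Phi> (cinv c (snd q, y)) * fst q))"
      by (intro Ck_on_mult Ck_on_sqrt Ck_on_exp Ck_on_const Ck_on_linear_map bounded_linear_fst ud 1 2 smooth_factor)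
        (auto intro: factor_pos)
    moreover have "potential \<kappa> u0 t (cinv c (x, y)) = u0 (cinv c (x, y)) * sqrt (fac c t (x, y)) * exp (- \<kappa> * \<Phi> (cinv c (x, y)) * t)"
      if "t \<in> J" "(x, y) \<in> cimg c" for t x
      by (rule potential_chart[OF that(1) c that(2)])
    ultimately show ?thesis by (subst Ck_on_cong) auto
  qed
qed

lemma potential_flow:
  assumes t: "t \<in> J" and c: "c \<in> A" and z: "z \<in> cimg c"
  shows "((\<lambda>r. potential \<kappa> u0 r (cinv c z)) has_real_derivative
     - (speed c t z + \<kappa> * \<Phi> (cinv c z)) * potential \<kappa> u0 t (cinv c z)) (at t within J)"
proof -
  interpret chart_flow J "cimg c" "\<lambda>t. g t c" "speed c" by (rule flow_in_chart[OF c])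
  let ?\<phi> = "\<Phi> (cinv c z)" and ?f = "fac c t z"
  have f: "?f > 0" by (rule factor_pos[OF t z])
  have "((\<lambda>r. sqrt (fac c r z)) has_real_derivative (inverse (sqrt ?f) / 2) * (- 2 * speed c t z * ?f)) (at t within J)"
    by (rule DERIV_chain2[OF DERIV_real_sqrt[OF f] factor_flow[OF t z]])
  then have sq: "((\<lambda>r. sqrt (fac c r z)) has_real_derivative - speed c t z * sqrt ?f) (at t within J)"
    by (rule DERIV_cong) (use f in \<open>simp add: field_simps\<close>)
  have ex: "((\<lambda>r. exp (- \<kappa> * ?\<phi> * r)) has_real_derivative exp (- \<kappa> * ?\<phi> * t) * (- \<kappa> * ?\<phi>)) (at t within J)"
    by (auto intro!: derivative_eq_intros)
  have "((\<lambda>r. u0 (cinv c z) * sqrt (fac c r z) * exp (- \<kappa> * ?\<phi> * r)) has_real_derivative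
     - (speed c t z + \<kappa> * ?\<phi>) * (u0 (cinv c z) * sqrt ?f * exp (- \<kappa> * ?\<phi> * t))) (at t within J)"
    by (rule DERIV_cong[OF DERIV_mult[OF DERIV_cmult[OF sq] ex]]) (simp add: algebra_simps)
  then show ?thesis
    unfolding potential_chart[OF t c z] has_field_derivative_def
    by (rule has_derivative_transform[OF t, rotated]) (simp add: potential_chart[OF _ c z])
qed

lemma potential_pos:
  assumes "t \<in> J" "\<forall>x. u0 x > 0"
  shows "potential \<kappa> u0 t x > 0"
proof -
  obtain c z where c: "c \<in> A" "z \<in> cimg c" "x = cinv c z" using point_in_chart by blast
  show ?thesis
    unfolding c(3) potential_chart[OF assms(1) c(1,2)]
    using assms(2) chart_flow.factor_pos[OF flow_in_chart[OF c(1)] assms(1) c(2)] by simp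
qed

lemma leaf_smooth_leaf_differentiable:
  assumes u: "leaf_smooth A u" and c: "c \<in> A" and z: "z \<in> cimg c"
  shows "leaf_differentiable (\<lambda>w. u (cinv c w)) z"
proof -
  interpret chart_flow J "cimg c" "\<lambda>t. g t c" "speed c" by (rule flow_in_chart[OF c])
  have "Ck_on (Suc 0) {x. (x, snd z) \<in> cimg c} (\<lambda>x. u (cinv c (x, snd z)))"
    using u c unfolding leaf_smooth_def smooth_on_def by blast
  from Ck_on_open_differentiable[OF slice_open this, of "fst z"] z
  show ?thesis by (simp add: leaf_differentiable_def)
qed

lemma potential_leaf:
  assumes u0: "leaf_smooth A u0" "\<forall>x. u0 x > 0" and t: "t \<in> J" and c: "c \<in> A" and z: "z \<in> cimg c"
  shows "leaf_differentiable (\<lambda>w. potential \<kappa> u0 t (cinv c w)) z"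
    and "snd \<xi> = 0 \<Longrightarrow> dirder (\<lambda>w. ln (potential \<kappa> u0 t (cinv c w))) z \<xi> =
      dirder (\<lambda>w. ln (u0 (cinv c w))) z \<xi> + (1/2) * (dirder (fac c t) z \<xi> / fac c t z)"
proof -
  interpret chart_flow J "cimg c" "\<lambda>t. g t c" "speed c" by (rule flow_in_chart[OF c])
  let ?L = "\<lambda>w. ln (u0 (cinv c w)) + ((1/2) * ln (fac c t w) + (- \<kappa> * t) * \<Phi> (cinv c w))"
  have f: "fac c t w > 0" if "w \<in> cimg c" for w by (rule factor_pos[OF t that])
  have u0d: "leaf_differentiable (\<lambda>w. u0 (cinv c w)) z" by (rule leaf_smooth_leaf_differentiable[OF u0(1) c z])
  have u0p: "u0 (cinv c z) > 0" using u0(2) by simp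
  have fd: "leaf_differentiable (fac c t) z"
    by (rule differentiable_imp_leaf_differentiable[OF factor_differentiable[OF t z]])
  note l1 = leaf_differentiable_ln[where f = "\<lambda>w. u0 (cinv c w)", OF u0d u0p]
  note l2 = leaf_differentiable_ln[OF fd f[OF z]]
  note l2' = leaf_differentiable_cmult[OF l2(1), where c = "1/2"]
  note l3 = leaf_differentiable_cmult[OF \<Phi>_leaf(1)[OF c z], where c = "- \<kappa> * t"]
  note l23 = leaf_differentiable_add[OF l2'(1) l3(1)]
  note L = leaf_differentiable_add[OF l1(1) l23(1)]
  have eq: "ln (potential \<kappa> u0 t (cinv c w)) = ?L w" if w: "w \<in> cimg c" for w
  proof -
    have "u0 (cinv c w) \<noteq> 0" using u0(2) by (metis less_irrefl)
    then show ?thesis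
      unfolding potential_chart[OF t c w] using f[OF w] by (simp add: ln_mult ln_sqrt)
  qed
  show "leaf_differentiable (\<lambda>w. potential \<kappa> u0 t (cinv c w)) z"
  proof -
    have "(\<lambda>x. exp (?L (x, snd z))) differentiable (at (fst z))"
      using has_derivative_exp[OF leaf_differentiable_has_derivative[OF L(1)]] unfolding differentiable_def by blast
    then have "leaf_differentiable (\<lambda>w. exp (?L w)) z" by (simp add: leaf_differentiable_def)
    moreover have "exp (?L w) = potential \<kappa> u0 t (cinv c w)" if "w \<in> cimg c" for w
      unfolding eq[OF that, symmetric] by (rule exp_ln[OF potential_pos[OF t u0(2)]])
    ultimately show ?thesis by (rule leaf_differentiable_cong[OF open_U z, rotated])
  qed
  assume \<xi>: "snd \<xi> = 0"
  have "dirder (\<lambda>w. ln (potential \<kappa> u0 t (cinv c w))) z \<xi> = dirder ?L z \<xi>"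
    by (rule dirder_cong[OF open_U z eq])
  also have "\<dots> = dirder (\<lambda>w. ln (u0 (cinv c w))) z \<xi> + (1/2) * (dirder (fac c t) z \<xi> / fac c t z)"
    unfolding L(2)[OF \<xi>] l23(2)[OF \<xi>] l2'(2)[OF \<xi>] l2(2)[OF \<xi>] l3(2)[OF \<xi>] \<Phi>_leaf(2)[OF c z \<xi>] by simp
  finally show "dirder (\<lambda>w. ln (potential \<kappa> u0 t (cinv c w))) z \<xi> =
      dirder (\<lambda>w. ln (u0 (cinv c w))) z \<xi> + (1/2) * (dirder (fac c t) z \<xi> / fac c t z)" .
qed

lemma potential_log_potential:
  assumes u0: "leaf_smooth A u0" "log_potential A (g 0) u0" and t: "t \<in> J"
  shows "log_potential A (g t) (potential \<kappa> u0 t)"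
  unfolding log_potential_def
proof (intro conjI allI ballI)
  have u0_pos: "\<forall>x. u0 x > 0" using u0(2) by (simp add: log_potential_def)
  show "potential \<kappa> u0 t x > 0" for x by (rule potential_pos[OF t u0_pos])
  fix c z assume c: "c \<in> A" and z: "z \<in> cimg c"
  interpret chart_flow J "cimg c" "\<lambda>t. g t c" "speed c" by (rule flow_in_chart[OF c])
  interpret N: normal_conformal "cimg c" "g 0 c" "g t c" "fac c t" by (rule conformal[OF t])
  interpret P: pos_form "g 0 c" z by (rule pos[OF zero_J z])
  let ?n = "real CARD('n)" and ?u = "\<lambda>w. ln (potential \<kappa> u0 t (cinv c w))"
  have ud: "leaf_differentiable ?u z"
    by (rule leaf_differentiable_ln(1)[OF potential_leaf(1)[OF u0(1) u0_pos t c z] potential_pos[OF t u0_pos]])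
  have u0d: "leaf_differentiable (\<lambda>w. ln (u0 (cinv c w))) z"
    by (rule leaf_differentiable_ln(1)[OF leaf_smooth_leaf_differentiable[OF u0(1) c z]]) (use u0_pos in simp)
  have H0: "mean_curv (g 0 c) z = - ?n *\<^sub>R grad_leaf (g 0 c) (\<lambda>w. ln (u0 (cinv c w))) z"
    using u0(2) c z by (simp add: log_potential_def)
  have "mean_curv (g t c) z = - ?n *\<^sub>R grad_leaf (g 0 c) ?u z"
  proof (rule P.leaf_vector_eqI)
    show "snd (mean_curv (g t c) z) = 0" by (rule N.G'.snd_mean_curv[OF z])
    show "snd (- ?n *\<^sub>R grad_leaf (g 0 c) ?u z) = 0" by (simp add: P.snd_grad_leaf[OF ud])
    fix \<xi> :: "('p, 'n) pt" assume \<xi>: "snd \<xi> = 0"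
    show "g 0 c z (mean_curv (g t c) z) \<xi> = g 0 c z (- ?n *\<^sub>R grad_leaf (g 0 c) ?u z) \<xi>"
      by (simp add: N.mean_curv_change[OF z \<xi>] H0 bilinear_lmul[OF P.bil] bilinear_lneg[OF P.bil]
          P.grad_leaf_pairing[OF ud \<xi>] P.grad_leaf_pairing[OF u0d \<xi>]
          potential_leaf(2)[OF u0(1) u0_pos t c z \<xi>] algebra_simps)
  qed
  then show "mean_curv (g t c) z = - ?n *\<^sub>R grad_leaf (g t c) ?u z"
    by (simp add: N.grad_leaf_eq[OF z])
qed

text \<open>The left-hand side is the time derivative of the potential divided by \<open>n\<close>.  Inserting the formula for the mixed
  scalar curvature, the divergence of \<open>H\<close> and one part of the norm of \<open>h\<close> form the Laplacian of \<open>u\<close>, and the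
  remaining part of the norm of \<open>h\<close> is \<open>n \<beta>\<close>.\<close>

lemma potential_heat_equation:
  fixes \<kappa> :: real
  assumes u0: "leaf_smooth A u0" "log_potential A (g 0) u0" and t: "t \<in> J" and c: "c \<in> A" and z: "z \<in> cimg c"
  defines "n \<equiv> real CARD('n)" and "u \<equiv> \<lambda>w. potential \<kappa> u0 t (cinv c w)"
  shows "- (1 / n) * (speed c t z + \<kappa> * \<Phi> (cinv c z)) * u z =
     laplace_leaf (g t c) u z + (beta_D (g t c) z + (1 - \<kappa>) * \<Phi> (cinv c z) / n) * u z
     + leaf_sff_norm2 (g t c) z / n * u z - integrability_norm2 (g t c) z / n * u z"
proof -
  have u0_pos: "\<forall>x. u0 x > 0" using u0(2) by (simp add: log_potential_def)
  interpret chart_flow J "cimg c" "\<lambda>t. g t c" "speed c" by (rule flow_in_chart[OF c])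
  interpret chart_metric "cimg c" "g t c" by (rule metrics[OF t])
  have n: "n > 0" by (simp add: n_def)
  have lap: "laplace_leaf (g t c) u z = - (u z / n) * div_leaf (g t c) (mean_curv (g t c)) z
      + u z / n\<^sup>2 * sqnorm (g t c) z (mean_curv (g t c) z)"
    unfolding n_def u_def
    by (rule laplace_leaf_potential[OF potential_leaf(1)[OF u0(1) u0_pos t c] potential_pos[OF t u0_pos]
          potential_log_potential[OF u0 t, unfolded log_potential_def, THEN conjunct2, rule_format, OF c] z])
  have Sc: "Sc_mix (g t c) z = div_leaf (g t c) (mean_curv (g t c)) z - normal_sff_norm2 (g t c) z
      + integrability_norm2 (g t c) z - leaf_sff_norm2 (g t c) z"
    by (rule Sc_mix_harmonic[OF harmonic_at[OF t c] z])
  have h: "normal_sff_norm2 (g t c) z = n * beta_D (g t c) z + sqnorm (g t c) z (mean_curv (g t c) z) / n"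
    using beta_D_eq[of z] by (simp add: n_def)
  show ?thesis
    unfolding lap Sc h using n by (simp add: field_simps power2_eq_square)
qed

lemma
  assumes t: "t \<in> J" and c: "c \<in> A" and z: "z \<in> cimg c"
  shows leaf_sff_norm2_flow: "leaf_sff_norm2 (g t c) z = leaf_sff_norm2 (g 0 c) z / fac c t z"
    and integrability_norm2_flow: "integrability_norm2 (g t c) z = integrability_norm2 (g 0 c) z / (fac c t z)\<^sup>2"
proof -
  interpret chart_flow J "cimg c" "\<lambda>t. g t c" "speed c" by (rule flow_in_chart[OF c])
  interpret N: normal_conformal "cimg c" "g 0 c" "g t c" "fac c t" by (rule conformal[OF t])
  show "leaf_sff_norm2 (g t c) z = leaf_sff_norm2 (g 0 c) z / fac c t z"
    by (rule N.leaf_sff_norm2_scaled[OF z])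
  show "integrability_norm2 (g t c) z = integrability_norm2 (g 0 c) z / (fac c t z)\<^sup>2"
    by (rule N.integrability_norm2_scaled[OF z])
qed

lemma integrability_norm2_nonneg: "t \<in> J \<Longrightarrow> c \<in> A \<Longrightarrow> z \<in> cimg c \<Longrightarrow> integrability_norm2 (g t c) z \<ge> 0"
proof -
  assume *: "t \<in> J" "c \<in> A" "z \<in> cimg c"
  interpret P: pos_form "g t c" z by (rule chart_flow.pos[OF flow_in_chart[OF *(2)] *(1,3)])
  have "sqnorm (g t c) z v \<ge> 0" for v
    using P.pos[of v] by (cases "v = 0") (auto simp: sqnorm_def bilinear_lzero[OF P.bil] less_imp_le)
  then show ?thesis by (simp add: integrability_norm2_def sum_nonneg)
qed

end

context mixed_scalar_flow
begin

text \<open>Since \<open>u\<^sup>2 = u\<^sub>0\<^sup>2 \<rho>\<close>, the scaling of the two norms says that \<open>u\<^sup>2 \<parallel>h\<^sub>F\<parallel>\<^sup>2\<close> and \<open>u\<^sup>4 \<parallel>T\<parallel>\<^sup>2\<close> keep their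
  initial values \<open>\<Psi>\<^sub>1\<close> and \<open>\<Psi>\<^sub>2\<close>.\<close>

lemma potential_nonlinear_terms:
  assumes u0: "\<forall>x. u0 x > 0" and t: "t \<in> J" and c: "c \<in> A" and z: "z \<in> cimg c"
  defines "u \<equiv> potential 0 u0 t (cinv c z)"
  shows "leaf_sff_norm2 (g t c) z * u = Psi1 (g 0) u0 c z * inverse u"
    and "integrability_norm2 (g t c) z * u = Psi2 (g 0) u0 c z * inverse u ^ 3"
proof -
  let ?v = "u0 (cinv c z)" and ?f = "fac c t z"
  have f: "?f > 0" by (rule chart_flow.factor_pos[OF flow_in_chart[OF c] t z])
  have v: "?v > 0" using u0 by simp
  have u: "u = ?v * sqrt ?f" by (simp add: u_def potential_chart[OF t c z])
  then have u2: "u\<^sup>2 = ?v\<^sup>2 * ?f" using f by (simp add: power_mult_distrib)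
  have u4: "u ^ 4 = ?v ^ 4 * ?f\<^sup>2"
    using arg_cong[OF u2, of "\<lambda>x. x\<^sup>2"] by (simp add: power_mult_distrib flip: power_mult)
  have pos: "u > 0" using u v f by simp
  have "leaf_sff_norm2 (g t c) z * u\<^sup>2 = Psi1 (g 0) u0 c z"
    unfolding u2 leaf_sff_norm2_flow[OF t c z] Psi1_def using f by simp
  then show "leaf_sff_norm2 (g t c) z * u = Psi1 (g 0) u0 c z * inverse u"
    using pos by (simp add: field_simps power2_eq_square)
  have "integrability_norm2 (g t c) z * u ^ 4 = Psi2 (g 0) u0 c z"
    unfolding u4 integrability_norm2_flow[OF t c z] Psi2_def using f by simp
  then have "Psi2 (g 0) u0 c z * inverse u ^ 3 = integrability_norm2 (g t c) z * (u ^ 4 * inverse u ^ 3)" by simp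
  also have "u ^ 4 * inverse u ^ 3 = u" using pos by (simp add: field_simps power_eq_if)
  finally show "integrability_norm2 (g t c) z * u = Psi2 (g 0) u0 c z * inverse u ^ 3" by simp
qed

lemma potential_by_integrability:
  assumes u0: "\<forall>x. u0 x > 0" and t: "t \<in> J" and c: "c \<in> A" and z: "z \<in> cimg c"
    and nz: "Psi2 (g 0) u0 c z \<noteq> 0"
  shows "potential 0 u0 t (cinv c z) =
    Psi2 (g 0) u0 c z powr (1/4) * sqrt (integrability_norm2 (g t c) z) powr (- 1/2)"
proof -
  let ?u = "potential 0 u0 t (cinv c z)" and ?T = "integrability_norm2 (g t c) z"
  have u: "?u > 0" by (rule potential_pos[OF t u0])
  have P: "Psi2 (g 0) u0 c z = ?T * ?u ^ 4"
  proof -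
    have "Psi2 (g 0) u0 c z = Psi2 (g 0) u0 c z * inverse ?u ^ 3 * ?u ^ 3"
      using u by (simp add: power_inverse)
    also have "\<dots> = ?T * ?u * ?u ^ 3" by (simp only: potential_nonlinear_terms(2)[OF u0 t c z])
    finally show ?thesis by (simp add: eval_nat_numeral)
  qed
  then have "?T \<noteq> 0" using nz by auto
  with integrability_norm2_nonneg[OF t c z] have T: "?T > 0" by linarith
  have "?u ^ 4 = ?u powr 4" using u by simp
  then have "(?T * ?u ^ 4) powr (1/4) = ?T powr (1/4) * (?u powr 4) powr (1/4)"
    using u T by (simp add: powr_mult)
  also have "(?u powr 4) powr (1/4) = ?u" unfolding powr_powr using u by simp
  finally have "(?T * ?u ^ 4) powr (1/4) = ?T powr (1/4) * ?u" .
  moreover have "sqrt ?T powr (- 1/2) = ?T powr (- (1/4))"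
    unfolding powr_half_sqrt[OF integrability_norm2_nonneg[OF t c z], symmetric] powr_powr by simp
  moreover have "?T powr (1/4) * ?T powr (- (1/4)) = 1"
    using powr_add[of ?T "1/4" "- (1/4)"] T by simp
  ultimately show ?thesis unfolding P by (simp add: mult.assoc mult.left_commute mult.commute)
qed

end

theorem proposition2:
  fixes A :: "('a::{t2_space, second_countable_topology}, 'p::finite, 'n::finite) chart set"
    and g :: "real \<Rightarrow> ('a, 'p, 'n) metric"
    and \<Phi> :: "'a \<Rightarrow> real"
    and t0 :: ereal
  defines "n \<equiv> real CARD('n)"
    and "J \<equiv> time_interval t0"
  assumes "closed_foliated_manifold A"
    and "\<forall>k. riemannian_metric k A (g 0)"
    and "harmonic A (g 0)"
    and "leafwise_constant A \<Phi>"
    and "0 < t0"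
    and "Sc_mix_flow A J \<Phi> g"
  shows
    "(\<forall>t\<in>J. \<forall>c\<in>A. \<forall>z\<in>cimg c. \<exists>H'.
        ((\<lambda>s. mean_curv (g s c) z) has_vector_derivative H') (at t within J) \<and>
        H' + grad_leaf (g t c) (\<lambda>w. sqnorm (g t c) w (mean_curv (g t c) w)) z =
          n *\<^sub>R grad_leaf (g t c) (div_leaf (g t c) (mean_curv (g t c))) z
          + n *\<^sub>R grad_leaf (g t c) (\<lambda>w. integrability_norm2 (g t c) w
                - leaf_sff_norm2 (g t c) w - n * beta_D (g t c) w) z)
     \<and>
     (\<forall>u0. leaf_smooth A u0 \<and> log_potential A (g 0) u0 \<longrightarrow>
        (\<exists>u. leaf_smooth_family A J u \<and> (\<forall>t\<in>J. log_potential A (g t) (u t)))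
        \<and>
        ((\<forall>c\<in>A. \<forall>z\<in>cimg c. Psi2 (g 0) u0 c z \<noteq> 0) \<longrightarrow>
          (\<exists>u. leaf_smooth_family A J u \<and> (\<forall>t\<in>J. log_potential A (g t) (u t)) \<and> u 0 = u0 \<and>
            (\<forall>t\<in>J. \<forall>c\<in>A. \<forall>z\<in>cimg c.
               u t (cinv c z) = Psi2 (g 0) u0 c z powr (1/4)
                 * sqrt (integrability_norm2 (g t c) z) powr (- 1/2)) \<and>
            (\<forall>t\<in>J. \<forall>c\<in>A. \<forall>z\<in>cimg c. \<exists>u'.
               ((\<lambda>s. u s (cinv c z)) has_real_derivative u') (at t within J) \<and>
               1 / n * u' = laplace_leaf (g t c) (\<lambda>w. u t (cinv c w)) z
                 + (beta_D (g t c) z + \<Phi> (cinv c z) / n) * u t (cinv c z)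
                 + Psi1 (g 0) u0 c z / n * inverse (u t (cinv c z))
                 - Psi2 (g 0) u0 c z / n * inverse (u t (cinv c z)) ^ 3)))
        \<and>
        ((\<forall>c\<in>A. \<forall>z\<in>cimg c. Psi1 (g 0) u0 c z = 0 \<and> Psi2 (g 0) u0 c z = 0) \<longrightarrow>
          (\<exists>u. leaf_smooth_family A J u \<and> (\<forall>t\<in>J. log_potential A (g t) (u t)) \<and> u 0 = u0 \<and>
            (\<forall>t\<in>J. \<forall>c\<in>A. \<forall>z\<in>cimg c. \<exists>u'.
               ((\<lambda>s. u s (cinv c z)) has_real_derivative u') (at t within J) \<and>
               1 / n * u' = laplace_leaf (g t c) (\<lambda>w. u t (cinv c w)) z
                 + beta_D (g t c) z * u t (cinv c z)))))"
proof -
  interpret mixed_scalar_flow A g \<Phi> t0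
    by standard (use assms(3-) in \<open>auto simp: J_def\<close>)
  have pot: "leaf_smooth_family A J (potential \<kappa> u0)" "\<forall>t\<in>J. log_potential A (g t) (potential \<kappa> u0 t)"
    if "leaf_smooth A u0" "log_potential A (g 0) u0" for \<kappa> u0
    using potential_smooth[OF that(1)] potential_log_potential[OF that] by (auto simp: J_def)
  have evolution: "\<exists>u'. ((\<lambda>s. potential \<kappa> u0 s (cinv c z)) has_real_derivative u') (at t within J) \<and>
      1 / n * u' = laplace_leaf (g t c) (\<lambda>w. potential \<kappa> u0 t (cinv c w)) z
        + (beta_D (g t c) z + (1 - \<kappa>) * \<Phi> (cinv c z) / n) * potential \<kappa> u0 t (cinv c z)
        + leaf_sff_norm2 (g t c) z / n * potential \<kappa> u0 t (cinv c z)
        - integrability_norm2 (g t c) z / n * potential \<kappa> u0 t (cinv c z)"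
    if u0: "leaf_smooth A u0" "log_potential A (g 0) u0" and tcz: "t \<in> J" "c \<in> A" "z \<in> cimg c" for \<kappa> u0 t c z
  proof (intro exI conjI)
    have t: "t \<in> time_interval t0" using tcz(1) by (simp add: J_def)
    show "((\<lambda>s. potential \<kappa> u0 s (cinv c z)) has_real_derivative
        - (Sc_mix (g t c) z - \<Phi> (cinv c z) + \<kappa> * \<Phi> (cinv c z)) * potential \<kappa> u0 t (cinv c z)) (at t within J)"
      unfolding J_def by (rule potential_flow[OF t tcz(2,3)])
    show "1 / n * (- (Sc_mix (g t c) z - \<Phi> (cinv c z) + \<kappa> * \<Phi> (cinv c z)) * potential \<kappa> u0 t (cinv c z)) =
        laplace_leaf (g t c) (\<lambda>w. potential \<kappa> u0 t (cinv c w)) z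
        + (beta_D (g t c) z + (1 - \<kappa>) * \<Phi> (cinv c z) / n) * potential \<kappa> u0 t (cinv c z)
        + leaf_sff_norm2 (g t c) z / n * potential \<kappa> u0 t (cinv c z)
        - integrability_norm2 (g t c) z / n * potential \<kappa> u0 t (cinv c z)"
      unfolding n_def potential_heat_equation[OF u0 t tcz(2,3), symmetric]
      by (simp only: mult_minus_left mult_minus_right mult.assoc)
  qed
  show ?thesis
  proof (intro conjI ballI allI impI; (elim conjE)?)
    fix t c z assume "t \<in> J" "c \<in> A" "z \<in> cimg c"
    then show "\<exists>H'. ((\<lambda>s. mean_curv (g s c) z) has_vector_derivative H') (at t within J) \<and>
        H' + grad_leaf (g t c) (\<lambda>w. sqnorm (g t c) w (mean_curv (g t c) w)) z =
          n *\<^sub>R grad_leaf (g t c) (div_leaf (g t c) (mean_curv (g t c))) z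
          + n *\<^sub>R grad_leaf (g t c) (\<lambda>w. integrability_norm2 (g t c) w
                - leaf_sff_norm2 (g t c) w - n * beta_D (g t c) w) z"
      unfolding n_def J_def by (rule mean_curv_evolution)
  next
    fix u0 assume u0: "leaf_smooth A u0" "log_potential A (g 0) u0"
    then have pos: "\<forall>x. u0 x > 0" by (simp add: log_potential_def)
    show "\<exists>u. leaf_smooth_family A J u \<and> (\<forall>t\<in>J. log_potential A (g t) (u t))"
      using pot[OF u0] by blast
    {
      \<comment> \<open>The potential itself; its nonlinear terms are the norms of \<open>h\<^sub>F\<close> and \<open>T\<close>.\<close>
      assume Psi2: "\<forall>c\<in>A. \<forall>z\<in>cimg c. Psi2 (g 0) u0 c z \<noteq> 0"
      show "\<exists>u. leaf_smooth_family A J u \<and> (\<forall>t\<in>J. log_potential A (g t) (u t)) \<and> u 0 = u0 \<and>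
            (\<forall>t\<in>J. \<forall>c\<in>A. \<forall>z\<in>cimg c.
               u t (cinv c z) = Psi2 (g 0) u0 c z powr (1/4)
                 * sqrt (integrability_norm2 (g t c) z) powr (- 1/2)) \<and>
            (\<forall>t\<in>J. \<forall>c\<in>A. \<forall>z\<in>cimg c. \<exists>u'.
               ((\<lambda>s. u s (cinv c z)) has_real_derivative u') (at t within J) \<and>
               1 / n * u' = laplace_leaf (g t c) (\<lambda>w. u t (cinv c w)) z
                 + (beta_D (g t c) z + \<Phi> (cinv c z) / n) * u t (cinv c z)
                 + Psi1 (g 0) u0 c z / n * inverse (u t (cinv c z))
                 - Psi2 (g 0) u0 c z / n * inverse (u t (cinv c z)) ^ 3)"
      proof (intro exI[of _ "potential 0 u0"] conjI ballI pot(1)[OF u0])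
        show "log_potential A (g t) (potential 0 u0 t)" if "t \<in> J" for t
          using pot(2)[OF u0] that by blast
        show "potential 0 u0 0 = u0" by (rule potential_zero)
        fix t c z assume tcz: "t \<in> J" "c \<in> A" "z \<in> cimg c"
        then have t: "t \<in> time_interval t0" by (simp add: J_def)
        show "potential 0 u0 t (cinv c z) = Psi2 (g 0) u0 c z powr (1/4)
            * sqrt (integrability_norm2 (g t c) z) powr (- 1/2)"
          using Psi2 tcz by (intro potential_by_integrability[OF pos t]) auto
        note terms = potential_nonlinear_terms[OF pos t tcz(2,3)]
        show "\<exists>u'. ((\<lambda>s. potential 0 u0 s (cinv c z)) has_real_derivative u') (at t within J) \<and>
               1 / n * u' = laplace_leaf (g t c) (\<lambda>w. potential 0 u0 t (cinv c w)) z
                 + (beta_D (g t c) z + \<Phi> (cinv c z) / n) * potential 0 u0 t (cinv c z)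
                 + Psi1 (g 0) u0 c z / n * inverse (potential 0 u0 t (cinv c z))
                 - Psi2 (g 0) u0 c z / n * inverse (potential 0 u0 t (cinv c z)) ^ 3"
          using evolution[OF u0 tcz, of 0] by (simp only: times_divide_eq_left terms) simp
      qed
    next
      \<comment> \<open>Here \<open>h\<^sub>F = 0\<close> and \<open>T = 0\<close> at all times, and \<open>\<kappa> = 1\<close> removes \<open>\<Phi>\<close>.\<close>
      assume Psi: "\<forall>c\<in>A. \<forall>z\<in>cimg c. Psi1 (g 0) u0 c z = 0 \<and> Psi2 (g 0) u0 c z = 0"
      show "\<exists>u. leaf_smooth_family A J u \<and> (\<forall>t\<in>J. log_potential A (g t) (u t)) \<and> u 0 = u0 \<and>
            (\<forall>t\<in>J. \<forall>c\<in>A. \<forall>z\<in>cimg c. \<exists>u'.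
               ((\<lambda>s. u s (cinv c z)) has_real_derivative u') (at t within J) \<and>
               1 / n * u' = laplace_leaf (g t c) (\<lambda>w. u t (cinv c w)) z
                 + beta_D (g t c) z * u t (cinv c z))"
      proof (intro exI[of _ "potential 1 u0"] conjI ballI pot(1)[OF u0])
        show "log_potential A (g t) (potential 1 u0 t)" if "t \<in> J" for t
          using pot(2)[OF u0] that by blast
        show "potential 1 u0 0 = u0" by (rule potential_zero)
        fix t c z assume tcz: "t \<in> J" "c \<in> A" "z \<in> cimg c"
        then have t: "t \<in> time_interval t0" by (simp add: J_def)
        have "potential 0 u0 t (cinv c z) > 0" by (rule potential_pos[OF t pos])
        then have "leaf_sff_norm2 (g t c) z = 0" "integrability_norm2 (g t c) z = 0"
          using potential_nonlinear_terms[OF pos t tcz(2,3)] Psi tcz by auto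
        then show "\<exists>u'. ((\<lambda>s. potential 1 u0 s (cinv c z)) has_real_derivative u') (at t within J) \<and>
               1 / n * u' = laplace_leaf (g t c) (\<lambda>w. potential 1 u0 t (cinv c w)) z
                 + beta_D (g t c) z * potential 1 u0 t (cinv c z)"
          using evolution[OF u0 tcz, of 1] by simp
      qed
    }
  qed
qed

end
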